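(* Let $c>0$, $N,m_1,m_2\ge1$ integers, $D\subseteq\mathbb{R}^{m_1}$ compact, $U\subseteq\mathbb{R}^{m_2}$ locally compact with $0\in U$, $W=D\times U$, $a\in C^0(\mathbb{R}^N\times[0,1];\mathbb{R})$ locally Lipschitz, $g_i\in C^0([0,1];\mathbb{R})$, and $G,K_1,\dots,K_N:W\times L^\infty((0,1];\mathbb{R})\to\mathbb{R}$ satisfying: (A1) there exist non-decreasing $L,\sigma:\mathbb{R}_+\to\mathbb{R}_+$ such that for all $R\ge0$, $h\in(0,1)$, $w\in W$ with $|w|\le R$, $x,y\in L^\infty((0,1];[-R,R])$: $|G(w,x)-G(w,y)|+\sum_i|K_i(w,x)-K_i(w,y)|\le L(R)h\sup_{0<z\le h}|x(z)-y(z)|+L(R)\sup_{h<z\le1}|x(z)-y(z)|$ and $|G(w,x)|+\sum_i|K_i(w,x)|\le\sigma(R)$; (A2) for every $\delta>0$, $(p,v)\in L^\infty([-c^{-1},\delta);\mathbb{R}^{N+1})$, $w\in L^\infty([0,\delta);W)$, the function equal to $(p,v)$ a.e. on $[-c^{-1},0)$ and to $t\mapsto F(w(t),p_t,v_t)$ a.e. on $[0,\delta)$ belongs to $L^\infty([-c^{-1},\delta);\mathbb{R}^{N+1})$; (A3) there exists $b\in K_\infty$ with $|G(d,u,x)|+\sum_i|K_i(d,u,x)|\le b(\max(|u|,\sup_{0\le z\le1}|x(z)|))$ for all $x\in L^\infty([0,1];\mathbb{R})$, $d\in D$, $u\in U$. Assume there exist a continuous, positive definite and radially unbounded function $W:\mathbb{R}^{N+1}\to\mathbb{R}_+$,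 a continuous non-decreasing function $\gamma:\mathbb{R}_+\to\mathbb{R}_+$ and a constant $\lambda\in(0,1)$ such that for all $(p,v)\in L^\infty([-c^{-1},0);\mathbb{R}^{N+1})$, $d\in D$, $u\in U$: $$W(F(d,u,p,v))\le\lambda\sup_{-c^{-1}\le s<0}W(p(s),v(s))+\gamma(|u|).$$ Then the PDE system is ISS from the input $u\in U$ uniformly in $d\in D$.
   Context: The PDE system is formally $\partial_t x(t,z)+c\,\partial_z x(t,z)=a(p(t),z)x(t,z)+g(z)p(t)$, $t>0$, $z\in(0,1)$; $p_i(t)=K_i(d(t),u(t),x_t)$; $x(t,0)=G(d(t),u(t),x_t)$, with $x_t(z)=x(t,z)$, $g(z)p=\sum_ig_i(z)p_i$, $w=(d,u)$. $L^\infty,L^\infty_{loc}$: (locally) essentially bounded measurable functions; suprema of measurable functions are essential suprema. $q_t(s)=q(t+s)$, $s\in[-c^{-1},0)$. $K_\infty$: continuous strictly increasing unbounded functions $\mathbb{R}_+\to\mathbb{R}_+$ vanishing at $0$. $F$: for $(p,v)\in L^\infty([-c^{-1},0);\mathbb{R}^{N+1})$ let $X(p,v)(z)=\exp\big(\int_{-c^{-1}z}^0a(p(q),z+cq)dq\big)v(-c^{-1}z)+\int_{-c^{-1}z}^0\exp\big(\int_s^0a(p(q),z+cq)dq\big)g(z+cs)p(s)ds$, $z\in(0,1]$, and $F(d,u,p,v)=(K_1(d,u,X(p,v)),\dots,K_N(d,u,X(p,v)),G(d,u,X(p,v)))$. Solution: given $x_0\in L^\infty([0,1];\mathbb{R})$,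 $w\in L^\infty_{loc}([0,\infty);W)$, a solution on $[0,T)$ is a locally bounded map $t\mapsto x_t\in L^\infty([0,1];\mathbb{R})$ such that with $p_i(t)=K_i(w(t),x_t)$, $v(t)=G(w(t),x_t)$, $(p,v)\in L^\infty_{loc}([0,T);\mathbb{R}^{N+1})$ and for all $t\in[0,T)$, a.e. $z$: $x(t,z)=\int_{\max(0,t-c^{-1}z)}^t\exp\big(\int_\tau^ta(p(s),z+c(s-t))ds\big)g(z+c(\tau-t))p(\tau)d\tau+\exp\big(\int_{\max(0,t-c^{-1}z)}^ta(p(s),z+c(s-t))ds\big)\cdot\big(v(t-c^{-1}z)$ if $z\le ct$; $x_0(z-ct)$ if $z>ct\big)$; the unique maximal one is called the solution. ISS: every solution (for all $x_0\in L^\infty([0,1];\mathbb{R})$, $d\in L^\infty([0,\infty);D)$, $u\in L^\infty_{loc}([0,\infty);U)$) exists for all $t\ge0$, and there is a continuous non-decreasing $\tilde\gamma$ such that, with $|x|_\infty=\sup_{0\le z\le1}|x(z)|$ and suprema over all such $d,u$: for every $\varepsilon>0$, $\sup\{|x_t|_\infty-\sup_{0\le s\le t}\tilde\gamma(|u(s)|):t\ge0,|x_0|_\infty\le\varepsilon\}<+\infty$; for every $\varepsilon>0$ there is $\delta>0$ with $\sup\{|x_t|_\infty-\sup_{0\le s\le t}\tilde\gamma(|u(s)|):t\ge0,|x_0|_\infty\le\delta\}<\varepsilon$; for every $\varepsilon>0$, $R\ge0$ there is $\tau>0$ with $\sup\{|x_t|_\infty-\sup_{0\le s\le t}\tilde\gamma(|u(s)|):t\ge\tau,|x_0|_\infty\le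 R\}<\varepsilon$. *)

theory Defs
  imports "HOL-Analysis.Analysis"
begin

(* Elements of L^infinity(S) are represented by functions together with the predicate
   linf_on S: Lebesgue measurable on S and essentially bounded on S. *)
definition linf_on :: "real set \<Rightarrow> (real \<Rightarrow> 'a::real_normed_vector) \<Rightarrow> bool" where
  "linf_on S f \<longleftrightarrow> set_borel_measurable lebesgue S f \<and>
     (\<exists>B. AE t in lebesgue. t \<in> S \<longrightarrow> norm (f t) \<le> B)"

(* Essential supremum over S of a (nonnegative) real function; the infimum is taken over
   nonnegative bounds, so that the essential supremum over a null set is 0. *)
definition esup :: "real set \<Rightarrow> (real \<Rightarrow> real) \<Rightarrow> real" where
  "esup S f = Inf {B. 0 \<le> B \<and> (AE t in lebesgue. t \<in> S \<longrightarrow> f t \<le> B)}"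

definition K_inf :: "(real \<Rightarrow> real) \<Rightarrow> bool" where
  "K_inf b \<longleftrightarrow> continuous_on {0..} b \<and> strict_mono_on {0..} b \<and> b 0 = 0 \<and>
     filterlim b at_top at_top"

definition Xmap :: "real \<Rightarrow> (real^'n \<Rightarrow> real \<Rightarrow> real) \<Rightarrow> ('n::finite \<Rightarrow> real \<Rightarrow> real)
    \<Rightarrow> (real \<Rightarrow> real^'n) \<Rightarrow> (real \<Rightarrow> real) \<Rightarrow> real \<Rightarrow> real" where
  "Xmap c a g p v z =
     exp (integral {-z/c..0} (\<lambda>q. a (p q) (z + c * q))) * v (-z/c)
     + integral {-z/c..0} (\<lambda>s. exp (integral {s..0} (\<lambda>q. a (p q) (z + c * q)))
                                 * (\<Sum>i\<in>UNIV. g i (z + c * s) * (p s) $ i))"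

definition Fmap :: "real \<Rightarrow> (real^'n \<Rightarrow> real \<Rightarrow> real) \<Rightarrow> ('n::finite \<Rightarrow> real \<Rightarrow> real)
    \<Rightarrow> ('n \<Rightarrow> ('d \<times> 'u) \<Rightarrow> (real \<Rightarrow> real) \<Rightarrow> real) \<Rightarrow> (('d \<times> 'u) \<Rightarrow> (real \<Rightarrow> real) \<Rightarrow> real)
    \<Rightarrow> 'd \<Rightarrow> 'u \<Rightarrow> (real \<Rightarrow> real^'n) \<Rightarrow> (real \<Rightarrow> real) \<Rightarrow> (real^'n) \<times> real" where
  "Fmap c a g K G d u p v =
     (let X = Xmap c a g p v in ((\<chi> i. K i (d, u) X), G (d, u) X))"

definition is_global_sol :: "real \<Rightarrow> (real^'n \<Rightarrow> real \<Rightarrow> real) \<Rightarrow> ('n::finite \<Rightarrow> real \<Rightarrow> real)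
    \<Rightarrow> ('n \<Rightarrow> ('d \<times> 'u) \<Rightarrow> (real \<Rightarrow> real) \<Rightarrow> real) \<Rightarrow> (('d \<times> 'u) \<Rightarrow> (real \<Rightarrow> real) \<Rightarrow> real)
    \<Rightarrow> (real \<Rightarrow> real) \<Rightarrow> (real \<Rightarrow> 'd) \<Rightarrow> (real \<Rightarrow> 'u) \<Rightarrow> (real \<Rightarrow> real \<Rightarrow> real) \<Rightarrow> bool" where
  "is_global_sol c a g K G x0 d u x \<longleftrightarrow>
     (\<forall>t\<ge>0. linf_on {0..1} (x t)) \<and>
     (\<forall>T\<ge>0. \<exists>B. \<forall>t\<in>{0..T}. esup {0..1} (\<lambda>z. \<bar>x t z\<bar>) \<le> B) \<and>
     (let p = (\<lambda>t. \<chi> i. K i (d t, u t) (x t));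
          v = (\<lambda>t. G (d t, u t) (x t)) in
       (\<forall>T\<ge>0. linf_on {0..T} (\<lambda>t. (p t, v t))) \<and>
       (\<forall>t\<ge>0. AE z in lebesgue. z \<in> {0..1} \<longrightarrow>
          x t z =
            integral {max 0 (t - z/c)..t}
              (\<lambda>\<tau>. exp (integral {\<tau>..t} (\<lambda>s. a (p s) (z + c * (s - t))))
                     * (\<Sum>i\<in>UNIV. g i (z + c * (\<tau> - t)) * (p \<tau>) $ i))
            + exp (integral {max 0 (t - z/c)..t} (\<lambda>s. a (p s) (z + c * (s - t))))
              * (if z \<le> c * t then v (t - z/c) else x0 (z - c * t))))"

definition adm_inputs :: "'d::real_normed_vector set \<Rightarrow> 'u::real_normed_vector set
    \<Rightarrow> (real \<Rightarrow> 'd) \<Rightarrow> (real \<Rightarrow> 'u) \<Rightarrow> bool" where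
  "adm_inputs D U d u \<longleftrightarrow>
     linf_on {0..} d \<and> (\<forall>t\<ge>0. d t \<in> D) \<and>
     (\<forall>T\<ge>0. linf_on {0..T} u) \<and> (\<forall>t\<ge>0. u t \<in> U)"

definition iss_vals :: "real \<Rightarrow> (real^'n \<Rightarrow> real \<Rightarrow> real) \<Rightarrow> ('n::finite \<Rightarrow> real \<Rightarrow> real)
    \<Rightarrow> ('n \<Rightarrow> ('d \<times> 'u) \<Rightarrow> (real \<Rightarrow> real) \<Rightarrow> real) \<Rightarrow> (('d \<times> 'u) \<Rightarrow> (real \<Rightarrow> real) \<Rightarrow> real)
    \<Rightarrow> 'd::real_normed_vector set \<Rightarrow> 'u::real_normed_vector set \<Rightarrow> (real \<Rightarrow> real)
    \<Rightarrow> real \<Rightarrow> real \<Rightarrow> ereal set" where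
  "iss_vals c a g K G D U gt T0 r =
     {ereal (esup {0..1} (\<lambda>z. \<bar>x t z\<bar>) - esup {0..t} (\<lambda>s. gt (norm (u s)))) | t x0 d u x.
        T0 \<le> t \<and> linf_on {0..1} x0 \<and> esup {0..1} (\<lambda>z. \<bar>x0 z\<bar>) \<le> r \<and>
        adm_inputs D U d u \<and> is_global_sol c a g K G x0 d u x}"

definition ISS :: "real \<Rightarrow> (real^'n \<Rightarrow> real \<Rightarrow> real) \<Rightarrow> ('n::finite \<Rightarrow> real \<Rightarrow> real)
    \<Rightarrow> ('n \<Rightarrow> ('d \<times> 'u) \<Rightarrow> (real \<Rightarrow> real) \<Rightarrow> real) \<Rightarrow> (('d \<times> 'u) \<Rightarrow> (real \<Rightarrow> real) \<Rightarrow> real)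
    \<Rightarrow> 'd::real_normed_vector set \<Rightarrow> 'u::real_normed_vector set \<Rightarrow> bool" where
  "ISS c a g K G D U \<longleftrightarrow>
     (\<forall>x0 d u. linf_on {0..1} x0 \<and> adm_inputs D U d u \<longrightarrow>
        (\<exists>x. is_global_sol c a g K G x0 d u x)) \<and>
     (\<exists>gt. continuous_on {0..} gt \<and> mono_on {0..} gt \<and> (\<forall>s\<ge>0. 0 \<le> gt s) \<and>
        (\<forall>\<epsilon>>0. Sup (iss_vals c a g K G D U gt 0 \<epsilon>) < \<infinity>) \<and>
        (\<forall>\<epsilon>>0. \<exists>\<delta>>0. Sup (iss_vals c a g K G D U gt 0 \<delta>) < ereal \<epsilon>) \<and>
        (\<forall>\<epsilon>>0. \<forall>R\<ge>0. \<exists>\<tau>>0. Sup (iss_vals c a g K G D U gt \<tau> R) < ereal \<epsilon>))"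

end

theory Submission
  imports Defs
begin

text \<open>The initial profile \<open>x0\<close> can be encoded as a past of the pair \<open>(p, v)\<close> (with \<open>p = 0\<close>), so that
  solutions of the PDE system correspond to functions \<open>y = (p, v)\<close> on \<open>[-1/c, \<infinity>)\<close> with the given
  past and \<open>y(t) = F(d(t), u(t), y\<^sub>t)\<close> for \<open>t \<ge> 0\<close>.

  Existence: the Picard iterates stay in a sublevel set of the Lyapunov function by the small-gain
  inequality, and on it \<open>F\<close> is a contraction in an exponentially weighted supremum norm, so the
  iterates converge on every bounded time interval.

  Stability: with \<open>\<Gamma>\<close> the essential supremum of \<open>\<gamma>(|u|)\<close> up to time \<open>t\<close>, every delay \<open>1/c\<close> that elapses
  contracts the Lyapunov function by \<open>\<lambda>\<close> up to \<open>\<Gamma>\<close>, so it is at most \<open>\<lambda>\<^sup>k M\<^sub>0 + \<Gamma>/(1 - \<lambda>)\<close> after time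
  \<open>k/c\<close>. A bound on the past of \<open>y\<close> bounds the profile, and a continuous majorant of the resulting
  function of \<open>\<Gamma>\<close> gives the gain.\<close>

subsection \<open>Essentially bounded functions and integrals\<close>

text \<open>The factor h in the Lipschitz hypothesis takes the place of the missing delay. A second
  obstacle is the mixture of pointwise and almost-everywhere information. The equation for y is
  posed at every t, while inputs and profiles matter only modulo null sets. Existence is therefore
  proved for data that are bounded everywhere, where all iterates obey pointwise bounds, and is then
  transferred along almost-everywhere equalities. A third obstacle concerns the gain. The estimate
  yields a function of an essential supremum, whereas ISS asks for the essential supremum of a
  function of |u|, and the radius of a sublevel set need not depend continuously on its level. A
  majorant taken with a shift of one unit settles both problems at once.\<close>

text \<open>The exceptional set is contained in the image of a null set under the inverse affine
  map, and differentiable images of null sets are null.\<close>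

lemma AE_lebesgue_affine:
  fixes m b :: real
  assumes m: "m \<noteq> 0" and P: "AE x in lebesgue. P x"
  shows "AE x in lebesgue. P (m * x + b)"
proof -
  obtain N where N: "N \<in> null_sets lebesgue" "{x. \<not> P x} \<subseteq> N"
    using P by (auto simp: eventually_ae_filter)
  let ?f = "\<lambda>x. (x - b) / m"
  have "negligible N" using N(1) by (simp add: negligible_iff_null_sets)
  then have "negligible (?f ` N)"
    by (rule negligible_differentiable_image_negligible[rotated])
      (use m in \<open>auto simp: differentiable_on_def intro!: derivative_intros\<close>)
  moreover have "{x. \<not> P (m * x + b)} \<subseteq> ?f ` N"
  proof
    fix x assume "x \<in> {x. \<not> P (m * x + b)}"
    then have "m * x + b \<in> N" using N(2) by auto
    moreover have "x = ?f (m * x + b)" using m by (simp add: field_simps)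
    ultimately show "x \<in> ?f ` N" by (rule image_eqI[rotated])
  qed
  ultimately show ?thesis
    by (auto simp: negligible_iff_null_sets intro: AE_I')
qed

lemma AE_lebesgue_translate:
  fixes t :: real
  assumes "AE s in lebesgue. P s"
  shows "AE s in lebesgue. P (t + s)"
  using AE_lebesgue_affine[of 1 P t] assms by (simp add: add.commute)

lemma measurable_lebesgue_affine:
  fixes m b :: real and f :: "real \<Rightarrow> 'a::topological_space"
  assumes "m \<noteq> 0" "f \<in> borel_measurable lebesgue"
  shows "(\<lambda>x. f (m * x + b)) \<in> borel_measurable lebesgue"
proof -
  have "(\<lambda>x. b + m * x) \<in> lebesgue \<rightarrow>\<^sub>M lebesgue"
    using lebesgue_affine_measurable[where c= "\<lambda>x::real. m" and t = b] assms(1) by simp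
  from measurable_compose[OF this assms(2)] show ?thesis by (simp add: add.commute)
qed

lemma borel_measurable_lebesgue_continuous:
  fixes f :: "real \<Rightarrow> 'a::topological_space"
  shows "continuous_on UNIV f \<Longrightarrow> f \<in> borel_measurable lebesgue"
  by (intro measurable_completion) (simp add: borel_measurable_continuous_onI)

lemma linf_on_subset:
  fixes f :: "real \<Rightarrow> 'a::euclidean_space"
  assumes "linf_on S f" "T \<subseteq> S" "T \<in> sets lebesgue"
  shows "linf_on T f"
proof -
  have "set_borel_measurable lebesgue T f"
    using assms by (intro set_borel_measurable_subset[of lebesgue S f T]) (auto simp: linf_on_def)
  moreover from assms obtain B where "AE t in lebesgue. t \<in> S \<longrightarrow> norm (f t) \<le> B"
    by (auto simp: linf_on_def)
  then have "AE t in lebesgue. t \<in> T \<longrightarrow> norm (f t) \<le> B"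
    by eventually_elim (use assms in auto)
  ultimately show ?thesis unfolding linf_on_def by blast
qed

lemma linf_on_affine:
  fixes m b :: real and f :: "real \<Rightarrow> 'a::euclidean_space"
  assumes m: "m \<noteq> 0" and f: "linf_on S f"
  shows "linf_on {x. m * x + b \<in> S} (\<lambda>x. f (m * x + b))"
proof -
  have "(\<lambda>x. indicat_real S x *\<^sub>R f x) \<in> borel_measurable lebesgue"
    using f by (auto simp: linf_on_def set_borel_measurable_def)
  from measurable_lebesgue_affine[OF m this, of b]
  have "set_borel_measurable lebesgue {x. m * x + b \<in> S} (\<lambda>x. f (m * x + b))"
    by (simp add: set_borel_measurable_def indicator_def)
  moreover from f obtain B where "AE t in lebesgue. t \<in> S \<longrightarrow> norm (f t) \<le> B"
    by (auto simp: linf_on_def)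
  from AE_lebesgue_affine[OF m this, of b]
  have "\<exists>B. AE t in lebesgue. t \<in> {x. m * x + b \<in> S} \<longrightarrow> norm (f (m * t + b)) \<le> B" by auto
  ultimately show ?thesis unfolding linf_on_def by blast
qed

lemma linf_on_shift:
  fixes t :: real and f :: "real \<Rightarrow> 'a::euclidean_space"
  assumes "linf_on {\<alpha> + t..<\<beta> + t} f"
  shows "linf_on {\<alpha>..<\<beta>} (\<lambda>s. f (t + s))"
proof -
  have "{x. 1 * x + t \<in> {\<alpha> + t..<\<beta> + t}} = {\<alpha>..<\<beta>}" by auto
  with linf_on_affine[of 1 "{\<alpha> + t..<\<beta> + t}" f t] assms show ?thesis
    by (simp add: add.commute)
qed

lemma linf_on_cong_AE:
  fixes f g :: "real \<Rightarrow> 'a::euclidean_space"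
  assumes f: "linf_on S f" and ae: "AE t in lebesgue. t \<in> S \<longrightarrow> f t = g t"
  shows "linf_on S g"
proof -
  have "AE x in lebesgue. indicat_real S x *\<^sub>R f x = indicat_real S x *\<^sub>R g x"
    using ae by eventually_elim (auto simp: indicator_def)
  with f have "set_borel_measurable lebesgue S g"
    unfolding linf_on_def set_borel_measurable_def by (intro borel_measurable_AE[of _ "\<lambda>x. indicat_real S x *\<^sub>R g x"]) auto
  moreover from f obtain B where "AE t in lebesgue. t \<in> S \<longrightarrow> norm (f t) \<le> B"
    by (auto simp: linf_on_def)
  then have "AE t in lebesgue. t \<in> S \<longrightarrow> norm (g t) \<le> B"
    using ae by eventually_elim auto
  ultimately show ?thesis unfolding linf_on_def by blast
qed

lemma linf_on_Pair_iff:
  fixes f :: "real \<Rightarrow> 'a::euclidean_space" and g :: "real \<Rightarrow> 'b::euclidean_space"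
  shows "linf_on S (\<lambda>t. (f t, g t)) \<longleftrightarrow> linf_on S f \<and> linf_on S g"
proof
  assume L: "linf_on S (\<lambda>t. (f t, g t))"
  then have m: "(\<lambda>x. indicat_real S x *\<^sub>R (f x, g x)) \<in> borel_measurable lebesgue"
    by (auto simp: linf_on_def set_borel_measurable_def)
  have "(\<lambda>x. fst (indicat_real S x *\<^sub>R (f x, g x))) \<in> borel_measurable lebesgue"
    by (rule borel_measurable_continuous_on[OF _ m]) (intro continuous_intros)
  moreover have "(\<lambda>x. snd (indicat_real S x *\<^sub>R (f x, g x))) \<in> borel_measurable lebesgue"
    by (rule borel_measurable_continuous_on[OF _ m]) (intro continuous_intros)
  moreover from L obtain B where B: "AE t in lebesgue. t \<in> S \<longrightarrow> norm (f t, g t) \<le> B"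
    by (auto simp: linf_on_def)
  moreover have "AE t in lebesgue. t \<in> S \<longrightarrow> norm (f t) \<le> B"
    using B by eventually_elim (use order_trans[OF norm_fst_le] in blast)
  moreover have "AE t in lebesgue. t \<in> S \<longrightarrow> norm (g t) \<le> B"
    using B by eventually_elim (use order_trans[OF norm_snd_le] in blast)
  ultimately show "linf_on S f \<and> linf_on S g"
    unfolding linf_on_def set_borel_measurable_def by auto
next
  assume L: "linf_on S f \<and> linf_on S g"
  then have "(\<lambda>x. (indicat_real S x *\<^sub>R f x, indicat_real S x *\<^sub>R g x)) \<in> borel_measurable lebesgue"
    unfolding linf_on_def set_borel_measurable_def by (intro borel_measurable_Pair) auto
  moreover from L obtain A B where "AE t in lebesgue. t \<in> S \<longrightarrow> norm (f t) \<le> A"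
      "AE t in lebesgue. t \<in> S \<longrightarrow> norm (g t) \<le> B"
    by (auto simp: linf_on_def)
  then have "AE t in lebesgue. t \<in> S \<longrightarrow> norm (f t, g t) \<le> A + B"
    by eventually_elim (use order_trans[OF norm_Pair_le add_mono] in blast)
  ultimately show "linf_on S (\<lambda>t. (f t, g t))"
    unfolding linf_on_def set_borel_measurable_def by auto
qed

lemma linf_on_Un:
  fixes f :: "real \<Rightarrow> 'a::euclidean_space"
  assumes "linf_on S f" "linf_on T f" "S \<in> sets lebesgue" "T \<in> sets lebesgue"
  shows "linf_on (S \<union> T) f"
proof -
  from assms obtain A B where "AE t in lebesgue. t \<in> S \<longrightarrow> norm (f t) \<le> A"
      "AE t in lebesgue. t \<in> T \<longrightarrow> norm (f t) \<le> B"
    by (auto simp: linf_on_def)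
  then have "AE t in lebesgue. t \<in> S \<union> T \<longrightarrow> norm (f t) \<le> max A B"
    by eventually_elim auto
  moreover have "(\<lambda>x. if x \<in> S then indicat_real S x *\<^sub>R f x else indicat_real T x *\<^sub>R f x)
      \<in> borel_measurable lebesgue"
    using assms unfolding linf_on_def set_borel_measurable_def
    by (intro measurable_If_set) auto
  then have "set_borel_measurable lebesgue (S \<union> T) f"
    unfolding set_borel_measurable_def by (rule measurable_cong[THEN iffD1, rotated]) (auto simp: indicator_def)
  ultimately show ?thesis unfolding linf_on_def by blast
qed

lemma linf_on_measurable_bounded:
  fixes f :: "real \<Rightarrow> 'a::euclidean_space"
  assumes "f \<in> borel_measurable lebesgue" "S \<in> sets lebesgue"
    "AE t in lebesgue. t \<in> S \<longrightarrow> norm (f t) \<le> B"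
  shows "linf_on S f"
  using assms unfolding linf_on_def set_borel_measurable_def by auto

section \<open>Essential suprema\<close>

lemma esup_nonneg:
  assumes "AE t in lebesgue. t \<in> S \<longrightarrow> f t \<le> B"
  shows "0 \<le> esup S f"
proof -
  have "AE t in lebesgue. t \<in> S \<longrightarrow> f t \<le> max 0 B"
    using assms by eventually_elim auto
  then have "max 0 B \<in> {B. 0 \<le> B \<and> (AE t in lebesgue. t \<in> S \<longrightarrow> f t \<le> B)}" by simp
  then show ?thesis unfolding esup_def by (intro cInf_greatest) blast+
qed

lemma esup_le:
  assumes "0 \<le> B" "AE t in lebesgue. t \<in> S \<longrightarrow> f t \<le> B"
  shows "esup S f \<le> B"
  unfolding esup_def using assms by (intro cInf_lower) (auto intro!: bdd_belowI[of _ 0])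

text \<open>The infimum defining \<open>esup\<close> is attained: each bound
  \<open>esup S f + 1 / Suc n\<close> holds outside a null set, and countably many null sets have a
  null union. The hypothesis keeps the set of bounds nonempty, so that \<open>Inf\<close> is
  meaningful.\<close>

lemma AE_le_esup:
  assumes "AE t in lebesgue. t \<in> S \<longrightarrow> f t \<le> B"
  shows "AE t in lebesgue. t \<in> S \<longrightarrow> f t \<le> esup S f"
proof -
  let ?X = "{B. 0 \<le> B \<and> (AE t in lebesgue. t \<in> S \<longrightarrow> f t \<le> B)}"
  have "AE t in lebesgue. t \<in> S \<longrightarrow> f t \<le> max 0 B"
    using assms by eventually_elim auto
  then have "max 0 B \<in> ?X" by simp
  then have ne: "?X \<noteq> {}" by blast
  have "AE t in lebesgue. t \<in> S \<longrightarrow> f t \<le> esup S f + 1 / Suc n" for n :: nat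
  proof -
    have "Inf ?X < esup S f + 1 / Suc n" unfolding esup_def by simp
    from cInf_lessD[OF ne this] obtain x where "x \<in> ?X" "x < esup S f + 1 / Suc n" by blast
    then show ?thesis by (auto elim!: eventually_mono)
  qed
  then have "AE t in lebesgue. \<forall>n::nat. t \<in> S \<longrightarrow> f t \<le> esup S f + 1 / Suc n"
    by (subst AE_all_countable) blast
  then show ?thesis
  proof eventually_elim
    case (elim t)
    show ?case
    proof
      assume "t \<in> S"
      then have *: "f t \<le> esup S f + 1 / Suc n" for n using elim by auto
      show "f t \<le> esup S f"
      proof (rule field_le_epsilon)
        fix e :: real assume "e > 0"
        then obtain n where "1 / Suc n < e" using nat_approx_posE by blast
        with *[of n] show "f t \<le> esup S f + e" by linarith
      qed
    qed
  qed
qed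

lemma esup_AE_zero:
  assumes "AE t in lebesgue. t \<in> S \<longrightarrow> f t = 0"
  shows "esup S f = 0"
proof (rule antisym)
  have *: "AE t in lebesgue. t \<in> S \<longrightarrow> f t \<le> 0" using assms by eventually_elim auto
  show "esup S f \<le> 0" by (rule esup_le[OF _ *]) simp
  show "0 \<le> esup S f" by (rule esup_nonneg[OF *])
qed

section \<open>Integrals under almost-everywhere hypotheses\<close>

lemma abs_integral_le_AE:
  fixes f h :: "real \<Rightarrow> real"
  assumes ae: "AE s in lebesgue. s \<in> {l..r} \<longrightarrow> \<bar>f s\<bar> \<le> h s"
    and h: "(h has_integral I) {l..r}" and h0: "\<And>s. s \<in> {l..r} \<Longrightarrow> 0 \<le> h s"
  shows "\<bar>integral {l..r} f\<bar> \<le> I"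
proof (cases "f integrable_on {l..r}")
  case True
  obtain N where N: "N \<in> null_sets lebesgue" "{s. \<not> (s \<in> {l..r} \<longrightarrow> \<bar>f s\<bar> \<le> h s)} \<subseteq> N"
    using ae by (auto simp: eventually_ae_filter)
  have negl: "negligible N" using N(1) by (simp add: negligible_iff_null_sets)
  define f' where "f' s = (if s \<in> N then 0 else f s)" for s
  have "f' integrable_on {l..r}"
    by (rule integrable_spike[OF True negl]) (auto simp: f'_def)
  moreover have "integral {l..r} f = integral {l..r} f'"
    by (rule integral_spike[OF negl]) (auto simp: f'_def)
  moreover have "norm (integral {l..r} f') \<le> integral {l..r} h"
    using h \<open>f' integrable_on {l..r}\<close> N(2) h0
    by (intro integral_norm_bound_integral) (auto simp: f'_def)
  ultimately show ?thesis using h by (simp add: integral_unique)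
next
  \<comment> \<open>A non-integrable function has integral 0 by convention, and I is nonnegative
    because h is.\<close>
  case False
  have "0 \<le> I" using has_integral_nonneg[OF h] h0 by blast
  with False show ?thesis by (simp add: not_integrable_integral)
qed

lemma abs_integral_le_const_AE:
  fixes f :: "real \<Rightarrow> real"
  assumes "AE s in lebesgue. s \<in> {l..r} \<longrightarrow> \<bar>f s\<bar> \<le> B" "0 \<le> B" "l \<le> r"
  shows "\<bar>integral {l..r} f\<bar> \<le> B * (r - l)"
  using abs_integral_le_AE[OF assms(1), of "(r - l) * B"] has_integral_const_real[of B l r] assms
  by (simp add: mult.commute)

lemma AE_lebesgue_neq: "AE s in lebesgue. s \<noteq> (x::real)"
  by (rule AE_I'[of "{x}"]) (auto simp flip: negligible_iff_null_sets)

text \<open>The weight integrates over [l, 0] to at most E/\<mu>, however long the interval is. This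
  is the source of the factor 1/\<mu> in the contraction estimate.\<close>

lemma abs_integral_le_exp:
  fixes f :: "real \<Rightarrow> real"
  assumes f: "\<And>s. s \<in> {l..<0} \<Longrightarrow> \<bar>f s\<bar> \<le> E * exp (\<mu> * s) + B"
    and "0 \<le> E" "0 \<le> B" "0 < \<mu>" "l \<le> 0"
  shows "\<bar>integral {l..0} f\<bar> \<le> E / \<mu> + B * (- l)"
proof -
  have I: "((\<lambda>s. E * exp (\<mu> * s) + B) has_integral
      ((E / \<mu> * exp (\<mu> * 0) + B * 0) - (E / \<mu> * exp (\<mu> * l) + B * l))) {l..0}"
    using assms
    by (intro fundamental_theorem_of_calculus)
      (auto intro!: derivative_eq_intros simp flip: has_real_derivative_iff_has_vector_derivative)
  have "AE s in lebesgue. s \<in> {l..0} \<longrightarrow> \<bar>f s\<bar> \<le> E * exp (\<mu> * s) + B"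
    using AE_lebesgue_neq[of 0] by eventually_elim (use f in auto)
  from abs_integral_le_AE[OF this I] assms
  have "\<bar>integral {l..0} f\<bar> \<le> (E / \<mu> * exp (\<mu> * 0) + B * 0) - (E / \<mu> * exp (\<mu> * l) + B * l)"
    by simp
  also have "\<dots> \<le> E / \<mu> + B * (- l)" using assms by simp
  finally show ?thesis .
qed

lemma integral_cong_AE_Icc:
  fixes f g :: "real \<Rightarrow> real"
  assumes "AE s in lebesgue. s \<in> {l..r} \<longrightarrow> f s = g s"
  shows "integral {l..r} f = integral {l..r} g" "f integrable_on {l..r} \<longleftrightarrow> g integrable_on {l..r}"
proof -
  obtain N where N: "N \<in> null_sets lebesgue" "{s. \<not> (s \<in> {l..r} \<longrightarrow> f s = g s)} \<subseteq> N"
    using assms by (auto simp: eventually_ae_filter)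
  then have n: "negligible N" by (simp add: negligible_iff_null_sets)
  show "integral {l..r} f = integral {l..r} g"
    by (rule integral_spike[OF n]) (use N in auto)
  show "f integrable_on {l..r} \<longleftrightarrow> g integrable_on {l..r}"
    using integrable_spike[OF _ n, of f "{l..r}" g] integrable_spike[OF _ n, of g "{l..r}" f] N(2)
    by fastforce
qed

text \<open>Cutting off at an essential bound and extending by 0 yields a representative that is
  measurable and bounded on the whole line, as the lemmas on parameter integrals demand.\<close>

lemma linf_on_bounded_version:
  fixes f :: "real \<Rightarrow> 'a::euclidean_space"
  assumes f: "linf_on S f"
  obtains f' R where "f' \<in> borel_measurable lebesgue" "\<And>s. norm (f' s) \<le> R" "0 \<le> R"
    "AE s in lebesgue. s \<in> S \<longrightarrow> f s = f' s"
proof -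
  let ?f = "\<lambda>s. indicat_real S s *\<^sub>R f s"
  have m: "?f \<in> borel_measurable lebesgue"
    using f by (auto simp: linf_on_def set_borel_measurable_def)
  obtain B where B: "AE s in lebesgue. s \<in> S \<longrightarrow> norm (f s) \<le> B"
    using f by (auto simp: linf_on_def)
  define f' where "f' s = (if norm (?f s) \<le> max 0 B then ?f s else 0)" for s
  have "{s \<in> space lebesgue. norm (?f s) \<le> max 0 B} \<in> sets lebesgue"
    using m by measurable
  then have "f' \<in> borel_measurable lebesgue"
    unfolding f'_def using m by (intro measurable_If) auto
  moreover have "norm (f' s) \<le> max 0 B" for s by (simp add: f'_def)
  moreover have "AE s in lebesgue. s \<in> S \<longrightarrow> f s = f' s"
    using B by eventually_elim (auto simp: f'_def)
  ultimately show thesis using that[of f' "max 0 B"] by simp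
qed

lemma bounded_measurable_integrable_on:
  fixes f :: "real \<Rightarrow> real"
  assumes f: "f \<in> borel_measurable lebesgue" and B: "\<And>x. x \<in> {l..r} \<Longrightarrow> \<bar>f x\<bar> \<le> B"
  shows "f integrable_on {l..r}"
  by (rule measurable_bounded_by_integrable_imp_integrable[where g = "\<lambda>_. B"])
    (use assms in \<open>auto intro: measurable_restrict_space1\<close>)

text \<open>Dominated convergence, with the moving endpoint absorbed into the integrand as a cutoff.
  Convergence of the cutoff can fail only at s = l z, and this point is removed from the domain of
  integration.\<close>

lemma continuous_on_param_integral:
  fixes k :: "real \<Rightarrow> real \<Rightarrow> real" and l :: "real \<Rightarrow> real"
  assumes k: "\<And>z. k z \<in> borel_measurable lebesgue" and B: "\<And>z s. \<bar>k z s\<bar> \<le> B"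
    and kc: "\<And>s. continuous_on UNIV (\<lambda>z. k z s)"
    and l: "continuous_on UNIV l" and lm: "\<And>z. m \<le> l z"
  shows "continuous_on UNIV (\<lambda>z. integral {l z..r} (k z))"
proof (rule continuous_on_sequentiallyI)
  fix Z :: "nat \<Rightarrow> real" and z
  assume Z: "Z \<longlonglongrightarrow> z"
  define k' where "k' x s = (if s \<in> {l x..r} then k x s else 0)" for x s
  define S where "S = {m..r} - {l z}"
  have 1: "integral {l x..r} (k x) = integral S (k' x)" for x
  proof -
    have "integral {l x..r} (k x) = integral {m..r} (k' x)"
      using integral_restrict_Int[of "{m..r}" "{l x..r}" "k x"] lm[of x]
      by (simp add: k'_def[abs_def] Int_absorb1 min_absorb1)
    also have "\<dots> = integral S (k' x)"
      unfolding S_def by (rule integral_subset_negligible[symmetric]) (auto intro: negligible_subset[of "{l z}"])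
    finally show ?thesis .
  qed
  have int: "k' x integrable_on {m..r}" for x
  proof (rule bounded_measurable_integrable_on)
    show "k' x \<in> borel_measurable lebesgue"
      unfolding k'_def by (intro measurable_If_set) (use k in auto)
    show "\<bar>k' x s\<bar> \<le> \<bar>B\<bar>" for s using B[of x s] by (auto simp: k'_def)
  qed
  have "(\<lambda>n. integral S (k' (Z n))) \<longlonglongrightarrow> integral S (k' z)"
  proof (rule dominated_convergence(2))
    show "k' (Z n) integrable_on S" for n
      unfolding S_def by (rule integrable_spike_set[OF int]) (auto intro: negligible_subset[of "{l z}"])
    show "(\<lambda>_. \<bar>B\<bar>) integrable_on S"
      unfolding S_def by (rule integrable_spike_set[of _ "{m..r}"]) (auto intro: negligible_subset[of "{l z}"])
    show "norm (k' (Z n) s) \<le> \<bar>B\<bar>" for n s using B[of "Z n" s] by (auto simp: k'_def)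
    show "(\<lambda>n. k' (Z n) s) \<longlonglongrightarrow> k' z s" if s: "s \<in> S" for s
    proof -
      have lZ: "(\<lambda>n. l (Z n)) \<longlonglongrightarrow> l z"
        by (rule continuous_on_tendsto_compose[OF l Z]) auto
      have kZ: "(\<lambda>n. k (Z n) s) \<longlonglongrightarrow> k z s"
        by (rule continuous_on_tendsto_compose[OF kc Z]) auto
      consider "s < l z" | "l z < s" using s by (force simp: S_def)
      then show ?thesis
      proof cases
        case 1
        then have "eventually (\<lambda>n. s < l (Z n)) sequentially" by (rule order_tendstoD(1)[OF lZ])
        then have "eventually (\<lambda>n. k' (Z n) s = 0) sequentially"
          by eventually_elim (auto simp: k'_def)
        moreover have "k' z s = 0" using 1 by (auto simp: k'_def)
        ultimately show ?thesis by (simp add: tendsto_eventually)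
      next
        case 2
        then have "eventually (\<lambda>n. l (Z n) < s) sequentially" by (rule order_tendstoD(2)[OF lZ])
        then have "eventually (\<lambda>n. k (Z n) s = k' (Z n) s) sequentially"
          using s by (auto elim!: eventually_mono simp: k'_def S_def)
        moreover have "k' z s = k z s" using 2 s by (auto simp: k'_def S_def)
        ultimately show ?thesis using kZ by (simp add: tendsto_cong)
      qed
    qed
  qed
  then show "(\<lambda>n. integral {l (Z n)..r} (k (Z n))) \<longlonglongrightarrow> integral {l z..r} (k z)"
    by (simp add: 1)
qed

section \<open>Majorants, geometric sequences and sublevel sets\<close>

lemma mono_on_continuous_majorant:
  fixes f :: "real \<Rightarrow> real"
  assumes mono: "mono_on {0..} f"
  obtains \<phi> where "continuous_on {0..} \<phi>" "mono_on {0..} \<phi>" "\<And>s. 0 \<le> s \<Longrightarrow> f (s + 1) \<le> \<phi> s"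
proof -
  define F where "F t = integral {0..t} f" for t
  \<comment> \<open>The average of \<open>f\<close> over the window [s + 1, s + 2]: continuous as a
    difference of indefinite integrals, nondecreasing because the window moves to the right, and at
    least the value of \<open>f\<close> at the left end of the window.\<close>
  define \<phi> where "\<phi> s = F (s + 2) - F (s + 1)" for s
  have int: "f integrable_on {a..b}" if "0 \<le> a" for a b
    by (rule integrable_on_mono_on) (use mono that in \<open>auto simp: mono_on_def\<close>)
  have contF: "continuous_on {0..} F"
    unfolding continuous_on_eq_continuous_within
  proof
    fix x :: real assume "x \<in> {0..}"
    then have "continuous (at x within {0..x + 1}) F"
      using indefinite_integral_continuous_1[OF int[of 0 "x + 1"]]
      by (simp add: F_def[abs_def] continuous_on_eq_continuous_within)
    moreover have "at x within {0..} = at x within {0..x + 1}"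
      by (rule at_within_nhd[of _ "{..<x + 1}"]) auto
    ultimately show "continuous (at x within {0..}) F" by simp
  qed
  have \<phi>: "\<phi> s = integral {s + 1..s + 2} f" if "0 \<le> s" for s
    using Henstock_Kurzweil_Integration.integral_combine[of 0 "s + 1" "s + 2" f] int[of 0 "s + 2"] that by (simp add: \<phi>_def F_def)
  show thesis
  proof
    show "continuous_on {0..} \<phi>"
      unfolding \<phi>_def
      by (intro continuous_intros continuous_on_compose2[OF contF]) auto
    show "mono_on {0..} \<phi>"
    proof (rule mono_onI)
      fix s t :: real assume st: "s \<in> {0..}" "t \<in> {0..}" "s \<le> t"
      have "integral {s + 1..s + 2} f = integral {1..2} (\<lambda>x. f (x + s))"
        using integral_shift_real_ivl[of "1 + s" s "2 + s" f] by (simp add: add.commute)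
      also have "\<dots> \<le> integral {1..2} (\<lambda>x. f (x + t))"
      proof (rule integral_le)
        show "(\<lambda>x. f (x + s)) integrable_on {1..2}"
          using integrable_shift_real_ivl_iff[of f s "1 + s" "2 + s"] int[of "1 + s" "2 + s"] st by simp
        show "(\<lambda>x. f (x + t)) integrable_on {1..2}"
          using integrable_shift_real_ivl_iff[of f t "1 + t" "2 + t"] int[of "1 + t" "2 + t"] st by simp
        show "f (x + s) \<le> f (x + t)" if "x \<in> {1..2}" for x
          using mono st that by (auto simp: mono_on_def)
      qed
      also have "\<dots> = integral {t + 1..t + 2} f"
        using integral_shift_real_ivl[of "1 + t" t "2 + t" f] by (simp add: add.commute)
      finally show "\<phi> s \<le> \<phi> t" using st by (simp add: \<phi>)
    qed
    show "f (s + 1) \<le> \<phi> s" if "0 \<le> s" for s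
    proof -
      have "integral {s + 1..s + 2} (\<lambda>_. f (s + 1)) \<le> integral {s + 1..s + 2} f"
        using that mono int[of "s + 1" "s + 2"] by (intro integral_le) (auto simp: mono_on_def)
      with that show ?thesis by (simp add: \<phi>)
    qed
  qed
qed

text \<open>The increments from index k on sum to at most C(1/2)^k (1 + 1/2 + ...) = 2C(1/2)^k. The
  induction retains the unspent remainder of the series so that the bound telescopes.\<close>

lemma geometric_increments_limit:
  fixes f :: "nat \<Rightarrow> 'a::banach"
  assumes inc: "\<And>k. norm (f (Suc k) - f k) \<le> C * (1/2) ^ k"
  shows "\<exists>l. f \<longlonglongrightarrow> l \<and> (\<forall>k. norm (f k - l) \<le> 2 * C * (1/2) ^ k)"
proof -
  have step: "norm (f (k + j) - f k) \<le> 2 * C * (1/2) ^ k - 2 * C * (1/2) ^ (k + j)" for k j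
  proof (induction j)
    case (Suc j)
    have "norm (f (k + Suc j) - f k) \<le> norm (f (Suc (k + j)) - f (k + j)) + norm (f (k + j) - f k)"
      using norm_triangle_ineq[of "f (Suc (k + j)) - f (k + j)" "f (k + j) - f k"] by simp
    moreover have "C * (1/2) ^ (k + j) = 2 * C * (1/2) ^ (k + j) - 2 * C * (1/2) ^ (k + Suc j)"
      by simp
    ultimately show ?case using Suc inc[of "k + j"] by linarith
  qed simp
  have C: "0 \<le> C" using inc[of 0] by (auto intro: order_trans[OF norm_ge_zero])
  have bd: "norm (f (k + j) - f k) \<le> 2 * C * (1/2) ^ k" for k j
      proof -
    have "0 \<le> 2 * C * (1/2) ^ (k + j)" using C by simp
    with step[of k j] show ?thesis by linarith
  qed
  have lim0: "(\<lambda>k. 2 * C * (1/2) ^ k) \<longlonglongrightarrow> 0"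
    by (intro tendsto_mult_right_zero LIMSEQ_realpow_zero) auto
  have "Cauchy f"
  proof (rule CauchyI)
    fix e :: real assume "0 < e"
    then have "eventually (\<lambda>k. 2 * C * (1/2) ^ k < e / 2) sequentially"
      by (intro order_tendstoD(2)[OF lim0]) simp
    then obtain M where M: "2 * C * (1/2) ^ M < e / 2" by (auto simp: eventually_sequentially)
    show "\<exists>M. \<forall>m\<ge>M. \<forall>n\<ge>M. norm (f m - f n) < e"
    proof (intro exI allI impI)
      fix m n assume "M \<le> m" "M \<le> n"
      then obtain i j where ij: "m = M + i" "n = M + j" by (metis le_iff_add)
      have "norm (f m - f n) \<le> norm (f m - f M) + norm (f n - f M)"
        using norm_triangle_ineq4[of "f m - f M" "f n - f M"] by simp
      with bd[of M i] bd[of M j] M show "norm (f m - f n) < e" unfolding ij by linarith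
    qed
  qed
  then obtain l where l: "f \<longlonglongrightarrow> l" by (auto simp: Cauchy_convergent_iff convergent_def)
  have "norm (f k - l) \<le> 2 * C * (1/2) ^ k" for k
  proof -
    have "(\<lambda>j. norm (f (k + j) - f k)) \<longlonglongrightarrow> norm (l - f k)"
      using LIMSEQ_ignore_initial_segment[OF l, of k] by (intro tendsto_intros) (simp add: add.commute)
    then have "norm (l - f k) \<le> 2 * C * (1/2) ^ k"
      by (rule Lim_bounded) (use bd in auto)
    then show ?thesis by (simp add: norm_minus_commute)
  qed
  with l show ?thesis by blast
qed

lemma radially_unbounded_sublevel_bounded:
  fixes V :: "'a::real_normed_vector \<Rightarrow> real"
  assumes "filterlim V at_top at_infinity"
  shows "\<exists>M\<ge>0. \<forall>y. V y \<le> s \<longrightarrow> norm y \<le> M"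
proof -
  have "eventually (\<lambda>y. s + 1 \<le> V y) at_infinity"
    using assms by (auto simp: filterlim_at_top)
  then obtain b where b: "\<And>y. b \<le> norm y \<Longrightarrow> s + 1 \<le> V y"
    by (auto simp: eventually_at_infinity)
  have "norm y \<le> max 0 b" if "V y \<le> s" for y
    using b[of y] that by (cases "b \<le> norm y") auto
  then show ?thesis by (intro exI[of _ "max 0 b"]) auto
qed

text \<open>Sublevel sets of level at most 1 lie in a ball of radius M. On the compact shell between
  the radii e and M the function V attains a positive minimum, and a level of half that minimum
  misses the shell.\<close>

lemma posdef_small_sublevel:
  fixes V :: "'a::euclidean_space \<Rightarrow> real"
  assumes cont: "continuous_on UNIV V" and pos: "\<And>y. y \<noteq> 0 \<Longrightarrow> 0 < V y"
    and unb: "filterlim V at_top at_infinity" and "0 < e"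
  shows "\<exists>\<eta>>0. \<forall>y. V y \<le> \<eta> \<longrightarrow> norm y \<le> e"
proof -
  obtain M where M: "0 \<le> M" "\<And>y. V y \<le> 1 \<Longrightarrow> norm y \<le> M"
    using radially_unbounded_sublevel_bounded[OF unb] by blast
  define S where "S = {y::'a. e \<le> norm y \<and> norm y \<le> M}"
  have "S = cball 0 M - ball 0 e" by (auto simp: S_def)
  then have "compact S" using compact_diff[of "cball (0::'a) M" "ball 0 e"] by simp
  show ?thesis
  proof (cases "S = {}")
    case True
    then have "norm y \<le> e" if "V y \<le> 1" for y using M(2)[OF that] True unfolding S_def by force
    then show ?thesis by (intro exI[of _ 1]) auto
  next
    case False
    then obtain x where x: "x \<in> S" "\<And>y. y \<in> S \<Longrightarrow> V x \<le> V y"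
      using continuous_attains_inf[OF \<open>compact S\<close> False continuous_on_subset[OF cont]] by auto
    have "V x > 0" using x(1) \<open>0 < e\<close> by (intro pos) (auto simp: S_def)
    moreover have "norm y \<le> e" if y: "V y \<le> min 1 (V x / 2)" for y
    proof (rule ccontr)
      assume "\<not> norm y \<le> e"
      then have "y \<in> S" using M(2)[of y] y by (auto simp: S_def)
      from x(2)[OF this] y \<open>V x > 0\<close> show False by auto
    qed
    ultimately show ?thesis by (intro exI[of _ "min 1 (V x / 2)"]) auto
  qed
qed

subsection \<open>The profile as a function of the past\<close>

lemma abs_exp_diff_le:
  fixes x y m :: real
  assumes "x \<le> m" "y \<le> m"
  shows "\<bar>exp x - exp y\<bar> \<le> exp m * \<bar>x - y\<bar>"
proof -
  have *: "exp u - exp v \<le> exp m * (u - v)" if "v \<le> u" "u \<le> m" for u v :: real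
  proof -
    have "1 - exp (v - u) \<le> u - v" using exp_ge_add_one_self[of "v - u"] by linarith
    then have "exp u * (1 - exp (v - u)) \<le> exp u * (u - v)" by (intro mult_left_mono) auto
    also have "\<dots> \<le> exp m * (u - v)" using that by (intro mult_right_mono) auto
    finally show ?thesis by (simp add: algebra_simps flip: exp_add)
  qed
  show ?thesis
  proof (cases "x \<le> y")
    case True
    then have "exp x \<le> exp y" by simp
    with *[of x y] True assms show ?thesis by (simp add: abs_if)
  next
    case False
    then have "exp y \<le> exp x" by simp
    with *[of y x] False assms show ?thesis by (simp add: abs_if)
  qed
qed

lemma abs_mult_diff_le:
  fixes x y x' y' :: real
  assumes "\<bar>x\<bar> \<le> X" "\<bar>y - y'\<bar> \<le> dy" "\<bar>x - x'\<bar> \<le> dx" "\<bar>y'\<bar> \<le> Y"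
  shows "\<bar>x * y - x' * y'\<bar> \<le> X * dy + dx * Y"
proof -
  have "x * y - x' * y' = x * (y - y') + (x - x') * y'" by (simp add: algebra_simps)
  also have "\<bar>\<dots>\<bar> \<le> \<bar>x\<bar> * \<bar>y - y'\<bar> + \<bar>x - x'\<bar> * \<bar>y'\<bar>"
    by (rule order_trans[OF abs_triangle_ineq]) (simp add: abs_mult)
  also have "\<dots> \<le> X * dy + dx * Y"
    using assms by (intro add_mono mult_mono) auto
  finally show ?thesis .
qed

locale transport_kernel =
  fixes c :: real and a :: "real^'n::finite \<Rightarrow> real \<Rightarrow> real" and g :: "'n \<Rightarrow> real \<Rightarrow> real"
  assumes c_pos: "c > 0"
    and a_cont: "continuous_on (UNIV \<times> {0..1}) (\<lambda>(p, z). a p z)"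
    and a_loclip: "\<forall>y\<in>UNIV \<times> {0..1}. \<exists>r>0. \<exists>L.
                     L-lipschitz_on (ball y r \<inter> (UNIV \<times> {0..1})) (\<lambda>(p, z). a p z)"
    and g_cont: "\<forall>i. continuous_on {0..1} (g i)"
begin

section \<open>Bounds and Lipschitz constants of the coefficients\<close>

definition abound :: "real \<Rightarrow> real" where
  "abound R = (SUP x\<in>cball 0 R \<times> {0..1}. \<bar>a (fst x) (snd x)\<bar>)"

definition gbound :: real where
  "gbound = (\<Sum>i\<in>UNIV. SUP z\<in>{0..1}. \<bar>g i z\<bar>)"

text \<open>A characteristic crosses [0,1] in time 1/c. Along it the exponential amplifies by at
  most exp(abound R / c), the boundary value contributes R, and the source contributes at most
  gbound R per unit of time.\<close>

definition Xbound :: "real \<Rightarrow> real" where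
  "Xbound R = exp (abound R / c) * (R + gbound * R / c)"

lemma bdd_above_a: "bdd_above ((\<lambda>x. \<bar>a (fst x) (snd x)\<bar>) ` (cball 0 R \<times> {0..1}))"
proof -
  have "continuous_on (cball 0 R \<times> {0..1}) (\<lambda>x. a (fst x) (snd x))"
    by (rule continuous_on_subset[OF a_cont[unfolded case_prod_unfold]]) auto
  then have "compact ((\<lambda>x. \<bar>a (fst x) (snd x)\<bar>) ` (cball 0 R \<times> {0..1}))"
    by (intro compact_continuous_image continuous_intros compact_Times compact_cball compact_Icc)
  then show ?thesis by (intro bounded_imp_bdd_above compact_imp_bounded)
qed

lemma abs_a_le:
  assumes "norm p \<le> R" "z \<in> {0..1}"
  shows "\<bar>a p z\<bar> \<le> abound R"
  using cSUP_upper[OF _ bdd_above_a, of "(p, z)" R] assms by (simp add: abound_def)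

lemma abound_nonneg: "0 \<le> R \<Longrightarrow> 0 \<le> abound R"
  using abs_a_le[of 0 R 0] by auto

lemma abound_mono: "0 \<le> R \<Longrightarrow> R \<le> R' \<Longrightarrow> abound R \<le> abound R'"
  unfolding abound_def by (intro cSUP_subset_mono bdd_above_a) auto

lemma abs_g_le: "z \<in> {0..1} \<Longrightarrow> \<bar>g i z\<bar> \<le> (SUP z\<in>{0..1}. \<bar>g i z\<bar>)"
proof (rule cSUP_upper)
  have "compact ((\<lambda>z. \<bar>g i z\<bar>) ` {0..1})"
    using g_cont by (intro compact_continuous_image continuous_intros) auto
  then show "bdd_above ((\<lambda>z. \<bar>g i z\<bar>) ` {0..1})"
    by (intro bounded_imp_bdd_above compact_imp_bounded)
qed

lemma gbound_nonneg: "0 \<le> gbound"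
  unfolding gbound_def
proof (rule sum_nonneg)
  show "0 \<le> (SUP z\<in>{0..1}. \<bar>g i z\<bar>)" for i
    using abs_g_le[of 0 i] by (auto intro: order_trans[OF abs_ge_zero])
qed

lemma abs_g_sum_le:
  assumes "z \<in> {0..1}"
  shows "\<bar>\<Sum>i\<in>UNIV. g i z * p $ i\<bar> \<le> gbound * norm p"
proof -
  have "\<bar>\<Sum>i\<in>UNIV. g i z * p $ i\<bar> \<le> (\<Sum>i\<in>UNIV. \<bar>g i z\<bar> * \<bar>p $ i\<bar>)"
    by (rule order_trans[OF sum_abs]) (simp add: abs_mult)
  also have "\<dots> \<le> (\<Sum>i\<in>UNIV. (SUP z\<in>{0..1}. \<bar>g i z\<bar>) * norm p)"
    using abs_g_le[OF assms] component_le_norm_cart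
    by (intro sum_mono mult_mono) (auto intro: order_trans[OF abs_ge_zero])
  finally show ?thesis by (simp add: gbound_def sum_distrib_right)
qed

lemma Xbound_nonneg: "0 \<le> R \<Longrightarrow> 0 \<le> Xbound R"
  unfolding Xbound_def using gbound_nonneg c_pos by (intro mult_nonneg_nonneg add_nonneg_nonneg) auto

lemma Xbound_mono:
  assumes "0 \<le> R" "R \<le> R'" shows "Xbound R \<le> Xbound R'"
  unfolding Xbound_def using abound_mono[OF assms] gbound_nonneg c_pos assms
  by (intro mult_mono add_mono divide_right_mono mult_left_mono add_nonneg_nonneg divide_nonneg_pos mult_nonneg_nonneg) (auto intro: divide_right_mono)

text \<open>For r \<le> 1 the growth rate \<open>abound r\<close> can be replaced by
  \<open>abound 1\<close>, which leaves a bound that is linear in r.\<close>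

lemma Xbound_small:
  assumes "0 < e"
  shows "\<exists>r>0. Xbound r \<le> e"
proof -
  define C where "C = exp (abound 1 / c) * (1 + gbound / c)"
  have C: "0 < C" unfolding C_def using gbound_nonneg c_pos by (intro mult_pos_pos add_pos_nonneg) auto
  define r where "r = min 1 (e / C)"
  have r: "0 < r" "r \<le> 1" "r \<le> e / C" using assms C by (auto simp: r_def)
  have "Xbound r \<le> exp (abound 1 / c) * (r + gbound * r / c)"
    unfolding Xbound_def using abound_mono[of r 1] r c_pos gbound_nonneg
    by (intro mult_right_mono) (auto simp: divide_right_mono)
  also have "\<dots> = C * r" by (simp add: C_def algebra_simps)
  also have "\<dots> \<le> e" using r(3) C by (simp add: field_simps)
  finally show ?thesis using r(1) by blast
qed

text \<open>The local Lipschitz property, read in p with z as a parameter, becomes uniform on the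
  compact product of \<open>cball 0 R\<close> and [0,1].\<close>

lemma a_lipschitz:
  "\<exists>L\<ge>0. \<forall>p q z. norm p \<le> R \<longrightarrow> norm q \<le> R \<longrightarrow> z \<in> {0..1} \<longrightarrow> \<bar>a p z - a q z\<bar> \<le> L * norm (p - q)"
proof -
  have "local_lipschitz {0..1} UNIV (\<lambda>z p. a p z)"
  proof (rule local_lipschitzI)
    fix z :: real and p :: "real^'n" assume z: "z \<in> {0..1}"
    then obtain r L where r: "0 < r"
      and L: "L-lipschitz_on (ball (p, z) r \<inter> (UNIV \<times> {0..1})) (\<lambda>(p, z). a p z)"
      using a_loclip by (metis SigmaI UNIV_I)
    \<comment> \<open>Two displacements of at most r/3, one in p and one in z, keep the pair inside
      the ball of radius r in the product space.\<close>
    have "L-lipschitz_on (cball p (r/3) \<inter> UNIV) (\<lambda>p. a p z')" if z': "z' \<in> cball z (r/3) \<inter> {0..1}" for z'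
    proof (rule lipschitz_onI)
      have mem: "(x, z') \<in> ball (p, z) r \<inter> (UNIV \<times> {0..1})" if "x \<in> cball p (r/3) \<inter> UNIV" for x
      proof -
        have "dist (p, z) (x, z') \<le> dist p x + dist z z'"
          unfolding dist_Pair_Pair by (rule sqrt_sum_squares_le_sum) auto
        also have "\<dots> < r" using that z' r by auto
        finally show ?thesis using z' by auto
      qed
      show "dist (a x z') (a y z') \<le> L * dist x y"
        if "x \<in> cball p (r/3) \<inter> UNIV" "y \<in> cball p (r/3) \<inter> UNIV" for x y
        using lipschitz_onD[OF L mem[OF that(1)] mem[OF that(2)]] by (simp add: dist_Pair_Pair)
      show "0 \<le> L" by (rule lipschitz_on_nonneg[OF L])
    qed
    then show "\<exists>u>0. \<exists>L. \<forall>z\<in>cball z u \<inter> {0..1}. L-lipschitz_on (cball p u \<inter> UNIV) (\<lambda>p. a p z)"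
      using r by (intro exI[of _ "r/3"] conjI exI[of _ L]) auto
  qed
  then have ll: "local_lipschitz {0..1} (cball 0 R) (\<lambda>z p. a p z)"
    by (rule local_lipschitz_subset) auto
  have cont: "continuous_on {0..1} (\<lambda>z. a p z)" for p
    by (rule continuous_on_compose2[OF a_cont[unfolded case_prod_unfold], of "{0..1}" "\<lambda>z. (p, z)",
          unfolded fst_conv snd_conv]) (auto intro!: continuous_intros)
  obtain L where L: "\<And>z. z \<in> {0..1} \<Longrightarrow> L-lipschitz_on (cball 0 R) (\<lambda>p. a p z)"
    using local_lipschitz_compact_implies_lipschitz[OF ll compact_cball compact_Icc cont] by blast
  have "\<bar>a p z - a q z\<bar> \<le> L * norm (p - q)" if "norm p \<le> R" "norm q \<le> R" "z \<in> {0..1}" for p q z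
    using lipschitz_onD[OF L[OF that(3)], of p q] that by (simp add: dist_norm)
  moreover have "0 \<le> L" using lipschitz_on_nonneg[OF L[of 0]] by simp
  ultimately show ?thesis by blast
qed

section \<open>Characteristics and kernels extended to the whole line\<close>

lemma char_in_unit:
  assumes "z \<in> {0..1}" "s \<in> {-z/c..0}"
  shows "z + c * s \<in> {0..1}"
proof -
  have "- z \<le> c * s" using assms c_pos by (simp add: field_simps)
  moreover have "c * s \<le> 0" using assms c_pos by (simp add: mult_nonneg_nonpos)
  ultimately show ?thesis using assms by auto
qed

lemma char_in_past: "z \<in> {0..1} \<Longrightarrow> -1/c \<le> -z/c" "z \<in> {0..1} \<Longrightarrow> -z/c \<le> 0"
  using c_pos by (auto simp: divide_right_mono)

text \<open>Extends the coefficients continuously from [0,1] to the real line, so that the kernels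
  below are defined for all z and s and the lemma on parameter integrals applies to them.\<close>

definition clamp_unit :: "real \<Rightarrow> real" where
  "clamp_unit z = max 0 (min 1 z)"

lemma clamp_unit_mem: "clamp_unit z \<in> {0..1}"
  by (auto simp: clamp_unit_def)

lemma clamp_unit_id: "z \<in> {0..1} \<Longrightarrow> clamp_unit z = z"
  by (auto simp: clamp_unit_def)

lemma clamp_unit_cont: "continuous_on S f \<Longrightarrow> continuous_on S (\<lambda>x. clamp_unit (f x))"
  unfolding clamp_unit_def by (intro continuous_intros)

definition achar :: "(real \<Rightarrow> real^'n) \<Rightarrow> real \<Rightarrow> real \<Rightarrow> real" where
  "achar p z q = a (p q) (clamp_unit (z + c * q))"

definition past_clamp :: "real \<Rightarrow> real" where
  "past_clamp s = max (-1/c) (min 0 s)"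

text \<open>The source integrand of \<open>Xmap\<close> with position and lower integration limit
  clamped. It agrees with the original on the part of a characteristic that lies in [0,1], and for
  bounded measurable p it is measurable in s and continuous in z everywhere.\<close>

definition Xkernel :: "(real \<Rightarrow> real^'n) \<Rightarrow> real \<Rightarrow> real \<Rightarrow> real" where
  "Xkernel p z s = exp (integral {past_clamp s..0} (achar p z))
     * (\<Sum>i\<in>UNIV. g i (clamp_unit (z + c * s)) * p s $ i)"

lemma a_clamp_cont: "continuous_on UNIV (\<lambda>x. a (fst x) (clamp_unit (snd x)))"
proof -
  have "continuous_on UNIV (\<lambda>x::(real^'n) \<times> real. (fst x, clamp_unit (snd x)))"
    by (intro continuous_intros clamp_unit_cont)
  from continuous_on_compose2[OF a_cont[unfolded case_prod_unfold] this] show ?thesis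
    using clamp_unit_mem by (simp add: image_subset_iff)
qed

lemma g_clamp_cont: "continuous_on UNIV (\<lambda>z. g i (clamp_unit z))"
proof -
  have "continuous_on {0..1} (g i)" using g_cont by blast
  moreover have "continuous_on UNIV (\<lambda>z. clamp_unit z)" by (intro clamp_unit_cont continuous_intros)
  moreover have "(\<lambda>z. clamp_unit z) ` UNIV \<subseteq> {0..1}" using clamp_unit_mem by blast
  ultimately show ?thesis by (rule continuous_on_compose2)
qed

context
  fixes p :: "real \<Rightarrow> real^'n" and R :: real
  assumes p: "p \<in> borel_measurable lebesgue" and pR: "\<And>s. norm (p s) \<le> R"
begin

lemma achar_measurable: "achar p z \<in> borel_measurable lebesgue"
proof -
  have "(\<lambda>q. (p q, z + c * q)) \<in> borel_measurable lebesgue"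
    by (intro borel_measurable_Pair p borel_measurable_lebesgue_continuous continuous_intros)
  from borel_measurable_continuous_on[OF a_clamp_cont this] show ?thesis
    by (simp add: achar_def[abs_def])
qed

lemma achar_bound: "\<bar>achar p z q\<bar> \<le> abound R"
  unfolding achar_def by (intro abs_a_le pR clamp_unit_mem)

lemma achar_cont: "continuous_on UNIV (\<lambda>z. achar p z q)"
  unfolding achar_def
  by (rule continuous_on_compose2[OF a_clamp_cont, of UNIV "\<lambda>z. (p q, z + c * q)", unfolded fst_conv snd_conv])
    (auto intro!: continuous_intros)

lemma past_clamp_cont: "continuous_on UNIV past_clamp"
  unfolding past_clamp_def[abs_def] by (intro continuous_intros)

lemma past_clamp_bounds: "-1/c \<le> past_clamp s" "past_clamp s \<le> 0"
  using c_pos by (auto simp: past_clamp_def)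

lemma integral_achar_bound: "\<bar>integral {past_clamp s..0} (achar p z)\<bar> \<le> abound R / c"
proof -
  have R: "0 \<le> R" using pR[of 0] norm_ge_zero order_trans by blast
  have "\<bar>integral {past_clamp s..0} (achar p z)\<bar> \<le> abound R * (0 - past_clamp s)"
    using achar_bound abound_nonneg[OF R] past_clamp_bounds by (intro abs_integral_le_const_AE) auto
  also have "\<dots> \<le> abound R * (1 / c)"
    using past_clamp_bounds[of s] abound_nonneg[OF R] by (intro mult_left_mono) auto
  finally show ?thesis by simp
qed

text \<open>The exponential factor is continuous in s as an integral with a moving endpoint, and the
  clamped g is continuous; only p is merely measurable.\<close>

lemma Xkernel_measurable: "Xkernel p z \<in> borel_measurable lebesgue"
proof -
  have "continuous_on UNIV (\<lambda>s. integral {past_clamp s..0} (achar p z))"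
    by (rule continuous_on_param_integral[where B = "abound R" and m = "-1/c" and k = "\<lambda>_. achar p z"])
      (use achar_measurable achar_bound past_clamp_cont past_clamp_bounds in auto)
  then have "(\<lambda>s. exp (integral {past_clamp s..0} (achar p z))) \<in> borel_measurable lebesgue"
    by (intro borel_measurable_lebesgue_continuous continuous_intros)
  moreover have "(\<lambda>s. g i (clamp_unit (z + c * s))) \<in> borel_measurable lebesgue" for i
    by (intro borel_measurable_lebesgue_continuous continuous_on_compose2[OF g_clamp_cont]
        continuous_intros) auto
  moreover have "(\<lambda>s. p s $ i) \<in> borel_measurable lebesgue" for i
    by (rule borel_measurable_continuous_on[OF _ p]) (intro continuous_intros)
  ultimately show ?thesis
    unfolding Xkernel_def[abs_def] by (intro borel_measurable_times borel_measurable_sum)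
qed

lemma Xkernel_bound: "\<bar>Xkernel p z s\<bar> \<le> exp (abound R / c) * (gbound * R)"
proof -
  have "\<bar>\<Sum>i\<in>UNIV. g i (clamp_unit (z + c * s)) * p s $ i\<bar> \<le> gbound * R"
    using abs_g_sum_le[OF clamp_unit_mem, of "z + c * s" "p s"] mult_left_mono[OF pR gbound_nonneg]
    by (meson order_trans)
  moreover have "exp (integral {past_clamp s..0} (achar p z)) \<le> exp (abound R / c)"
    using integral_achar_bound[of s z] by simp
  ultimately show ?thesis unfolding Xkernel_def abs_mult by (intro mult_mono) auto
qed

lemma Xkernel_cont: "continuous_on UNIV (\<lambda>z. Xkernel p z s)"
proof -
  have "continuous_on UNIV (\<lambda>z. integral {past_clamp s..0} (achar p z))"
    by (rule continuous_on_param_integral[where B = "abound R" and m = "past_clamp s"])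
      (use achar_measurable achar_bound achar_cont in auto)
  moreover have "continuous_on UNIV (\<lambda>z. g i (clamp_unit (z + c * s)))" for i
    by (auto intro!: continuous_on_compose2[OF g_clamp_cont] continuous_intros)
  ultimately show ?thesis unfolding Xkernel_def by (intro continuous_intros)
qed

lemma integral_a_char:
  assumes z: "z \<in> {0..1}" and s: "s \<in> {-z/c..0}"
  shows "integral {s..0} (\<lambda>q. a (p q) (z + c * q)) = integral {past_clamp s..0} (achar p z)"
proof -
  have "past_clamp s = s" using s char_in_past[OF z] by (auto simp: past_clamp_def)
  moreover have "clamp_unit (z + c * q) = z + c * q" if "q \<in> {s..0}" for q
    using that s by (intro clamp_unit_id char_in_unit[OF z]) auto
  ultimately show ?thesis by (auto simp: achar_def intro!: integral_cong)
qed

lemma Xkernel_eq: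
  assumes z: "z \<in> {0..1}" and s: "s \<in> {-z/c..0}"
  shows "exp (integral {s..0} (\<lambda>q. a (p q) (z + c * q))) * (\<Sum>i\<in>UNIV. g i (z + c * s) * (p s) $ i)
    = Xkernel p z s"
  using clamp_unit_id[OF char_in_unit[OF z s]] integral_a_char[OF z s] by (simp add: Xkernel_def)

lemma a_char_integrable_on_aux:
  assumes z: "z \<in> {0..1}"
  shows "(\<lambda>q. a (p q) (z + c * q)) integrable_on {-z/c..0}"
    "(\<lambda>s. exp (integral {s..0} (\<lambda>q. a (p q) (z + c * q))) * (\<Sum>i\<in>UNIV. g i (z + c * s) * (p s) $ i))
        integrable_on {-z/c..0}"
proof -
  have "achar p z integrable_on {-z/c..0}"
    by (rule bounded_measurable_integrable_on[OF achar_measurable]) (rule achar_bound)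
  then show "(\<lambda>q. a (p q) (z + c * q)) integrable_on {-z/c..0}"
    by (rule integrable_eq) (simp only: achar_def clamp_unit_id[OF char_in_unit[OF z]])
  have "Xkernel p z integrable_on {-z/c..0}"
    by (rule bounded_measurable_integrable_on[OF Xkernel_measurable]) (rule Xkernel_bound)
  then show "(\<lambda>s. exp (integral {s..0} (\<lambda>q. a (p q) (z + c * q))) * (\<Sum>i\<in>UNIV. g i (z + c * s) * (p s) $ i))
        integrable_on {-z/c..0}"
    by (rule integrable_eq) (simp add: Xkernel_eq[OF z])
qed

text \<open>After clamping, both integrals are continuous in z. The remaining ingredient is v
  composed with an invertible affine map, which preserves Lebesgue measurability.\<close>

lemma Xmap_measurable_aux:
  assumes v: "v \<in> borel_measurable lebesgue"
  shows "set_borel_measurable lebesgue {0..1} (Xmap c a g p v)"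
proof -
  define I where "I z = integral {-clamp_unit z/c..0} (achar p z)" for z
  define J where "J z = integral {-clamp_unit z/c..0} (Xkernel p z)" for z
  have lc: "continuous_on UNIV (\<lambda>z. -clamp_unit z/c)" "-1/c \<le> -clamp_unit z/c" for z
    using c_pos char_in_past(1)[OF clamp_unit_mem]
    by (auto intro!: continuous_intros clamp_unit_cont)
  have "continuous_on UNIV I" unfolding I_def[abs_def]
    by (rule continuous_on_param_integral[where B = "abound R" and m = "-1/c"])
      (use achar_measurable achar_bound achar_cont lc in auto)
  moreover have "continuous_on UNIV J" unfolding J_def[abs_def]
    by (rule continuous_on_param_integral[where B = "exp (abound R / c) * (gbound * R)" and m = "-1/c"])
      (use Xkernel_measurable Xkernel_bound Xkernel_cont lc in auto)
  ultimately have "I \<in> borel_measurable lebesgue" "J \<in> borel_measurable lebesgue"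
    by (simp_all add: borel_measurable_lebesgue_continuous)
  moreover have "(\<lambda>z. v (-z/c)) \<in> borel_measurable lebesgue"
    using measurable_lebesgue_affine[of "-1/c" v 0] v c_pos by simp
  ultimately have "(\<lambda>z. indicat_real {0..1} z *\<^sub>R (exp (I z) * v (-z/c) + J z)) \<in> borel_measurable lebesgue"
    by (intro borel_measurable_scaleR borel_measurable_add borel_measurable_times borel_measurable_exp borel_measurable_indicator) auto
  moreover have "Xmap c a g p v z = exp (I z) * v (-z/c) + J z" if z: "z \<in> {0..1}" for z
  proof -
    have "past_clamp (-z/c) = -z/c" using char_in_past[OF z] by (auto simp: past_clamp_def)
    moreover have "integral {-z/c..0} (\<lambda>s. exp (integral {s..0} (\<lambda>q. a (p q) (z + c * q)))
        * (\<Sum>i\<in>UNIV. g i (z + c * s) * (p s) $ i)) = integral {-z/c..0} (Xkernel p z)"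
      by (rule integral_cong) (simp add: Xkernel_eq[OF z])
    ultimately show ?thesis
      using integral_a_char[OF z, of "-z/c"] char_in_past[OF z] clamp_unit_id[OF z]
      by (simp add: Xmap_def I_def J_def)
  qed
  then have "indicat_real {0..1} z *\<^sub>R Xmap c a g p v z
      = indicat_real {0..1} z *\<^sub>R (exp (I z) * v (-z/c) + J z)" for z
    by (auto simp: indicator_def)
  ultimately show ?thesis unfolding set_borel_measurable_def by (simp only:)
qed

end

section \<open>Profiles of essentially bounded pasts\<close>

lemma AE_past_Icc:
  assumes "AE s in lebesgue. s \<in> {-1/c..<0} \<longrightarrow> P s" "z \<in> {0..1}" "-z/c \<le> s"
  shows "AE q in lebesgue. q \<in> {s..0} \<longrightarrow> P q"
  using assms(1) AE_lebesgue_neq[of 0]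
  by eventually_elim (use char_in_past[OF assms(2)] assms(3) in auto)

lemma Xmap_terms_cong_AE:
  assumes ae: "AE s in lebesgue. s \<in> {-1/c..<0} \<longrightarrow> p s = p' s" and z: "z \<in> {0..1}"
  shows "s \<in> {-z/c..0} \<Longrightarrow> integral {s..0} (\<lambda>q. a (p q) (z + c * q)) = integral {s..0} (\<lambda>q. a (p' q) (z + c * q))"
    "AE s in lebesgue. s \<in> {-z/c..0} \<longrightarrow>
       exp (integral {s..0} (\<lambda>q. a (p q) (z + c * q))) * (\<Sum>i\<in>UNIV. g i (z + c * s) * (p s) $ i)
       = exp (integral {s..0} (\<lambda>q. a (p' q) (z + c * q))) * (\<Sum>i\<in>UNIV. g i (z + c * s) * (p' s) $ i)"
proof -
  show *: "integral {s..0} (\<lambda>q. a (p q) (z + c * q)) = integral {s..0} (\<lambda>q. a (p' q) (z + c * q))"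
    if "s \<in> {-z/c..0}" for s
  proof (rule integral_cong_AE_Icc(1))
    have "-z/c \<le> s" using that by simp
    from AE_past_Icc[OF ae z this]
    show "AE q in lebesgue. q \<in> {s..0} \<longrightarrow> a (p q) (z + c * q) = a (p' q) (z + c * q)"
      by eventually_elim auto
  qed
  show "AE s in lebesgue. s \<in> {-z/c..0} \<longrightarrow>
       exp (integral {s..0} (\<lambda>q. a (p q) (z + c * q))) * (\<Sum>i\<in>UNIV. g i (z + c * s) * (p s) $ i)
       = exp (integral {s..0} (\<lambda>q. a (p' q) (z + c * q))) * (\<Sum>i\<in>UNIV. g i (z + c * s) * (p' s) $ i)"
    using AE_past_Icc[OF ae z order_refl] by eventually_elim (use * in auto)
qed

lemma Xmap_cong_AE:
  assumes p: "AE s in lebesgue. s \<in> {-1/c..<0} \<longrightarrow> p s = p' s"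
    and v: "AE s in lebesgue. s \<in> {-1/c..<0} \<longrightarrow> v s = v' s"
  shows "AE z in lebesgue. z \<in> {0..1} \<longrightarrow> Xmap c a g p v z = Xmap c a g p' v' z"
proof -
  have m: "-1/c \<noteq> 0" using c_pos by simp
  from AE_lebesgue_affine[OF m v, of 0] AE_lebesgue_neq[of 0]
  show ?thesis
  proof eventually_elim
    case (elim z)
    show ?case
    proof
      assume z: "z \<in> {0..1}"
      \<comment> \<open>At z = 0 the profile would read v at time 0, which is outside the past; this
        one point has been discarded as a null set.\<close>
      have "-z/c < 0" using z elim c_pos by auto
      with elim char_in_past[OF z] have "v (-z/c) = v' (-z/c)" by simp
      moreover have "integral {-z/c..0} (\<lambda>q. a (p q) (z + c * q)) = integral {-z/c..0} (\<lambda>q. a (p' q) (z + c * q))"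
        by (rule Xmap_terms_cong_AE(1)[OF p z]) (use char_in_past[OF z] in auto)
      moreover note integral_cong_AE_Icc(1)[OF Xmap_terms_cong_AE(2)[OF p z]]
      ultimately show "Xmap c a g p v z = Xmap c a g p' v' z" by (simp add: Xmap_def)
    qed
  qed
qed

lemma a_char_integrable_on:
  assumes p: "linf_on {-1/c..<0} p" and z: "z \<in> {0..1}"
  shows "(\<lambda>q. a (p q) (z + c * q)) integrable_on {-z/c..0}"
    "(\<lambda>s. exp (integral {s..0} (\<lambda>q. a (p q) (z + c * q))) * (\<Sum>i\<in>UNIV. g i (z + c * s) * (p s) $ i))
        integrable_on {-z/c..0}"
proof -
  obtain p' R where p': "p' \<in> borel_measurable lebesgue" "\<And>s. norm (p' s) \<le> R"
    and R: "0 \<le> R" and ae: "AE s in lebesgue. s \<in> {-1/c..<0} \<longrightarrow> p s = p' s"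
    by (rule linf_on_bounded_version[OF p]) (rule that)
  have "AE q in lebesgue. q \<in> {-z/c..0} \<longrightarrow> a (p q) (z + c * q) = a (p' q) (z + c * q)"
    using AE_past_Icc[OF ae z order_refl] by eventually_elim auto
  from integral_cong_AE_Icc(2)[OF this] show "(\<lambda>q. a (p q) (z + c * q)) integrable_on {-z/c..0}"
    using a_char_integrable_on_aux(1)[OF p' z] by simp
  show "(\<lambda>s. exp (integral {s..0} (\<lambda>q. a (p q) (z + c * q))) * (\<Sum>i\<in>UNIV. g i (z + c * s) * (p s) $ i))
        integrable_on {-z/c..0}"
    using a_char_integrable_on_aux(2)[OF p' z] by (simp only: integral_cong_AE_Icc(2)[OF Xmap_terms_cong_AE(2)[OF ae z]])
qed

lemma Xmap_terms_bound:
  assumes p: "AE s in lebesgue. s \<in> {-1/c..<0} \<longrightarrow> norm (p s) \<le> R" and R: "0 \<le> R" and z: "z \<in> {0..1}"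
  shows "s \<in> {-z/c..0} \<Longrightarrow> \<bar>integral {s..0} (\<lambda>q. a (p q) (z + c * q))\<bar> \<le> abound R / c"
    "\<bar>integral {-z/c..0} (\<lambda>s. exp (integral {s..0} (\<lambda>q. a (p q) (z + c * q)))
        * (\<Sum>i\<in>UNIV. g i (z + c * s) * (p s) $ i))\<bar> \<le> exp (abound R / c) * (gbound * R / c)"
proof -
  show I: "\<bar>integral {s..0} (\<lambda>q. a (p q) (z + c * q))\<bar> \<le> abound R / c" if s: "s \<in> {-z/c..0}" for s
  proof -
    have sz: "-z/c \<le> s" using s by simp
    have "AE q in lebesgue. q \<in> {s..0} \<longrightarrow> \<bar>a (p q) (z + c * q)\<bar> \<le> abound R"
      using AE_past_Icc[OF p z sz]
      by eventually_elim (use s in \<open>auto intro!: abs_a_le char_in_unit[OF z, simplified]\<close>)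
    then have "\<bar>integral {s..0} (\<lambda>q. a (p q) (z + c * q))\<bar> \<le> abound R * (0 - s)"
      using s abound_nonneg[OF R] by (intro abs_integral_le_const_AE) auto
    also have "\<dots> \<le> abound R * (1 / c)"
      using char_in_past[OF z] sz abound_nonneg[OF R] by (intro mult_left_mono) auto
    finally show ?thesis by simp
  qed
  have "AE s in lebesgue. s \<in> {-z/c..0} \<longrightarrow> \<bar>exp (integral {s..0} (\<lambda>q. a (p q) (z + c * q)))
        * (\<Sum>i\<in>UNIV. g i (z + c * s) * (p s) $ i)\<bar> \<le> exp (abound R / c) * (gbound * R)"
    using AE_past_Icc[OF p z order_refl]
  proof eventually_elim
    case (elim s)
    show ?case
    proof
      assume s: "s \<in> {-z/c..0}"
      have "\<bar>\<Sum>i\<in>UNIV. g i (z + c * s) * p s $ i\<bar> \<le> gbound * R"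
        using abs_g_sum_le[OF char_in_unit[OF z s], of "p s"] mult_left_mono[of "norm (p s)" R gbound]
          gbound_nonneg elim s by linarith
      moreover have "exp (integral {s..0} (\<lambda>q. a (p q) (z + c * q))) \<le> exp (abound R / c)"
        using I[OF s] by simp
      ultimately show "\<bar>exp (integral {s..0} (\<lambda>q. a (p q) (z + c * q)))
          * (\<Sum>i\<in>UNIV. g i (z + c * s) * (p s) $ i)\<bar> \<le> exp (abound R / c) * (gbound * R)"
        unfolding abs_mult by (intro mult_mono) auto
    qed
  qed
  then have "\<bar>integral {-z/c..0} (\<lambda>s. exp (integral {s..0} (\<lambda>q. a (p q) (z + c * q)))
        * (\<Sum>i\<in>UNIV. g i (z + c * s) * (p s) $ i))\<bar> \<le> exp (abound R / c) * (gbound * R) * (0 - (-z/c))"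
    using char_in_past[OF z] gbound_nonneg R by (intro abs_integral_le_const_AE) auto
  also have "\<dots> \<le> exp (abound R / c) * (gbound * R) * (1 / c)"
    using char_in_past(1)[OF z] gbound_nonneg R by (intro mult_left_mono) auto
  finally show "\<bar>integral {-z/c..0} (\<lambda>s. exp (integral {s..0} (\<lambda>q. a (p q) (z + c * q)))
        * (\<Sum>i\<in>UNIV. g i (z + c * s) * (p s) $ i))\<bar> \<le> exp (abound R / c) * (gbound * R / c)"
    by (simp add: mult.assoc)
qed

lemma Xmap_bound_AE:
  assumes pv: "AE s in lebesgue. s \<in> {-1/c..<0} \<longrightarrow> norm (p s, v s) \<le> R" and R: "0 \<le> R"
  shows "AE z in lebesgue. z \<in> {0..1} \<longrightarrow> \<bar>Xmap c a g p v z\<bar> \<le> Xbound R"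
proof -
  have p: "AE s in lebesgue. s \<in> {-1/c..<0} \<longrightarrow> norm (p s) \<le> R"
    using pv by eventually_elim (use order_trans[OF norm_fst_le] in blast)
  have v: "AE s in lebesgue. s \<in> {-1/c..<0} \<longrightarrow> norm (v s) \<le> R"
    using pv by eventually_elim (use order_trans[OF norm_snd_le] in blast)
  have m: "-1/c \<noteq> 0" using c_pos by simp
  from AE_lebesgue_affine[OF m v, of 0] AE_lebesgue_neq[of 0]
  show ?thesis
  proof eventually_elim
    case (elim z)
    show ?case
    proof
      assume z: "z \<in> {0..1}"
      have "-z/c < 0" using z elim c_pos by auto
      with elim char_in_past[OF z] have v: "\<bar>v (-z/c)\<bar> \<le> R" by simp
      have "exp (integral {-z/c..0} (\<lambda>q. a (p q) (z + c * q))) \<le> exp (abound R / c)"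
        using Xmap_terms_bound(1)[OF p R z, of "-z/c"] char_in_past[OF z] by simp
      with v have "\<bar>exp (integral {-z/c..0} (\<lambda>q. a (p q) (z + c * q))) * v (-z/c)\<bar> \<le> exp (abound R / c) * R"
        unfolding abs_mult by (intro mult_mono) auto
      with Xmap_terms_bound(2)[OF p R z] show "\<bar>Xmap c a g p v z\<bar> \<le> Xbound R"
        unfolding Xmap_def Xbound_def distrib_left by linarith
    qed
  qed
qed

text \<open>Measurability and the bound are established for bounded representatives of p and v and
  carried back, since the profile depends on the past only modulo null sets.\<close>

lemma linf_on_Xmap:
  assumes "linf_on {-1/c..<0} (\<lambda>s. (p s, v s))"
  shows "linf_on {0..1} (Xmap c a g p v)"
proof -
  have pv: "linf_on {-1/c..<0} p" "linf_on {-1/c..<0} v" using assms by (auto simp: linf_on_Pair_iff)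
  obtain p' R where p': "p' \<in> borel_measurable lebesgue" "\<And>s. norm (p' s) \<le> R"
    and R: "0 \<le> R" and aep: "AE s in lebesgue. s \<in> {-1/c..<0} \<longrightarrow> p s = p' s"
    by (rule linf_on_bounded_version[OF pv(1)]) (rule that)
  obtain v' Rv where v': "v' \<in> borel_measurable lebesgue" "\<And>s. norm (v' s) \<le> Rv"
    and Rv: "0 \<le> Rv" and aev: "AE s in lebesgue. s \<in> {-1/c..<0} \<longrightarrow> v s = v' s"
    by (rule linf_on_bounded_version[OF pv(2)]) (rule that)
  have "norm (p' s, v' s) \<le> R + Rv" for s
    by (rule order_trans[OF norm_Pair_le add_mono[OF p'(2) v'(2)]])
  then have "AE z in lebesgue. z \<in> {0..1} \<longrightarrow> \<bar>Xmap c a g p' v' z\<bar> \<le> Xbound (R + Rv)"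
    using R Rv by (intro Xmap_bound_AE) auto
  with Xmap_measurable_aux[OF p' v'(1)] have "linf_on {0..1} (Xmap c a g p' v')"
    unfolding linf_on_def by auto
  moreover have "AE z in lebesgue. z \<in> {0..1} \<longrightarrow> Xmap c a g p' v' z = Xmap c a g p v z"
    using Xmap_cong_AE[OF aep aev] by eventually_elim auto
  ultimately show ?thesis by (rule linf_on_cong_AE)
qed

text \<open>A perturbation of size E exp(\<mu> s) reaches position z in two ways. The boundary value
  travels for time z/c and arrives damped by exp(-\<mu> z/c). The perturbation of p acts only
  through integrals, in the exponent and in the source, and costs 1/\<mu>. The constant C is fixed
  before \<mu>, so that \<mu> can be chosen large afterwards.\<close>

lemma Xmap_lipschitz:
  "\<exists>C>0. \<forall>p v p' v' E \<mu> z. 0 \<le> E \<longrightarrow> 0 < \<mu> \<longrightarrow>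
     linf_on {-1/c..<0} p \<longrightarrow> linf_on {-1/c..<0} p' \<longrightarrow>
     (\<forall>s\<in>{-1/c..<0}. norm (p s, v s) \<le> R \<and> norm (p' s, v' s) \<le> R
        \<and> norm ((p s, v s) - (p' s, v' s)) \<le> E * exp (\<mu> * s)) \<longrightarrow> z \<in> {0<..1} \<longrightarrow>
     \<bar>Xmap c a g p v z - Xmap c a g p' v' z\<bar> \<le> C * E * (exp (-\<mu> * z / c) + 1 / \<mu>)"
proof -
  obtain L where L0: "0 \<le> L" and L: "\<And>p q z. norm p \<le> \<bar>R\<bar> \<Longrightarrow> norm q \<le> \<bar>R\<bar> \<Longrightarrow> z \<in> {0..1} \<Longrightarrow> \<bar>a p z - a q z\<bar> \<le> L * norm (p - q)"
    using a_lipschitz[of "\<bar>R\<bar>"] by blast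
  define A where "A = exp (abound \<bar>R\<bar> / c)"
  \<comment> \<open>The four summands come from the boundary value, from the changed exponential in
    front of it, from the changed source, and from the changed exponential under the source
    integral.\<close>
  define C where "C = A * (1 + L * \<bar>R\<bar> + gbound + L * gbound * \<bar>R\<bar> / c)"
  have A: "0 < A" by (simp add: A_def)
  have C: "0 < C" unfolding C_def using A L0 gbound_nonneg c_pos
    by (intro mult_pos_pos add_pos_nonneg) auto
  show ?thesis
  proof (intro exI[of _ C] conjI allI impI C)
    fix p p' :: "real \<Rightarrow> real^'n" and v v' :: "real \<Rightarrow> real" and E \<mu> z :: real
    assume E: "0 \<le> E" and \<mu>: "0 < \<mu>"
      and pl: "linf_on {-1/c..<0} p" and pl': "linf_on {-1/c..<0} p'"
      and H: "\<forall>s\<in>{-1/c..<0}. norm (p s, v s) \<le> R \<and> norm (p' s, v' s) \<le> R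
        \<and> norm ((p s, v s) - (p' s, v' s)) \<le> E * exp (\<mu> * s)"
      and z01: "z \<in> {0<..1}"
    have z: "z \<in> {0..1}" using z01 by auto
    have pR: "norm (p s) \<le> \<bar>R\<bar>" "norm (p' s) \<le> \<bar>R\<bar>" "\<bar>v' s\<bar> \<le> \<bar>R\<bar>"
      and d: "norm (p s - p' s) \<le> E * exp (\<mu> * s)" "\<bar>v s - v' s\<bar> \<le> E * exp (\<mu> * s)"
      if "s \<in> {-1/c..<0}" for s
      using bspec[OF H that] norm_fst_le[of "p s" "v s"] norm_fst_le[of "p' s" "v' s"] norm_snd_le[of "v' s" "p' s"]
        norm_fst_le[of "p s - p' s" "v s - v' s"] norm_snd_le[of "v s - v' s" "p s - p' s"] by auto
    have past: "q \<in> {-1/c..<0}" if "q \<in> {s..<0}" "s \<in> {-z/c..0}" for q s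
      using that char_in_past[OF z] by auto
    let ?I = "\<lambda>s. integral {s..0} (\<lambda>q. a (p q) (z + c * q))"
    let ?I' = "\<lambda>s. integral {s..0} (\<lambda>q. a (p' q) (z + c * q))"
    let ?g = "\<lambda>s. \<Sum>i\<in>UNIV. g i (z + c * s) * (p s) $ i"
    let ?g' = "\<lambda>s. \<Sum>i\<in>UNIV. g i (z + c * s) * (p' s) $ i"
    have aeR: "AE s in lebesgue. s \<in> {-1/c..<0} \<longrightarrow> norm (p s) \<le> \<bar>R\<bar>"
      "AE s in lebesgue. s \<in> {-1/c..<0} \<longrightarrow> norm (p' s) \<le> \<bar>R\<bar>" using pR by auto
    have IA: "?I s \<le> abound \<bar>R\<bar> / c" "?I' s \<le> abound \<bar>R\<bar> / c" if "s \<in> {-z/c..0}" for s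
      using Xmap_terms_bound(1)[OF aeR(1) _ z that] Xmap_terms_bound(1)[OF aeR(2) _ z that] by auto
    have Idiff: "\<bar>exp (?I s) - exp (?I' s)\<bar> \<le> A * (L * E / \<mu>)" if s: "s \<in> {-z/c..0}" for s
    proof -
      have sub: "{s..0} \<subseteq> {-z/c..0}" using s by auto
      have eq: "?I s - ?I' s = integral {s..0} (\<lambda>q. a (p q) (z + c * q) - a (p' q) (z + c * q))"
        using a_char_integrable_on(1)[OF pl z] a_char_integrable_on(1)[OF pl' z]
        by (intro Henstock_Kurzweil_Integration.integral_diff[symmetric] integrable_on_subinterval[OF _ sub])
      have "\<bar>integral {s..0} (\<lambda>q. a (p q) (z + c * q) - a (p' q) (z + c * q))\<bar> \<le> (L * E) / \<mu> + 0 * (- s)"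
      proof (rule abs_integral_le_exp)
        fix q assume q: "q \<in> {s..<0}"
        then have "q \<in> {-z/c..0}" using s by auto
        then have "\<bar>a (p q) (z + c * q) - a (p' q) (z + c * q)\<bar> \<le> L * norm (p q - p' q)"
          by (intro L pR char_in_unit[OF z] past[OF q s])
        also have "\<dots> \<le> L * (E * exp (\<mu> * q))"
          by (intro mult_left_mono d past[OF q s] L0)
        finally show "\<bar>a (p q) (z + c * q) - a (p' q) (z + c * q)\<bar> \<le> L * E * exp (\<mu> * q) + 0" by simp
      qed (use E L0 \<mu> s in auto)
      then have *: "\<bar>?I s - ?I' s\<bar> \<le> L * E / \<mu>" unfolding eq by simp
      have "\<bar>exp (?I s) - exp (?I' s)\<bar> \<le> A * \<bar>?I s - ?I' s\<bar>"
        unfolding A_def by (rule abs_exp_diff_le) (use IA[OF s] in auto)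
      also have "\<dots> \<le> A * (L * E / \<mu>)" using * A by (intro mult_left_mono) auto
      finally show ?thesis .
    qed
    have zc: "-z/c \<in> {-z/c..0}" "-z/c \<in> {-1/c..<0}" using char_in_past[OF z] z01 c_pos by auto
    have eA: "exp (?I s) \<le> A" if "s \<in> {-z/c..0}" for s using IA(1)[OF that] by (simp add: A_def)
    have T1: "\<bar>exp (?I (-z/c)) * v (-z/c) - exp (?I' (-z/c)) * v' (-z/c)\<bar>
        \<le> A * E * exp (-\<mu> * z / c) + A * (L * E / \<mu>) * \<bar>R\<bar>"
    proof -
      have "\<bar>exp (?I (-z/c)) * v (-z/c) - exp (?I' (-z/c)) * v' (-z/c)\<bar>
          \<le> A * (E * exp (\<mu> * (-z/c))) + A * (L * E / \<mu>) * \<bar>R\<bar>"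
        by (rule abs_mult_diff_le) (simp_all only: abs_exp_cancel eA[OF zc(1)] d(2)[OF zc(2)] Idiff[OF zc(1)] pR(3)[OF zc(2)])
      then show ?thesis by (simp add: mult.assoc)
    qed
    have n1: "0 \<le> A * gbound * E" and n2: "0 \<le> A * (L * E / \<mu>) * gbound * \<bar>R\<bar>"
      using A L0 E \<mu> gbound_nonneg by simp_all
    have T2: "\<bar>integral {-z/c..0} (\<lambda>s. exp (?I s) * ?g s) - integral {-z/c..0} (\<lambda>s. exp (?I' s) * ?g' s)\<bar>
        \<le> A * gbound * E / \<mu> + A * (L * E / \<mu>) * gbound * \<bar>R\<bar> * (1 / c)"
    proof -
      have eq: "integral {-z/c..0} (\<lambda>s. exp (?I s) * ?g s) - integral {-z/c..0} (\<lambda>s. exp (?I' s) * ?g' s)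
          = integral {-z/c..0} (\<lambda>s. exp (?I s) * ?g s - exp (?I' s) * ?g' s)"
        by (intro Henstock_Kurzweil_Integration.integral_diff[symmetric]
            a_char_integrable_on(2)[OF pl z] a_char_integrable_on(2)[OF pl' z])
      have "\<bar>integral {-z/c..0} (\<lambda>s. exp (?I s) * ?g s - exp (?I' s) * ?g' s)\<bar>
          \<le> A * gbound * E / \<mu> + A * (L * E / \<mu>) * gbound * \<bar>R\<bar> * (- (-z/c))"
      proof (rule abs_integral_le_exp)
        fix s assume s: "s \<in> {-z/c..<0}"
        then have s1: "s \<in> {-z/c..0}" and s2: "s \<in> {-1/c..<0}" using past[OF s zc(1)] by auto
        have gd: "?g s - ?g' s = (\<Sum>i\<in>UNIV. g i (z + c * s) * (p s - p' s) $ i)"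
          by (simp add: sum_subtractf algebra_simps)
        have g1: "\<bar>?g s - ?g' s\<bar> \<le> gbound * (E * exp (\<mu> * s))"
          unfolding gd using abs_g_sum_le[OF char_in_unit[OF z s1], of "p s - p' s"]
            mult_left_mono[OF d(1)[OF s2] gbound_nonneg] by linarith
        have g2: "\<bar>?g' s\<bar> \<le> gbound * \<bar>R\<bar>"
          using abs_g_sum_le[OF char_in_unit[OF z s1], of "p' s"]
            mult_left_mono[OF pR(2)[OF s2] gbound_nonneg] by linarith
        have "\<bar>exp (?I s) * ?g s - exp (?I' s) * ?g' s\<bar>
            \<le> A * (gbound * (E * exp (\<mu> * s))) + A * (L * E / \<mu>) * (gbound * \<bar>R\<bar>)"
          by (rule abs_mult_diff_le) (simp_all only: abs_exp_cancel eA[OF s1] Idiff[OF s1] g1 g2)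
        then show "\<bar>exp (?I s) * ?g s - exp (?I' s) * ?g' s\<bar>
            \<le> A * gbound * E * exp (\<mu> * s) + A * (L * E / \<mu>) * gbound * \<bar>R\<bar>" by (simp only: mult.assoc)
      qed (rule n1 n2 \<mu> char_in_past(2)[OF z])+
      also have "\<dots> \<le> A * gbound * E / \<mu> + A * (L * E / \<mu>) * gbound * \<bar>R\<bar> * (1 / c)"
        using char_in_past(1)[OF z] by (intro add_left_mono mult_left_mono n2) simp
      finally show ?thesis unfolding eq .
    qed
    have "\<bar>Xmap c a g p v z - Xmap c a g p' v' z\<bar>
        \<le> (A * E * exp (-\<mu> * z / c) + A * (L * E / \<mu>) * \<bar>R\<bar>)
          + (A * gbound * E / \<mu> + A * (L * E / \<mu>) * gbound * \<bar>R\<bar> * (1 / c))"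
      using T1 T2 unfolding Xmap_def by linarith
    also have "\<dots> = A * E * exp (-\<mu> * z / c) + A * (L * \<bar>R\<bar> + gbound + L * gbound * \<bar>R\<bar> / c) * E * (1 / \<mu>)"
      by (simp add: algebra_simps)
    also have "\<dots> \<le> C * E * exp (-\<mu> * z / c) + C * E * (1 / \<mu>)"
    proof -
      have "A \<le> C" "A * (L * \<bar>R\<bar> + gbound + L * gbound * \<bar>R\<bar> / c) \<le> C"
        unfolding C_def using A L0 gbound_nonneg c_pos by simp_all
      then show ?thesis using E \<mu> by (intro add_mono mult_right_mono) simp_all
    qed
    also have "\<dots> = C * E * (exp (-\<mu> * z / c) + 1 / \<mu>)" by (simp add: algebra_simps)
    finally show "\<bar>Xmap c a g p v z - Xmap c a g p' v' z\<bar> \<le> C * E * (exp (-\<mu> * z / c) + 1 / \<mu>)" .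
  qed
qed

end

subsection \<open>Existence for the delay equation\<close>

locale delay_system = transport_kernel c a g
  for c :: real and a :: "real^'n::finite \<Rightarrow> real \<Rightarrow> real" and g :: "'n \<Rightarrow> real \<Rightarrow> real" +
  fixes D :: "'d::euclidean_space set" and U :: "'u::euclidean_space set"
    and K :: "'n \<Rightarrow> ('d \<times> 'u) \<Rightarrow> (real \<Rightarrow> real) \<Rightarrow> real"
    and G :: "('d \<times> 'u) \<Rightarrow> (real \<Rightarrow> real) \<Rightarrow> real"
    and V :: "(real^'n) \<times> real \<Rightarrow> real"
    and \<gamma> :: "real \<Rightarrow> real" and lam :: real
  assumes D_compact: "compact D" and U_zero: "0 \<in> U"
    and A1: "\<exists>L \<sigma> :: real \<Rightarrow> real.
       mono_on {0..} L \<and> mono_on {0..} \<sigma> \<and> (\<forall>R\<ge>0. 0 \<le> L R \<and> 0 \<le> \<sigma> R) \<and>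
       (\<forall>R\<ge>0. \<forall>h\<in>{0<..<1}. \<forall>w\<in>D \<times> U. \<forall>x y. norm w \<le> R \<longrightarrow>
          linf_on {0<..1} x \<longrightarrow> (AE z in lebesgue. z \<in> {0<..1} \<longrightarrow> \<bar>x z\<bar> \<le> R) \<longrightarrow>
          linf_on {0<..1} y \<longrightarrow> (AE z in lebesgue. z \<in> {0<..1} \<longrightarrow> \<bar>y z\<bar> \<le> R) \<longrightarrow>
          \<bar>G w x - G w y\<bar> + (\<Sum>i\<in>UNIV. \<bar>K i w x - K i w y\<bar>)
            \<le> L R * h * esup {0<..h} (\<lambda>z. \<bar>x z - y z\<bar>)
              + L R * esup {h<..1} (\<lambda>z. \<bar>x z - y z\<bar>) \<and>
          \<bar>G w x\<bar> + (\<Sum>i\<in>UNIV. \<bar>K i w x\<bar>) \<le> \<sigma> R)"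
    and A2: "\<forall>\<delta>>0. \<forall>(p :: real \<Rightarrow> real^'n) (v :: real \<Rightarrow> real) (w :: real \<Rightarrow> 'd \<times> 'u).
       linf_on {-1/c..<\<delta>} (\<lambda>t. (p t, v t)) \<longrightarrow> linf_on {0..<\<delta>} w \<longrightarrow>
       (\<forall>t\<in>{0..<\<delta>}. w t \<in> D \<times> U) \<longrightarrow>
       linf_on {-1/c..<\<delta>} (\<lambda>t. if t < 0 then (p t, v t)
          else Fmap c a g K G (fst (w t)) (snd (w t)) (\<lambda>s. p (t + s)) (\<lambda>s. v (t + s)))"
    and V_cont: "continuous_on UNIV V" and V_nonneg: "\<forall>y. 0 \<le> V y"
    and V_zero: "V 0 = 0" and V_pos: "\<forall>y. y \<noteq> 0 \<longrightarrow> V y > 0"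
    and V_radunb: "filterlim V at_top at_infinity"
    and \<gamma>_cont: "continuous_on {0..} \<gamma>" and \<gamma>_mono: "mono_on {0..} \<gamma>"
    and \<gamma>_nonneg: "\<forall>s\<ge>0. 0 \<le> \<gamma> s"
    and lam: "0 < lam" "lam < 1"
    and small_gain: "\<forall>p v. linf_on {-1/c..<0} (\<lambda>s. (p s, v s)) \<longrightarrow> (\<forall>d\<in>D. \<forall>u\<in>U.
       V (Fmap c a g K G d u p v)
         \<le> lam * esup {-1/c..<0} (\<lambda>s. V (p s, v s)) + \<gamma> (norm u))"
begin

section \<open>Output map on profiles and on histories\<close>

definition Out :: "'d \<times> 'u \<Rightarrow> (real \<Rightarrow> real) \<Rightarrow> (real^'n) \<times> real" where
  "Out w x = ((\<chi> i. K i w x), G w x)"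

definition Fhist :: "'d \<times> 'u \<Rightarrow> (real \<Rightarrow> (real^'n) \<times> real) \<Rightarrow> (real^'n) \<times> real" where
  "Fhist w y = Fmap c a g K G (fst w) (snd w) (\<lambda>s. fst (y s)) (\<lambda>s. snd (y s))"

definition Xhist :: "(real \<Rightarrow> (real^'n) \<times> real) \<Rightarrow> real \<Rightarrow> real" where
  "Xhist y = Xmap c a g (\<lambda>s. fst (y s)) (\<lambda>s. snd (y s))"

lemma Fhist_eq: "Fhist w y = Out w (Xhist y)"
  by (simp add: Fhist_def Fmap_def Out_def Xhist_def Let_def)

lemma norm_Out_diff_le:
  "norm (Out w x - Out w y) \<le> \<bar>G w x - G w y\<bar> + (\<Sum>i\<in>UNIV. \<bar>K i w x - K i w y\<bar>)"
proof -
  have "norm (Out w x - Out w y) \<le> norm ((\<chi> i. K i w x) - (\<chi> i. K i w y)) + norm (G w x - G w y)"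
    unfolding Out_def diff_Pair by (rule norm_Pair_le)
  moreover have "norm ((\<chi> i. K i w x) - (\<chi> i. K i w y)) \<le> (\<Sum>i\<in>UNIV. \<bar>K i w x - K i w y\<bar>)"
    by (rule order_trans[OF norm_le_l1_cart]) simp
  ultimately show ?thesis by simp
qed

text \<open>The Lipschitz hypothesis for the combined output, with profiles on [0,1] as in the
  notion of solution; the two intervals differ by a null point.\<close>

lemma Out_lipschitz:
  assumes "0 \<le> R"
  shows "\<exists>L\<ge>0. \<forall>w\<in>D \<times> U. \<forall>h\<in>{0<..<1}. \<forall>x y. norm w \<le> R \<longrightarrow>
     linf_on {0..1} x \<longrightarrow> (AE z in lebesgue. z \<in> {0..1} \<longrightarrow> \<bar>x z\<bar> \<le> R) \<longrightarrow>
     linf_on {0..1} y \<longrightarrow> (AE z in lebesgue. z \<in> {0..1} \<longrightarrow> \<bar>y z\<bar> \<le> R) \<longrightarrow>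
     norm (Out w x - Out w y) \<le> L * h * esup {0<..h} (\<lambda>z. \<bar>x z - y z\<bar>)
              + L * esup {h<..1} (\<lambda>z. \<bar>x z - y z\<bar>)"
proof -
  obtain L \<sigma> where L0: "\<forall>R\<ge>0. 0 \<le> L R \<and> 0 \<le> (\<sigma> R :: real)" and
    L: "\<forall>R\<ge>0. \<forall>h\<in>{0<..<1}. \<forall>w\<in>D \<times> U. \<forall>x y. norm w \<le> R \<longrightarrow>
          linf_on {0<..1} x \<longrightarrow> (AE z in lebesgue. z \<in> {0<..1} \<longrightarrow> \<bar>x z\<bar> \<le> R) \<longrightarrow>
          linf_on {0<..1} y \<longrightarrow> (AE z in lebesgue. z \<in> {0<..1} \<longrightarrow> \<bar>y z\<bar> \<le> R) \<longrightarrow>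
          \<bar>G w x - G w y\<bar> + (\<Sum>i\<in>UNIV. \<bar>K i w x - K i w y\<bar>)
            \<le> L R * h * esup {0<..h} (\<lambda>z. \<bar>x z - y z\<bar>)
              + L R * esup {h<..1} (\<lambda>z. \<bar>x z - y z\<bar>) \<and>
          \<bar>G w x\<bar> + (\<Sum>i\<in>UNIV. \<bar>K i w x\<bar>) \<le> \<sigma> R"
    using A1 by (elim exE conjE) (rule that)
  show ?thesis
  proof (intro exI[of _ "L R"] conjI ballI allI impI)
    show "0 \<le> L R" using L0 assms by blast
    fix w and h :: real and x y
    assume w: "w \<in> D \<times> U" and h: "h \<in> {0<..<1}" and wR: "norm w \<le> R"
      and x: "linf_on {0..1} x" and xR: "AE z in lebesgue. z \<in> {0..1} \<longrightarrow> \<bar>x z\<bar> \<le> R"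
      and y: "linf_on {0..1} y" and yR: "AE z in lebesgue. z \<in> {0..1} \<longrightarrow> \<bar>y z\<bar> \<le> R"
    have x': "linf_on {0<..1} x" "linf_on {0<..1} y"
      by (auto intro: linf_on_subset[OF x] linf_on_subset[OF y])
    have xR': "AE z in lebesgue. z \<in> {0<..1} \<longrightarrow> \<bar>x z\<bar> \<le> R" using xR by eventually_elim auto
    have yR': "AE z in lebesgue. z \<in> {0<..1} \<longrightarrow> \<bar>y z\<bar> \<le> R" using yR by eventually_elim auto
    from L[rule_format, OF assms h w wR x'(1) xR' x'(2) yR'] norm_Out_diff_le[of w x y]
    show "norm (Out w x - Out w y) \<le> L R * h * esup {0<..h} (\<lambda>z. \<bar>x z - y z\<bar>)
              + L R * esup {h<..1} (\<lambda>z. \<bar>x z - y z\<bar>)" by linarith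
  qed
qed

lemma linf_on_AE_bound:
  assumes "linf_on S f" obtains B where "0 \<le> B" "AE t in lebesgue. t \<in> S \<longrightarrow> norm (f t) \<le> B"
proof -
  from assms obtain B where "AE t in lebesgue. t \<in> S \<longrightarrow> norm (f t) \<le> B" by (auto simp: linf_on_def)
  then have "AE t in lebesgue. t \<in> S \<longrightarrow> norm (f t) \<le> max 0 B" by eventually_elim auto
  then show thesis using that[of "max 0 B"] by simp
qed

text \<open>\<open>K\<close> and \<open>G\<close> are formally functionals of functions, not of
  classes modulo null sets. The Lipschitz bound makes them insensitive to null sets, because both
  essential suprema of the difference vanish; h = 1/2 is an arbitrary choice.\<close>

lemma Out_cong_AE:
  assumes w: "w \<in> D \<times> U" and x: "linf_on {0..1} x" and y: "linf_on {0..1} y"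
    and ae: "AE z in lebesgue. z \<in> {0..1} \<longrightarrow> x z = y z"
  shows "Out w x = Out w y"
proof -
  obtain B where B: "0 \<le> B" "AE z in lebesgue. z \<in> {0..1} \<longrightarrow> norm (x z) \<le> B"
    by (rule linf_on_AE_bound[OF x])
  define R where "R = max B (norm w)"
  have xR: "AE z in lebesgue. z \<in> {0..1} \<longrightarrow> \<bar>x z\<bar> \<le> R"
    using B(2) by eventually_elim (auto simp: R_def)
  have yR: "AE z in lebesgue. z \<in> {0..1} \<longrightarrow> \<bar>y z\<bar> \<le> R"
    using xR ae by eventually_elim auto
  have R: "0 \<le> R" "norm w \<le> R" using B by (auto simp: R_def)
  obtain L where L: "\<forall>w\<in>D \<times> U. \<forall>h\<in>{0<..<1}. \<forall>x y. norm w \<le> R \<longrightarrow>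
     linf_on {0..1} x \<longrightarrow> (AE z in lebesgue. z \<in> {0..1} \<longrightarrow> \<bar>x z\<bar> \<le> R) \<longrightarrow>
     linf_on {0..1} y \<longrightarrow> (AE z in lebesgue. z \<in> {0..1} \<longrightarrow> \<bar>y z\<bar> \<le> R) \<longrightarrow>
     norm (Out w x - Out w y) \<le> L * h * esup {0<..h} (\<lambda>z. \<bar>x z - y z\<bar>)
              + L * esup {h<..1} (\<lambda>z. \<bar>x z - y z\<bar>)"
    using Out_lipschitz[OF R(1)] by (elim exE conjE) (rule that)
  have h: "1/2 \<in> {0<..<1::real}" by simp
  have e1: "esup {0<..1/2} (\<lambda>z. \<bar>x z - y z\<bar>) = 0"
    by (rule esup_AE_zero) (use ae in eventually_elim, auto)
  have e2: "esup {1/2<..1} (\<lambda>z. \<bar>x z - y z\<bar>) = 0"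
    by (rule esup_AE_zero) (use ae in eventually_elim, auto)
  have "norm (Out w x - Out w y) \<le> 0"
    using L[rule_format, OF w h R(2) x xR y yR] unfolding e1 e2 by simp
  then show ?thesis by simp
qed

lemma linf_on_Xhist: "linf_on {-1/c..<0} y \<Longrightarrow> linf_on {0..1} (Xhist y)"
  unfolding Xhist_def by (rule linf_on_Xmap) simp

lemma Xhist_bound_AE:
  assumes "AE s in lebesgue. s \<in> {-1/c..<0} \<longrightarrow> norm (y s) \<le> R" "0 \<le> R"
  shows "AE z in lebesgue. z \<in> {0..1} \<longrightarrow> \<bar>Xhist y z\<bar> \<le> Xbound R"
  unfolding Xhist_def by (rule Xmap_bound_AE) (use assms in simp_all)

lemma Xhist_cong_AE:
  assumes "AE s in lebesgue. s \<in> {-1/c..<0} \<longrightarrow> y s = y' s"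
  shows "AE z in lebesgue. z \<in> {0..1} \<longrightarrow> Xhist y z = Xhist y' z"
  unfolding Xhist_def
  by (rule Xmap_cong_AE; use assms in eventually_elim) auto

lemma linf_on_history:
  fixes y :: "real \<Rightarrow> (real^'n) \<times> real"
  assumes "linf_on {-1/c..<T} y" "0 \<le> t" "t \<le> T"
  shows "linf_on {-1/c..<0} (\<lambda>s. y (t + s))"
  by (rule linf_on_shift) (rule linf_on_subset[OF assms(1)], use assms in auto)

text \<open>The contraction in the exponentially weighted norm: the part of the profile near
  \<open>z = 0\<close>, which sees the most recent values, is damped by the factor \<open>h\<close> in the Lipschitz
  condition, while the rest is delayed by at least \<open>h/c\<close> and is damped by the weight.\<close>

lemma Fhist_contraction:
  assumes M: "0 \<le> M" and Rw: "0 \<le> Rw"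
  shows "\<exists>\<mu>>0. \<forall>w\<in>D \<times> U. \<forall>y y' E. norm w \<le> Rw \<longrightarrow> 0 \<le> E \<longrightarrow>
       linf_on {-1/c..<0} y \<longrightarrow> linf_on {-1/c..<0} y' \<longrightarrow>
       (\<forall>s\<in>{-1/c..<0}. norm (y s) \<le> M \<and> norm (y' s) \<le> M \<and> norm (y s - y' s) \<le> E * exp (\<mu> * s)) \<longrightarrow>
       norm (Fhist w y - Fhist w y') \<le> E / 2"
proof -
  \<comment> \<open>A single radius has to dominate both the profiles and the inputs in the
    Lipschitz hypothesis.\<close>
  define R where "R = max (Xbound M) Rw"
  have R: "0 \<le> R" using Rw by (auto simp: R_def)
  obtain C where C: "0 < C" and CX: "\<forall>p v p' v' E \<mu> z. 0 \<le> E \<longrightarrow> 0 < \<mu> \<longrightarrow>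
     linf_on {-1/c..<0} p \<longrightarrow> linf_on {-1/c..<0} p' \<longrightarrow>
     (\<forall>s\<in>{-1/c..<0}. norm (p s, v s) \<le> M \<and> norm (p' s, v' s) \<le> M
        \<and> norm ((p s, v s) - (p' s, v' s)) \<le> E * exp (\<mu> * s)) \<longrightarrow> z \<in> {0<..1} \<longrightarrow>
     \<bar>Xmap c a g p v z - Xmap c a g p' v' z\<bar> \<le> C * E * (exp (-\<mu> * z / c) + 1 / \<mu>)"
    using Xmap_lipschitz[of M] by (elim exE conjE) (rule that)
  obtain L where L0: "0 \<le> L" and L: "\<forall>w\<in>D \<times> U. \<forall>h\<in>{0<..<1}. \<forall>x y. norm w \<le> R \<longrightarrow>
     linf_on {0..1} x \<longrightarrow> (AE z in lebesgue. z \<in> {0..1} \<longrightarrow> \<bar>x z\<bar> \<le> R) \<longrightarrow>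
     linf_on {0..1} y \<longrightarrow> (AE z in lebesgue. z \<in> {0..1} \<longrightarrow> \<bar>y z\<bar> \<le> R) \<longrightarrow>
     norm (Out w x - Out w y) \<le> L * h * esup {0<..h} (\<lambda>z. \<bar>x z - y z\<bar>)
              + L * esup {h<..1} (\<lambda>z. \<bar>x z - y z\<bar>)"
    using Out_lipschitz[OF R] by (elim exE conjE) (rule that)
  define Q where "Q = L * C"
  have Q: "0 \<le> Q" using L0 C by (simp add: Q_def)
  \<comment> \<open>For \<mu> \<ge> 1 the bracket exp(-\<mu> z/c) + 1/\<mu> is at most 2, so h is
    chosen to give 2 Q h \<le> 1/4. Only then is \<mu> chosen, large in terms of h, so that the part
    z > h contributes at most another 1/4.\<close>
  define h where "h = min (1/2) (1 / (8 * (Q + 1)))"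
  have h: "h \<in> {0<..<1}" using Q by (auto simp: h_def)
  have "h * (8 * (Q + 1)) \<le> 1"
  proof -
    have "h \<le> 1 / (8 * (Q + 1))" by (simp add: h_def)
    then show ?thesis using Q by (simp add: field_simps)
  qed
  then have hQ: "Q * h * 2 \<le> 1/4" using h by (simp add: algebra_simps)
  have "((\<lambda>\<mu>. exp (-(h / c) * \<mu>) + 1 / \<mu>) \<longlongrightarrow> 0 + 0) at_top"
  proof (rule tendsto_add)
    have "filterlim (\<lambda>\<mu>. -(h / c) * \<mu>) at_bot at_top"
      using h c_pos by (intro filterlim_tendsto_neg_mult_at_bot[OF tendsto_const _ filterlim_ident]) auto
    then show "((\<lambda>\<mu>. exp (-(h / c) * \<mu>)) \<longlongrightarrow> 0) at_top"
      by (rule filterlim_compose[OF exp_at_bot])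
    show "((\<lambda>\<mu>::real. 1 / \<mu>) \<longlongrightarrow> 0) at_top"
      by (rule tendsto_divide_0[OF tendsto_const]) (simp add: filterlim_at_top_imp_at_infinity filterlim_ident)
  qed
  then have "eventually (\<lambda>\<mu>. exp (-(h / c) * \<mu>) + 1 / \<mu> < 1 / (4 * (Q + 1))) at_top"
    using Q by (intro order_tendstoD(2)[of _ 0]) auto
  then have "eventually (\<lambda>\<mu>. exp (-(h / c) * \<mu>) + 1 / \<mu> < 1 / (4 * (Q + 1)) \<and> 1 \<le> \<mu>) at_top"
    by (rule eventually_conj) (rule eventually_ge_at_top)
  then obtain \<mu> where \<mu>: "exp (-(h / c) * \<mu>) + 1 / \<mu> < 1 / (4 * (Q + 1))" "1 \<le> \<mu>"
    using eventually_happens'[OF trivial_limit_at_top_linorder] by blast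
  have "(exp (-(h / c) * \<mu>) + 1 / \<mu>) * (4 * (Q + 1)) \<le> 1"
    using \<mu> Q by (simp add: field_simps)
  moreover have "0 \<le> exp (-(h / c) * \<mu>) + 1 / \<mu>" using \<mu> by simp
  ultimately have \<mu>Q: "Q * (exp (-(h / c) * \<mu>) + 1 / \<mu>) \<le> 1/4" by (simp add: algebra_simps)
  show ?thesis
  proof (intro exI[of _ \<mu>] conjI ballI allI impI)
    show "0 < \<mu>" using \<mu> by simp
    fix w :: "'d \<times> 'u" and y y' :: "real \<Rightarrow> (real^'n) \<times> real" and E :: real
    assume w: "w \<in> D \<times> U" "norm w \<le> Rw" and E: "0 \<le> E"
      and y: "linf_on {-1/c..<0} y" and y': "linf_on {-1/c..<0} y'"
      and H: "\<forall>s\<in>{-1/c..<0}. norm (y s) \<le> M \<and> norm (y' s) \<le> M \<and> norm (y s - y' s) \<le> E * exp (\<mu> * s)"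
    have yM: "\<And>s. s \<in> {-1/c..<0} \<Longrightarrow> norm (y s) \<le> M" and yM': "\<And>s. s \<in> {-1/c..<0} \<Longrightarrow> norm (y' s) \<le> M"
      and d: "\<And>s. s \<in> {-1/c..<0} \<Longrightarrow> norm (y s - y' s) \<le> E * exp (\<mu> * s)"
      using H by blast+
    have p: "linf_on {-1/c..<0} (\<lambda>s. fst (y s))" "linf_on {-1/c..<0} (\<lambda>s. fst (y' s))"
      using linf_on_Pair_iff[of "{-1/c..<0}" "\<lambda>s. fst (y s)" "\<lambda>s. snd (y s)"]
        linf_on_Pair_iff[of "{-1/c..<0}" "\<lambda>s. fst (y' s)" "\<lambda>s. snd (y' s)"] y y' by auto
    have X: "\<bar>Xhist y z - Xhist y' z\<bar> \<le> C * E * (exp (-\<mu> * z / c) + 1 / \<mu>)" if "z \<in> {0<..1}" for z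
      unfolding Xhist_def
      using CX[rule_format, OF E _ p _ that, of \<mu> "\<lambda>s. snd (y s)" "\<lambda>s. snd (y' s)"] yM yM' d \<mu> by simp
    have CE: "0 \<le> C * E" using C E by simp
    have e1: "esup {0<..h} (\<lambda>z. \<bar>Xhist y z - Xhist y' z\<bar>) \<le> C * E * 2"
    proof (rule esup_le)
      show "AE z in lebesgue. z \<in> {0<..h} \<longrightarrow> \<bar>Xhist y z - Xhist y' z\<bar> \<le> C * E * 2"
      proof (intro always_eventually allI impI)
        fix z assume z: "z \<in> {0<..h}"
        have "exp (-\<mu> * z / c) + 1 / \<mu> \<le> 1 + 1" using \<mu> z c_pos by (intro add_mono) auto
        then have "C * E * (exp (-\<mu> * z / c) + 1 / \<mu>) \<le> C * E * 2" using CE by (intro mult_left_mono) auto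
        with X[of z] z h show "\<bar>Xhist y z - Xhist y' z\<bar> \<le> C * E * 2" by simp
      qed
    qed (use CE in simp)
    have e2: "esup {h<..1} (\<lambda>z. \<bar>Xhist y z - Xhist y' z\<bar>) \<le> C * E * (exp (-(h / c) * \<mu>) + 1 / \<mu>)"
    proof (rule esup_le)
      show "AE z in lebesgue. z \<in> {h<..1} \<longrightarrow> \<bar>Xhist y z - Xhist y' z\<bar> \<le> C * E * (exp (-(h / c) * \<mu>) + 1 / \<mu>)"
      proof (intro always_eventually allI impI)
        fix z assume z: "z \<in> {h<..1}"
        have "-\<mu> * z / c \<le> -(h / c) * \<mu>" using \<mu> z c_pos by (simp add: field_simps)
        then have "C * E * (exp (-\<mu> * z / c) + 1 / \<mu>) \<le> C * E * (exp (-(h / c) * \<mu>) + 1 / \<mu>)"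
          using CE by (intro mult_left_mono add_right_mono) auto
        with X[of z] z h show "\<bar>Xhist y z - Xhist y' z\<bar> \<le> C * E * (exp (-(h / c) * \<mu>) + 1 / \<mu>)" by simp
      qed
    qed (use CE \<mu> in simp)
    have wR: "norm w \<le> R" using w by (simp add: R_def)
    have XR: "AE z in lebesgue. z \<in> {0..1} \<longrightarrow> \<bar>Xhist y z\<bar> \<le> R"
      using Xhist_bound_AE[of y M] yM M by (auto simp: R_def elim!: eventually_mono)
    have XR': "AE z in lebesgue. z \<in> {0..1} \<longrightarrow> \<bar>Xhist y' z\<bar> \<le> R"
      using Xhist_bound_AE[of y' M] yM' M by (auto simp: R_def elim!: eventually_mono)
    have "norm (Fhist w y - Fhist w y') \<le> L * h * esup {0<..h} (\<lambda>z. \<bar>Xhist y z - Xhist y' z\<bar>)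
        + L * esup {h<..1} (\<lambda>z. \<bar>Xhist y z - Xhist y' z\<bar>)"
      unfolding Fhist_eq
      by (rule L[rule_format, OF w(1) h wR linf_on_Xhist[OF y] XR linf_on_Xhist[OF y'] XR'])
    also have "\<dots> \<le> L * h * (C * E * 2) + L * (C * E * (exp (-(h / c) * \<mu>) + 1 / \<mu>))"
      using L0 h by (intro add_mono mult_left_mono e1 e2) auto
    also have "\<dots> = (Q * h * 2) * E + (Q * (exp (-(h / c) * \<mu>) + 1 / \<mu>)) * E"
      by (simp add: Q_def algebra_simps)
    also have "\<dots> \<le> 1/4 * E + 1/4 * E"
      using hQ \<mu>Q E by (intro add_mono mult_right_mono) auto
    finally show "norm (Fhist w y - Fhist w y') \<le> E / 2" by simp
  qed
qed

section \<open>Lyapunov bounds and Picard iteration\<close>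

lemma V_bounded_on_cball: "\<exists>B\<ge>0. \<forall>y. norm y \<le> r \<longrightarrow> V y \<le> B"
proof -
  have "compact (V ` cball 0 r)"
    by (intro compact_continuous_image continuous_on_subset[OF V_cont]) auto
  then obtain B where "\<forall>x\<in>V ` cball 0 r. norm x \<le> B"
    using compact_imp_bounded bounded_iff by blast
  then have "V y \<le> max 0 B" if "norm y \<le> r" for y
    using that by (auto simp: le_max_iff_disj abs_le_iff)
  then show ?thesis by (intro exI[of _ "max 0 B"]) auto
qed

lemma small_gain_Fhist:
  assumes "linf_on {-1/c..<0} y" "w \<in> D \<times> U" "0 \<le> S"
    and S: "AE s in lebesgue. s \<in> {-1/c..<0} \<longrightarrow> V (y s) \<le> S"
  shows "V (Fhist w y) \<le> lam * S + \<gamma> (norm (snd w))"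
proof -
  have "V (Fhist w y) \<le> lam * esup {-1/c..<0} (\<lambda>s. V (y s)) + \<gamma> (norm (snd w))"
    using small_gain[rule_format, of "\<lambda>s. fst (y s)" "\<lambda>s. snd (y s)" "fst w" "snd w"] assms
    by (auto simp: Fhist_def mem_Times_iff)
  also have "\<dots> \<le> lam * S + \<gamma> (norm (snd w))"
    using esup_le[OF \<open>0 \<le> S\<close> S] lam by simp
  finally show ?thesis .
qed

text \<open>Picard iteration started at the history extended by \<open>0\<close>: the small-gain inequality
  keeps all iterates in one sublevel set of \<open>V\<close>, so no truncation is needed.\<close>

lemma history_solution:
  fixes h :: "real \<Rightarrow> (real^'n) \<times> real" and w :: "real \<Rightarrow> 'd \<times> 'u"
  assumes h: "linf_on {-1/c..<0} h" and hb: "\<And>s. s \<in> {-1/c..<0} \<Longrightarrow> norm (h s) \<le> Mh"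
    and w: "\<And>t. 0 \<le> t \<Longrightarrow> w t \<in> D \<times> U" and wl: "\<And>\<delta>. 0 < \<delta> \<Longrightarrow> linf_on {0..<\<delta>} w"
    and wb: "\<And>T. \<exists>B. \<forall>t\<in>{0..<T}. norm (w t) \<le> B"
  obtains y where "\<And>t. t \<in> {-1/c..<0} \<Longrightarrow> y t = h t"
    "\<And>T. 0 < T \<Longrightarrow> linf_on {-1/c..<T} y"
    "\<And>T. 0 < T \<Longrightarrow> \<exists>M\<ge>0. \<forall>t\<in>{-1/c..<T}. norm (y t) \<le> M"
    "\<And>t. 0 \<le> t \<Longrightarrow> y t = Fhist (w t) (\<lambda>s. y (t + s))"
proof -
  define \<Phi> where "\<Phi> y t = (if t < 0 then y t else Fhist (w t) (\<lambda>s. y (t + s)))" for y t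
  define Y where "Y k = (\<Phi> ^^ k) (\<lambda>t. if t < 0 then h t else 0)" for k
  have Y0: "Y 0 t = (if t < 0 then h t else 0)" for t by (simp add: Y_def)
  have YS: "Y (Suc k) t = (if t < 0 then Y k t else Fhist (w t) (\<lambda>s. Y k (t + s)))" for k t
    by (simp add: Y_def \<Phi>_def)
  have Yneg: "Y k t = h t" if "t < 0" for k t
    by (induction k) (use that in \<open>auto simp: Y0 YS\<close>)
  have Yl: "linf_on {-1/c..<T} (Y k)" if T: "0 < T" for k T
  proof (induction k)
    case 0
    have "linf_on {-1/c..<0} (Y 0)"
      by (rule linf_on_cong_AE[OF h]) (simp add: Y0)
    moreover have "linf_on {0..<T} (\<lambda>_. 0 :: (real^'n) \<times> real)"
      by (rule linf_on_measurable_bounded[where B = 0]) auto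
    then have "linf_on {0..<T} (Y 0)"
      by (rule linf_on_cong_AE) (simp add: Y0)
    ultimately have "linf_on ({-1/c..<0} \<union> {0..<T}) (Y 0)" by (rule linf_on_Un) auto
    moreover have "{-1/c..<0} \<union> {0..<T} = {-1/c..<T}"
      by (rule ivl_disj_un_two(3)) (use T c_pos in auto)
    ultimately show ?case by simp
  next
    case (Suc k)
    have "linf_on {-1/c..<T} (\<lambda>t. if t < 0 then (fst (Y k t), snd (Y k t))
          else Fmap c a g K G (fst (w t)) (snd (w t)) (\<lambda>s. fst (Y k (t + s))) (\<lambda>s. snd (Y k (t + s))))"
      using A2[rule_format, OF T, of "\<lambda>t. fst (Y k t)" "\<lambda>t. snd (Y k t)" w] Suc wl[OF T] w by simp
    moreover have "(\<lambda>t. if t < 0 then (fst (Y k t), snd (Y k t))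
          else Fmap c a g K G (fst (w t)) (snd (w t)) (\<lambda>s. fst (Y k (t + s))) (\<lambda>s. snd (Y k (t + s)))) = Y (Suc k)"
      by (simp add: YS Fhist_def fun_eq_iff)
    ultimately show ?case by simp
  qed
  have Yh: "linf_on {-1/c..<0} (\<lambda>s. Y k (t + s))" if "0 \<le> t" for k t
    by (rule linf_on_history[OF Yl[of "t + 1" k]]) (use that in auto)
  have bound: "\<exists>M\<ge>0. \<forall>k. \<forall>t\<in>{-1/c..<T}. norm (Y k t) \<le> M" if T: "0 < T" for T
  proof -
    obtain B where B: "\<And>t. t \<in> {0..<T} \<Longrightarrow> norm (w t) \<le> B" using wb[of T] by blast
    have B0: "0 \<le> B" using order_trans[OF norm_ge_zero B[of 0]] T by simp
    obtain Vh where Vh: "0 \<le> Vh" "\<And>y. norm y \<le> Mh \<Longrightarrow> V y \<le> Vh" using V_bounded_on_cball[of Mh] by blast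
    \<comment> \<open>The least level above the initial data that the map from S to lam S +
      \<gamma>(B) does not raise. Since V 0 = 0, the extension by 0 starts below it.\<close>
    define S where "S = max Vh (\<gamma> B / (1 - lam))"
    have S: "0 \<le> S" "lam * S + \<gamma> B \<le> S"
    proof -
      show "0 \<le> S" using Vh by (simp add: S_def)
      have "\<gamma> B / (1 - lam) \<le> S" by (simp add: S_def)
      then have "\<gamma> B \<le> S * (1 - lam)" using lam by (simp add: pos_divide_le_eq)
      then show "lam * S + \<gamma> B \<le> S" by (simp add: algebra_simps)
    qed
    have VY: "\<forall>t\<in>{-1/c..<T}. V (Y k t) \<le> S" for k
    proof (induction k)
      case 0
      show ?case using Vh hb V_zero S by (auto simp: Y0 S_def le_max_iff_disj)
    next
      case (Suc k)
      show ?case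
      proof
        fix t assume t: "t \<in> {-1/c..<T}"
        show "V (Y (Suc k) t) \<le> S"
        proof (cases "t < 0")
          case True
          then show ?thesis using Suc t by (simp add: YS)
        next
          case False
          have "norm (snd (w t)) \<le> B"
            using norm_snd_le[of "snd (w t)" "fst (w t)"] B[of t] False t by auto
          then have \<gamma>: "\<gamma> (norm (snd (w t))) \<le> \<gamma> B" using \<gamma>_mono B0 by (auto simp: mono_on_def)
          have "V (Fhist (w t) (\<lambda>s. Y k (t + s))) \<le> lam * S + \<gamma> (norm (snd (w t)))"
          proof (rule small_gain_Fhist[OF Yh _ S(1)])
            show "AE s in lebesgue. s \<in> {-1/c..<0} \<longrightarrow> V (Y k (t + s)) \<le> S"
              by (intro always_eventually allI impI bspec[OF Suc]) (use False t in auto)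
          qed (use w False in auto)
          with \<gamma> S False show ?thesis by (simp add: YS)
        qed
      qed
    qed
    obtain M where "0 \<le> M" "\<And>y. V y \<le> S \<Longrightarrow> norm y \<le> M"
      using radially_unbounded_sublevel_bounded[OF V_radunb, of S] by blast
    then show ?thesis using VY by blast
  qed
  have contr: "\<exists>M \<mu>. 0 \<le> M \<and> 0 < \<mu> \<and> (\<forall>k. \<forall>t\<in>{-1/c..<T}. norm (Y k t) \<le> M) \<and>
      (\<forall>k. \<forall>t\<in>{-1/c..<T}. norm (Y (Suc k) t - Y k t) \<le> 2 * M * (1/2) ^ k * exp (\<mu> * t)) \<and>
      (\<forall>t\<in>{0..<T}. \<forall>y y' E. 0 \<le> E \<longrightarrow> linf_on {-1/c..<0} y \<longrightarrow> linf_on {-1/c..<0} y' \<longrightarrow>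
         (\<forall>s\<in>{-1/c..<0}. norm (y s) \<le> M \<and> norm (y' s) \<le> M \<and> norm (y s - y' s) \<le> E * exp (\<mu> * s)) \<longrightarrow>
         norm (Fhist (w t) y - Fhist (w t) y') \<le> E / 2)"
    if T: "0 < T" for T
  proof -
    obtain B where B: "\<And>t. t \<in> {0..<T} \<Longrightarrow> norm (w t) \<le> B" using wb[of T] by blast
    have B0: "0 \<le> B" using order_trans[OF norm_ge_zero B[of 0]] T by simp
    obtain M where M: "0 \<le> M" "\<And>k t. t \<in> {-1/c..<T} \<Longrightarrow> norm (Y k t) \<le> M" using bound[OF T] by blast
    obtain \<mu> where \<mu>: "0 < \<mu>" and ct: "\<forall>w\<in>D \<times> U. \<forall>y y' E. norm w \<le> B \<longrightarrow> 0 \<le> E \<longrightarrow>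
       linf_on {-1/c..<0} y \<longrightarrow> linf_on {-1/c..<0} y' \<longrightarrow>
       (\<forall>s\<in>{-1/c..<0}. norm (y s) \<le> M \<and> norm (y' s) \<le> M \<and> norm (y s - y' s) \<le> E * exp (\<mu> * s)) \<longrightarrow>
       norm (Fhist w y - Fhist w y') \<le> E / 2"
      using Fhist_contraction[OF M(1) B0] by (elim exE conjE) (rule that)
    \<comment> \<open>The first increment is at most 2M because both iterates are bounded by M; from
      then on each application of F halves the weighted difference.\<close>
    have inc: "\<forall>t\<in>{-1/c..<T}. norm (Y (Suc k) t - Y k t) \<le> 2 * M * (1/2) ^ k * exp (\<mu> * t)" for k
    proof (induction k)
      case 0
      show ?case
      proof
        fix t assume t: "t \<in> {-1/c..<T}"
        show "norm (Y (Suc 0) t - Y 0 t) \<le> 2 * M * (1/2) ^ 0 * exp (\<mu> * t)"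
        proof (cases "t < 0")
          case True
          then show ?thesis using M(1) by (simp add: YS)
        next
          case False
          have "norm (Y (Suc 0) t - Y 0 t) \<le> M + M"
            using M(2)[OF t] by (intro order_trans[OF norm_triangle_ineq4] add_mono) auto
          also have "\<dots> \<le> (2 * M) * exp (\<mu> * t)"
            using mult_left_mono[of 1 "exp (\<mu> * t)" "2 * M"] False M(1) \<mu> by simp
          finally show ?thesis by simp
        qed
      qed
    next
      case (Suc k)
      show ?case
      proof
        fix t assume t: "t \<in> {-1/c..<T}"
        show "norm (Y (Suc (Suc k)) t - Y (Suc k) t) \<le> 2 * M * (1/2) ^ Suc k * exp (\<mu> * t)"
        proof (cases "t < 0")
          case True
          then show ?thesis using M(1) by (simp add: YS)
        next
          case False
          have mem: "t + s \<in> {-1/c..<T}" if "s \<in> {-1/c..<0}" for s using that t False by auto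
          \<comment> \<open>Since exp(\<mu> (t + s)) = exp(\<mu> t) exp(\<mu> s), the contraction
            applies to the history at time t with E equal to the previous bound evaluated at
            t.\<close>
          have "norm (Fhist (w t) (\<lambda>s. Y (Suc k) (t + s)) - Fhist (w t) (\<lambda>s. Y k (t + s)))
              \<le> (2 * M * (1/2) ^ k * exp (\<mu> * t)) / 2"
          proof (rule ct[rule_format])
            fix s assume s: "s \<in> {-1/c..<0}"
            show "norm (Y (Suc k) (t + s)) \<le> M \<and> norm (Y k (t + s)) \<le> M \<and>
                norm (Y (Suc k) (t + s) - Y k (t + s)) \<le> 2 * M * (1/2) ^ k * exp (\<mu> * t) * exp (\<mu> * s)"
              using bspec[OF Suc mem[OF s]] M(2)[OF mem[OF s]] by (simp add: exp_add distrib_left mult.assoc)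
          qed (use w B t False Yh M in auto)
          then show ?thesis using False by (simp add: YS[of "Suc k"] YS[of k] del: funpow.simps)
        qed
      qed
    qed
    have M': "\<forall>k. \<forall>t\<in>{-1/c..<T}. norm (Y k t) \<le> M" using M(2) by blast
    have inc': "\<forall>k. \<forall>t\<in>{-1/c..<T}. norm (Y (Suc k) t - Y k t) \<le> 2 * M * (1/2) ^ k * exp (\<mu> * t)"
      using inc by (rule allI)
    have ct': "\<forall>t\<in>{0..<T}. \<forall>y y' E. 0 \<le> E \<longrightarrow> linf_on {-1/c..<0} y \<longrightarrow> linf_on {-1/c..<0} y' \<longrightarrow>
         (\<forall>s\<in>{-1/c..<0}. norm (y s) \<le> M \<and> norm (y' s) \<le> M \<and> norm (y s - y' s) \<le> E * exp (\<mu> * s)) \<longrightarrow>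
         norm (Fhist (w t) y - Fhist (w t) y') \<le> E / 2"
    proof
      fix t assume t: "t \<in> {0..<T}"
      show "\<forall>y y' E. 0 \<le> E \<longrightarrow> linf_on {-1/c..<0} y \<longrightarrow> linf_on {-1/c..<0} y' \<longrightarrow>
         (\<forall>s\<in>{-1/c..<0}. norm (y s) \<le> M \<and> norm (y' s) \<le> M \<and> norm (y s - y' s) \<le> E * exp (\<mu> * s)) \<longrightarrow>
         norm (Fhist (w t) y - Fhist (w t) y') \<le> E / 2"
        using bspec[OF ct w[of t]] B[OF t] t by simp
    qed
    show ?thesis
      by (rule exI[of _ M], rule exI[of _ \<mu>], intro conjI) (fact M(1) \<mu> M' inc' ct')+
  qed
  define y where "y t = lim (\<lambda>k. Y k t)" for t
  \<comment> \<open>On a bounded horizon the weight is at most exp(\<mu> T), which turns the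
    weighted increments into a uniform geometric rate. The constants depend on T, the limit
    \<open>y\<close> does not.\<close>
  have rate: "\<exists>C\<ge>0. \<forall>t\<in>{-1/c..<T}. (\<lambda>k. Y k t) \<longlonglongrightarrow> y t \<and> (\<forall>k. norm (Y k t - y t) \<le> C * (1/2) ^ k)"
    if T: "0 < T" for T
  proof -
    obtain M \<mu> where M: "0 \<le> M" "0 < \<mu>"
      and inc: "\<And>k t. t \<in> {-1/c..<T} \<Longrightarrow> norm (Y (Suc k) t - Y k t) \<le> 2 * M * (1/2) ^ k * exp (\<mu> * t)"
      using contr[OF T] by blast
    show ?thesis
    proof (intro exI[of _ "2 * (2 * M * exp (\<mu> * T))"] conjI ballI)
      show "0 \<le> 2 * (2 * M * exp (\<mu> * T))" using M by simp
      fix t assume t: "t \<in> {-1/c..<T}"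
      have "norm (Y (Suc k) t - Y k t) \<le> (2 * M * exp (\<mu> * T)) * (1/2) ^ k" for k
      proof -
        have "2 * M * (1/2) ^ k * exp (\<mu> * t) \<le> 2 * M * (1/2) ^ k * exp (\<mu> * T)"
          using M t by (intro mult_left_mono) auto
        with inc[OF t, of k] show ?thesis by (simp add: mult_ac)
      qed
      from geometric_increments_limit[of "\<lambda>k. Y k t", OF this]
      obtain l where l: "(\<lambda>k. Y k t) \<longlonglongrightarrow> l" "\<forall>k. norm (Y k t - l) \<le> 2 * (2 * M * exp (\<mu> * T)) * (1/2) ^ k"
        by blast
      moreover have "y t = l" unfolding y_def by (rule limI[OF l(1)])
      ultimately show "(\<lambda>k. Y k t) \<longlonglongrightarrow> y t" "\<forall>k. norm (Y k t - y t) \<le> 2 * (2 * M * exp (\<mu> * T)) * (1/2) ^ k"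
        by auto
    qed
  qed
  have ylim: "(\<lambda>k. Y k t) \<longlonglongrightarrow> y t" if "-1/c \<le> t" for t
    using rate[of "max 1 (t + 1)"] that by (auto simp: less_max_iff_disj)
  have yM: "norm (y t) \<le> M" if "\<And>k. norm (Y k t) \<le> M" "-1/c \<le> t" for t M
    by (rule Lim_bounded[OF tendsto_norm[OF ylim[OF that(2)]]]) (use that in auto)
  have yl: "linf_on {-1/c..<T} y" if T: "0 < T" for T
  proof -
    obtain M where M: "\<And>k t. t \<in> {-1/c..<T} \<Longrightarrow> norm (Y k t) \<le> M" using bound[OF T] by blast
    have "(\<lambda>t. indicat_real {-1/c..<T} t *\<^sub>R y t) \<in> borel_measurable lebesgue"
    proof (rule borel_measurable_LIMSEQ_metric)
      show "(\<lambda>t. indicat_real {-1/c..<T} t *\<^sub>R Y k t) \<in> borel_measurable lebesgue" for k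
        using Yl[OF T, of k] by (simp add: linf_on_def set_borel_measurable_def)
      show "(\<lambda>k. indicat_real {-1/c..<T} t *\<^sub>R Y k t) \<longlonglongrightarrow> indicat_real {-1/c..<T} t *\<^sub>R y t" for t
        using ylim[of t] by (cases "t \<in> {-1/c..<T}") (auto intro!: tendsto_intros)
    qed
    moreover have "AE t in lebesgue. t \<in> {-1/c..<T} \<longrightarrow> norm (y t) \<le> M"
      by (intro always_eventually allI impI yM M) auto
    ultimately show ?thesis unfolding linf_on_def set_borel_measurable_def by blast
  qed
  show thesis
  proof (rule that[of y])
    show "y t = h t" if "t \<in> {-1/c..<0}" for t
    proof (rule LIMSEQ_unique[OF ylim])
      show "(\<lambda>k. Y k t) \<longlonglongrightarrow> h t" using that by (simp add: Yneg)
    qed (use that in auto)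
    show "linf_on {-1/c..<T} y" if "0 < T" for T by (rule yl[OF that])
    show "\<exists>M\<ge>0. \<forall>t\<in>{-1/c..<T}. norm (y t) \<le> M" if T: "0 < T" for T
    proof -
      obtain M where "0 \<le> M" "\<And>k t. t \<in> {-1/c..<T} \<Longrightarrow> norm (Y k t) \<le> M" using bound[OF T] by blast
      then show ?thesis using yM by (intro exI[of _ M]) auto
    qed
    show "y t = Fhist (w t) (\<lambda>s. y (t + s))" if t: "0 \<le> t" for t
    proof -
      have T: "0 < t + 1" using t by simp
      obtain M \<mu> where M: "0 \<le> M" "0 < \<mu>" "\<forall>k. \<forall>s\<in>{-1/c..<t + 1}. norm (Y k s) \<le> M"
        and ct: "\<forall>t\<in>{0..<t + 1}. \<forall>y y' E. 0 \<le> E \<longrightarrow> linf_on {-1/c..<0} y \<longrightarrow> linf_on {-1/c..<0} y' \<longrightarrow>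
         (\<forall>s\<in>{-1/c..<0}. norm (y s) \<le> M \<and> norm (y' s) \<le> M \<and> norm (y s - y' s) \<le> E * exp (\<mu> * s)) \<longrightarrow>
         norm (Fhist (w t) y - Fhist (w t) y') \<le> E / 2"
        using contr[OF T] by blast
      obtain C where C: "0 \<le> C" "\<And>k s. s \<in> {-1/c..<t + 1} \<Longrightarrow> norm (Y k s - y s) \<le> C * (1/2) ^ k"
        using rate[OF T] by blast
      have mem: "t + s \<in> {-1/c..<t + 1}" if "s \<in> {-1/c..<0}" for s using that t by auto
      \<comment> \<open>On the past exp(\<mu> s) is at least exp(-\<mu>/c), so multiplying the
        uniform rate by exp(\<mu>/c) makes it a weighted one. The contraction then acts as
        continuity of F along the iterates and yields the equation for the limit.\<close>
      have est: "norm (Y (Suc k) t - Fhist (w t) (\<lambda>s. y (t + s))) \<le> C * exp (\<mu> / c) * (1/2) ^ k / 2" for k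
      proof -
        have "norm (Fhist (w t) (\<lambda>s. Y k (t + s)) - Fhist (w t) (\<lambda>s. y (t + s))) \<le> (C * exp (\<mu> / c) * (1/2) ^ k) / 2"
        proof (rule ct[rule_format])
          show "linf_on {-1/c..<0} (\<lambda>s. Y k (t + s))" by (rule Yh[OF t])
          show "linf_on {-1/c..<0} (\<lambda>s. y (t + s))"
            by (rule linf_on_history[OF yl[OF T]]) (use t in auto)
          fix s assume s: "s \<in> {-1/c..<0}"
          have "norm (Y k (t + s) - y (t + s)) \<le> C * (1/2) ^ k * 1" using C(2)[OF mem[OF s]] by simp
          also have "\<dots> \<le> C * (1/2) ^ k * exp (\<mu> / c + \<mu> * s)"
          proof (intro mult_left_mono)
            have "0 \<le> \<mu> * (1 / c + s)" using s M by (intro mult_nonneg_nonneg) auto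
            then show "1 \<le> exp (\<mu> / c + \<mu> * s)" by (simp add: distrib_left)
          qed (use C in simp)
          finally have "norm (Y k (t + s) - y (t + s)) \<le> C * exp (\<mu> / c) * (1/2) ^ k * exp (\<mu> * s)"
            by (simp add: exp_add mult_ac)
          moreover have "norm (Y k (t + s)) \<le> M" using M(3) mem[OF s] by blast
          moreover have "norm (y (t + s)) \<le> M" by (rule yM) (use M(3) mem[OF s] in auto)
          ultimately show "norm (Y k (t + s)) \<le> M \<and> norm (y (t + s)) \<le> M \<and>
              norm (Y k (t + s) - y (t + s)) \<le> C * exp (\<mu> / c) * (1/2) ^ k * exp (\<mu> * s)" by blast
        qed (use t C in auto)
        then show ?thesis using t by (simp add: YS)
      qed
      have "(\<lambda>k. Y (Suc k) t - Fhist (w t) (\<lambda>s. y (t + s))) \<longlonglongrightarrow> 0"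
      proof (rule tendsto_0_le[where K = 1])
        show "(\<lambda>k. C * exp (\<mu> / c) * (1/2) ^ k / 2) \<longlonglongrightarrow> 0"
          by (intro tendsto_divide_zero tendsto_mult_right_zero LIMSEQ_realpow_zero) auto
        show "eventually (\<lambda>k. norm (Y (Suc k) t - Fhist (w t) (\<lambda>s. y (t + s)))
            \<le> norm (C * exp (\<mu> / c) * (1/2) ^ k / 2) * 1) sequentially"
          using est by (intro always_eventually allI) (auto intro: order_trans[OF _ abs_ge_self])
      qed
      then have "(\<lambda>k. Y (Suc k) t) \<longlonglongrightarrow> Fhist (w t) (\<lambda>s. y (t + s))" by (simp add: LIM_zero_iff)
      moreover have "-1/c \<le> t" by (rule order_trans[of _ 0]) (use t c_pos in auto)
      then have "(\<lambda>k. Y (Suc k) t) \<longlonglongrightarrow> y t" by (intro LIMSEQ_Suc ylim)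
      ultimately show ?thesis using LIMSEQ_unique by blast
    qed
  qed
qed

end

subsection \<open>Correspondence with the PDE system\<close>

context delay_system
begin

text \<open>The initial profile, read as boundary values that entered before time \<open>0\<close> while
  \<open>p\<close> vanished; the exponential compensates the damping accumulated on the way.\<close>

definition init_history :: "(real \<Rightarrow> real) \<Rightarrow> real \<Rightarrow> (real^'n) \<times> real" where
  "init_history x0 s = (0, x0 (-c * s) * exp (- integral {0..-s} (\<lambda>q. a 0 (c * q))))"

definition extend_history ::
    "(real \<Rightarrow> real) \<Rightarrow> (real \<Rightarrow> real^'n) \<Rightarrow> (real \<Rightarrow> real) \<Rightarrow> real \<Rightarrow> (real^'n) \<times> real" where
  "extend_history x0 p v t = (if t < 0 then init_history x0 t else (p t, v t))"

section \<open>Bounds and measurability of the encoded initial profile\<close>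

lemma a_zero_integrable: "l \<le> 1/c \<Longrightarrow> (\<lambda>q. a 0 (c * q)) integrable_on {0..l}"
  and a_zero_integral_bound: "0 \<le> l \<Longrightarrow> l \<le> 1/c \<Longrightarrow> \<bar>integral {0..l} (\<lambda>q. a 0 (c * q))\<bar> \<le> abound 0 / c"
proof -
  have cq: "c * q \<in> {0..1}" if "q \<in> {0..l}" "l \<le> 1/c" for q l
  proof -
    have "q \<le> 1/c" using that by auto
    then have "c * q \<le> 1" using c_pos by (simp add: pos_le_divide_eq mult.commute)
    with that c_pos show ?thesis by auto
  qed
  show "(\<lambda>q. a 0 (c * q)) integrable_on {0..l}" if "l \<le> 1/c" for l
  proof (rule integrable_continuous_real)
    show "continuous_on {0..l} (\<lambda>q. a 0 (c * q))"
      by (rule continuous_on_compose2[OF a_cont[unfolded case_prod_unfold], of "{0..l}" "\<lambda>q. (0, c * q)",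
            unfolded fst_conv snd_conv])
        (use cq that in \<open>auto intro!: continuous_intros simp del: atLeastAtMost_iff\<close>)
  qed
  show "\<bar>integral {0..l} (\<lambda>q. a 0 (c * q))\<bar> \<le> abound 0 / c" if "0 \<le> l" "l \<le> 1/c" for l
  proof -
    have "\<bar>integral {0..l} (\<lambda>q. a 0 (c * q))\<bar> \<le> abound 0 * (l - 0)"
      using that abound_nonneg[of 0]
      by (intro abs_integral_le_const_AE always_eventually allI impI abs_a_le cq) auto
    also have "\<dots> \<le> abound 0 * (1/c)"
      using that abound_nonneg[of 0] by (intro mult_left_mono) auto
    finally show ?thesis by simp
  qed
qed

lemma past_position: "s \<in> {-1/c..<0} \<Longrightarrow> -c * s \<in> {0..1}"
  using mult_pos_neg[OF c_pos, of s] c_pos by (auto simp: field_simps)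

lemma norm_init_history_le:
  assumes "s \<in> {-1/c..<0}"
  shows "norm (init_history x0 s) \<le> exp (abound 0 / c) * \<bar>x0 (-c * s)\<bar>"
proof -
  have "-s \<le> 1/c" "0 \<le> -s" using assms by auto
  from a_zero_integral_bound[OF this(2,1)]
  have "exp (- integral {0..-s} (\<lambda>q. a 0 (c * q))) \<le> exp (abound 0 / c)" by auto
  then show ?thesis
    by (simp add: init_history_def norm_Pair abs_mult mult.commute[of "\<bar>x0 _\<bar>"] mult_right_mono)
qed

lemma init_history_AE_bound:
  assumes "AE z in lebesgue. z \<in> {0..1} \<longrightarrow> \<bar>x0 z\<bar> \<le> r"
  shows "AE s in lebesgue. s \<in> {-1/c..<0} \<longrightarrow> norm (init_history x0 s) \<le> exp (abound 0 / c) * r"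
proof -
  have "-c \<noteq> 0" using c_pos by simp
  from AE_lebesgue_affine[OF this assms, of 0] show ?thesis
  proof eventually_elim
    case (elim s)
    show ?case
    proof
      assume s: "s \<in> {-1/c..<0}"
      then have "-c * s \<in> {0..1}" by (rule past_position)
      with elim have "exp (abound 0 / c) * \<bar>x0 (-c * s)\<bar> \<le> exp (abound 0 / c) * r" by simp
      with norm_init_history_le[OF s, of x0] show "norm (init_history x0 s) \<le> exp (abound 0 / c) * r"
        by linarith
    qed
  qed
qed

lemma init_history_cong_AE:
  assumes "AE z in lebesgue. z \<in> {0..1} \<longrightarrow> x0 z = x1 z"
  shows "AE s in lebesgue. s \<in> {-1/c..<0} \<longrightarrow> init_history x0 s = init_history x1 s"
proof -
  have "-c \<noteq> 0" using c_pos by simp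
  from AE_lebesgue_affine[OF this assms, of 0] show ?thesis
    by eventually_elim (use past_position in \<open>simp add: init_history_def\<close>)
qed

lemma linf_on_init_history:
  assumes "linf_on {0..1} x0"
  shows "linf_on {-1/c..<0} (init_history x0)"
proof -
  let ?S = "{-1/c..<0}" let ?e = "\<lambda>s. exp (- integral {0..-s} (\<lambda>q. a 0 (c * q)))"
  have "-c \<noteq> 0" using c_pos by simp
  have sub: "?S \<subseteq> {s. -c * s + 0 \<in> {0..1}}" using past_position by auto
  have x0: "linf_on ?S (\<lambda>s. x0 (-c * s))"
    using linf_on_subset[OF linf_on_affine[OF \<open>-c \<noteq> 0\<close> assms, of 0] sub] by simp
  have "continuous_on {0..1/c} (\<lambda>l. integral {0..l} (\<lambda>q. a 0 (c * q)))"
    by (rule indefinite_integral_continuous_1) (rule a_zero_integrable, simp)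
  then have "continuous_on ?S ?e"
    by (intro continuous_intros continuous_on_compose2[of "{0..1/c}" _ ?S "\<lambda>s. -s"]) auto
  then have "(\<lambda>s. indicat_real ?S s *\<^sub>R ?e s) \<in> borel_measurable borel"
    by (rule borel_measurable_continuous_on_indicator[rotated]) simp
  then have "(\<lambda>s. indicat_real ?S s *\<^sub>R ?e s) \<in> borel_measurable lebesgue"
    by (intro measurable_completion) simp
  moreover have "(\<lambda>s. indicat_real ?S s *\<^sub>R x0 (-c * s)) \<in> borel_measurable lebesgue"
    using x0 by (simp add: linf_on_def set_borel_measurable_def)
  ultimately have "(\<lambda>s. (indicat_real ?S s *\<^sub>R x0 (-c * s)) * (indicat_real ?S s *\<^sub>R ?e s)) \<in> borel_measurable lebesgue"
    by (rule borel_measurable_times[rotated])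
  then have "set_borel_measurable lebesgue ?S (\<lambda>s. x0 (-c * s) * ?e s)"
    unfolding set_borel_measurable_def
    by (rule measurable_cong[THEN iffD1, rotated]) (auto simp: indicator_def)
  moreover obtain B where "0 \<le> B" and B: "AE z in lebesgue. z \<in> {0..1} \<longrightarrow> norm (x0 z) \<le> B"
    by (rule linf_on_AE_bound[OF assms])
  have "AE s in lebesgue. s \<in> ?S \<longrightarrow> norm (x0 (-c * s) * ?e s) \<le> exp (abound 0 / c) * B"
    using init_history_AE_bound[OF B[unfolded real_norm_def]]
    by eventually_elim (auto simp: init_history_def norm_Pair)
  ultimately have v: "linf_on ?S (\<lambda>s. x0 (-c * s) * ?e s)"
    unfolding linf_on_def by blast
  have "linf_on ?S (\<lambda>_. 0 :: real^'n)"
    by (rule linf_on_measurable_bounded[where B = 0]) auto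
  with v have "linf_on ?S (\<lambda>s. (0 :: real^'n, x0 (-c * s) * ?e s))"
    by (simp add: linf_on_Pair_iff)
  then show ?thesis by (simp add: init_history_def[abs_def])
qed

lemma linf_on_extend_history:
  assumes x0: "linf_on {0..1} x0" and pv: "linf_on {0..T} (\<lambda>t. (p t, v t))" and T: "0 < T"
  shows "linf_on {-1/c..<T} (extend_history x0 p v)"
proof -
  have "linf_on {-1/c..<0} (extend_history x0 p v)"
    by (rule linf_on_cong_AE[OF linf_on_init_history[OF x0]]) (simp add: extend_history_def)
  moreover have "linf_on {0..<T} (\<lambda>t. (p t, v t))"
    by (rule linf_on_subset[OF pv]) auto
  then have "linf_on {0..<T} (extend_history x0 p v)"
    by (rule linf_on_cong_AE) (simp add: extend_history_def)
  ultimately have "linf_on ({-1/c..<0} \<union> {0..<T}) (extend_history x0 p v)" by (rule linf_on_Un) auto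
  moreover have "{-1/c..<0} \<union> {0..<T} = {-1/c..<T}"
    by (rule ivl_disj_un_two(3)) (use T c_pos in auto)
  ultimately show ?thesis by simp
qed

section \<open>The solution formula along characteristics in history form\<close>

definition char_formula where
  "char_formula x0 p v t z =
     integral {max 0 (t - z/c)..t}
              (\<lambda>\<tau>. exp (integral {\<tau>..t} (\<lambda>s. a (p s) (z + c * (s - t))))
                     * (\<Sum>i\<in>UNIV. g i (z + c * (\<tau> - t)) * (p \<tau>) $ i))
            + exp (integral {max 0 (t - z/c)..t} (\<lambda>s. a (p s) (z + c * (s - t))))
              * (if z \<le> c * t then v (t - z/c) else x0 (z - c * t))"

text \<open>Shifting time by t turns the integrals into those of \<open>Xmap\<close>. If the
  characteristic entered through the boundary at a nonnegative time, the two formulas coincide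
  directly. If it started in the initial profile, \<open>Xmap\<close> follows it further back to the
  boundary: there p vanishes, so the source adds nothing, and the additional exponential cancels the
  one in \<open>init_history\<close>.\<close>

lemma char_formula_eq_Xhist:
  assumes t: "0 \<le> t" and z: "z \<in> {0<..1}"
    and lin: "linf_on {-1/c..<0} (\<lambda>s. extend_history x0 p v (t + s))"
  shows "char_formula x0 p v t z = Xhist (\<lambda>s. extend_history x0 p v (t + s)) z"
proof -
  define p' where "p' s = fst (extend_history x0 p v (t + s))" for s
  define v' where "v' s = snd (extend_history x0 p v (t + s))" for s
  define m where "m = max 0 (t - z/c)"
  define k where "k s = exp (integral {s..0} (\<lambda>q. a (p' q) (z + c * q)))
      * (\<Sum>i\<in>UNIV. g i (z + c * s) * (p' s) $ i)" for s
  have z01: "z \<in> {0..1}" using z by auto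
  have p'_pos: "p' s = p (s + t)" if "0 \<le> s + t" for s
    using that by (simp add: p'_def extend_history_def add.commute)
  have p'_neg: "p' s = 0" if "s + t < 0" for s
    using that by (simp add: p'_def extend_history_def init_history_def add.commute)
  have m0: "0 \<le> m" by (simp add: m_def)
  have inner: "integral {\<tau>..t} (\<lambda>s. a (p s) (z + c * (s - t)))
      = integral {\<tau> - t..0} (\<lambda>q. a (p' q) (z + c * q))" if "m \<le> \<tau>" for \<tau>
  proof -
    have "integral {\<tau>..t} (\<lambda>s. a (p s) (z + c * (s - t)))
        = integral {\<tau> - t..t - t} (\<lambda>q. a (p (q + t)) (z + c * (q + t - t)))"
      by (rule integral_shift_real_ivl[symmetric])
    also have "\<dots> = integral {\<tau> - t..0} (\<lambda>q. a (p' q) (z + c * q))"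
      using that m0 by (auto intro!: integral_cong simp: p'_pos)
    finally show ?thesis .
  qed
  have "integral {m..t} (\<lambda>\<tau>. exp (integral {\<tau>..t} (\<lambda>s. a (p s) (z + c * (s - t))))
           * (\<Sum>i\<in>UNIV. g i (z + c * (\<tau> - t)) * (p \<tau>) $ i))
      = integral {m - t..t - t} (\<lambda>s. exp (integral {s + t..t} (\<lambda>s. a (p s) (z + c * (s - t))))
           * (\<Sum>i\<in>UNIV. g i (z + c * (s + t - t)) * (p (s + t)) $ i))"
    by (rule integral_shift_real_ivl[symmetric])
  also have "\<dots> = integral {m - t..0} k"
    using m0 by (auto intro!: integral_cong simp: k_def inner p'_pos)
  finally have outer: "integral {m..t} (\<lambda>\<tau>. exp (integral {\<tau>..t} (\<lambda>s. a (p s) (z + c * (s - t))))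
           * (\<Sum>i\<in>UNIV. g i (z + c * (\<tau> - t)) * (p \<tau>) $ i)) = integral {m - t..0} k" .
  have X: "Xhist (\<lambda>s. extend_history x0 p v (t + s)) z
      = exp (integral {-z/c..0} (\<lambda>q. a (p' q) (z + c * q))) * v' (-z/c) + integral {-z/c..0} k"
    by (simp add: Xhist_def Xmap_def k_def[abs_def] p'_def[abs_def] v'_def)
  show ?thesis
  proof (cases "z \<le> c * t")
    case True
    then have "z/c \<le> t" using c_pos by (simp add: field_simps)
    then have m: "m = t - z/c" "m - t = -z/c" and v': "v' (-z/c) = v (t - z/c)"
      by (auto simp: m_def v'_def extend_history_def)
    show ?thesis
      unfolding char_formula_def m_def[symmetric] outer X inner[OF order_refl] m(2) v' using True by simp
  next
    case False
    then have zt: "t < z/c" using c_pos by (simp add: field_simps)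
    then have m: "m = 0" by (simp add: m_def)
    have k0: "k s = 0" if "s + t < 0" for s by (simp add: k_def p'_neg[OF that])
    have "integral {-z/c..0} k = integral {-z/c..0} (\<lambda>s. if s \<in> {-t..0} then k s else 0)"
      by (rule integral_cong) (auto simp: k0)
    also have "\<dots> = integral ({-t..0} \<inter> {-z/c..0}) k" by (rule integral_restrict_Int)
    also have "{-t..0} \<inter> {-z/c..0} = {-t..0}" using zt by auto
    finally have I: "integral {m - t..0} k = integral {-z/c..0} k" by (simp add: m)
    have p'lin: "linf_on {-1/c..<0} p'"
      using lin linf_on_Pair_iff[of "{-1/c..<0}" p' v'] by (simp add: p'_def[abs_def] v'_def[abs_def])
    have "integral {-z/c..-t} (\<lambda>q. a (p' q) (z + c * q)) + integral {-t..0} (\<lambda>q. a (p' q) (z + c * q))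
        = integral {-z/c..0} (\<lambda>q. a (p' q) (z + c * q))"
      by (rule Henstock_Kurzweil_Integration.integral_combine)
        (use zt t a_char_integrable_on(1)[OF p'lin z01] in auto)
    \<comment> \<open>Before time 0 the growth rate is \<open>a 0\<close> along the characteristic
      prolonged back to z = 0, and the substitution q + z/c measures the time since that fictitious
      entry. At the endpoint q = -t the true p takes over, but this is a single point.\<close>
    moreover have Ineg: "integral {-z/c..-t} (\<lambda>q. a (p' q) (z + c * q)) = integral {0..z/c - t} (\<lambda>q. a 0 (c * q))"
    proof -
      have "integral {-z/c..-t} (\<lambda>q. a (p' q) (z + c * q)) = integral {-z/c..-t} (\<lambda>q. a 0 (c * (q + z/c)))"
      proof (rule integral_cong_AE_Icc(1))
        show "AE q in lebesgue. q \<in> {-z/c..-t} \<longrightarrow> a (p' q) (z + c * q) = a 0 (c * (q + z/c))"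
          using AE_lebesgue_neq[of "-t"]
          by eventually_elim (use c_pos in \<open>auto simp: p'_neg algebra_simps\<close>)
      qed
      also have "\<dots> = integral {0..z/c - t} (\<lambda>q. a 0 (c * q))"
        using integral_shift_real_ivl[of 0 "z/c" "z/c - t" "\<lambda>q. a 0 (c * q)"] by simp
      finally show ?thesis .
    qed
    moreover have "v' (-z/c) = x0 (z - c * t) * exp (- integral {0..z/c - t} (\<lambda>q. a 0 (c * q)))"
    proof -
      have "t + -z/c < 0" "-c * (t + -z/c) = z - c * t" "-(t + -z/c) = z/c - t"
        using zt c_pos by (auto simp: algebra_simps)
      then show ?thesis by (simp only: v'_def extend_history_def init_history_def if_True snd_conv)
    qed
    moreover have "exp I * (x * exp (- I0)) = exp It * x" if "I0 + It = I" for I I0 It x :: real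
      by (simp add: exp_add exp_minus field_simps flip: that)
    ultimately have "exp (integral {-z/c..0} (\<lambda>q. a (p' q) (z + c * q))) * v' (-z/c)
        = exp (integral {-t..0} (\<lambda>q. a (p' q) (z + c * q))) * x0 (z - c * t)"
      by (simp only: Ineg)
    then show ?thesis
      unfolding char_formula_def m_def[symmetric] outer X inner[OF order_refl] I using False by (simp add: m)
  qed
qed

section \<open>Passage between solutions and histories\<close>

lemma is_global_sol_iff:
  "is_global_sol c a g K G x0 d u x \<longleftrightarrow>
     (\<forall>t\<ge>0. linf_on {0..1} (x t)) \<and>
     (\<forall>T\<ge>0. \<exists>B. \<forall>t\<in>{0..T}. esup {0..1} (\<lambda>z. \<bar>x t z\<bar>) \<le> B) \<and>
     (\<forall>T\<ge>0. linf_on {0..T} (\<lambda>t. Out (d t, u t) (x t))) \<and>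
     (\<forall>t\<ge>0. AE z in lebesgue. z \<in> {0..1} \<longrightarrow>
        x t z = char_formula x0 (\<lambda>t. fst (Out (d t, u t) (x t))) (\<lambda>t. snd (Out (d t, u t) (x t))) t z)"
  by (simp only: is_global_sol_def Let_def Out_def char_formula_def fst_conv snd_conv)

text \<open>\<open>history_solution\<close> asks for pointwise bounds, so x0 is replaced by a
  bounded representative and u by 0 on a null set of times, which is allowed because 0 belongs to U.
  Under the true data the outputs agree with \<open>y\<close> only almost everywhere; this suffices
  because \<open>Xhist\<close> depends on the past only modulo null sets.\<close>

lemma solution_exists:
  assumes x0: "linf_on {0..1} x0" and adm: "adm_inputs D U d u"
  shows "\<exists>x. is_global_sol c a g K G x0 d u x"
proof -
  have d: "linf_on {0..} d" "\<And>t. 0 \<le> t \<Longrightarrow> d t \<in> D"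
    and u: "\<And>T. 0 \<le> T \<Longrightarrow> linf_on {0..T} u" "\<And>t. 0 \<le> t \<Longrightarrow> u t \<in> U"
    using adm by (auto simp: adm_inputs_def)
  obtain x1 R where x1: "x1 \<in> borel_measurable lebesgue" "\<And>z. norm (x1 z) \<le> R" "0 \<le> R"
    and x01: "AE z in lebesgue. z \<in> {0..1} \<longrightarrow> x0 z = x1 z"
    by (rule linf_on_bounded_version[OF x0]) (rule that)
  have x1l: "linf_on {0..1} x1" by (rule linf_on_measurable_bounded[OF x1(1)]) (use x1(2) in auto)
  have "\<forall>n::nat. \<exists>B. AE t in lebesgue. t \<in> {0..real n} \<longrightarrow> norm (u t) \<le> B"
    using u(1) by (auto simp: linf_on_def)
  then obtain B where B: "\<And>n::nat. AE t in lebesgue. t \<in> {0..real n} \<longrightarrow> norm (u t) \<le> B n" by metis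
  \<comment> \<open>One null set of times serves all the intervals [0, n] simultaneously, so that
    \<open>u'\<close> is bounded by \<open>max 0 (B n)\<close> at every point of each of
    them.\<close>
  define good where "good t \<longleftrightarrow> (\<forall>n::nat. t \<in> {0..real n} \<longrightarrow> norm (u t) \<le> B n)" for t
  have good: "AE t in lebesgue. good t"
    unfolding good_def by (subst AE_all_countable) (use B in blast)
  define u' where "u' t = (if good t then u t else 0)" for t
  define w where "w t = (d t, u' t)" for t
  have wDU: "w t \<in> D \<times> U" if "0 \<le> t" for t
    using d(2) u(2) that U_zero by (auto simp: w_def u'_def)
  have wl: "linf_on {0..<\<delta>} w" if "0 < \<delta>" for \<delta>
  proof -
    have "linf_on {0..<\<delta>} u" by (rule linf_on_subset[OF u(1)[of \<delta>]]) (use that in auto)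
    then have "linf_on {0..<\<delta>} u'"
      by (rule linf_on_cong_AE) (use good in eventually_elim, auto simp: u'_def)
    moreover have "linf_on {0..<\<delta>} d" by (rule linf_on_subset[OF d(1)]) auto
    ultimately show ?thesis unfolding w_def by (simp add: linf_on_Pair_iff)
  qed
  have wb: "\<exists>B. \<forall>t\<in>{0..<T}. norm (w t) \<le> B" for T
  proof -
    obtain Bd where Bd: "\<And>y. y \<in> D \<Longrightarrow> norm y \<le> Bd"
      using compact_imp_bounded[OF D_compact] by (auto simp: bounded_iff)
    have "norm (w t) \<le> Bd + max 0 (B (nat \<lceil>T\<rceil>))" if t: "t \<in> {0..<T}" for t
    proof -
      have "t \<le> T" "0 \<le> t" using t by auto
      then have "t \<in> {0..real (nat \<lceil>T\<rceil>)}" by (metis atLeastAtMost_iff order_trans real_nat_ceiling_ge)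
      then have "norm (u' t) \<le> max 0 (B (nat \<lceil>T\<rceil>))"
        unfolding u'_def good_def by (auto simp: le_max_iff_disj)
      moreover have "norm (d t) \<le> Bd" using Bd d(2) t by auto
      ultimately show ?thesis unfolding w_def by (intro order_trans[OF norm_Pair_le add_mono])
    qed
    then show ?thesis by blast
  qed
  have hb: "norm (init_history x1 s) \<le> exp (abound 0 / c) * R" if "s \<in> {-1/c..<0}" for s
    by (rule order_trans[OF norm_init_history_le[OF that]]) (use x1(2)[of "-c * s"] in simp)
  obtain y where yh: "\<And>t. t \<in> {-1/c..<0} \<Longrightarrow> y t = init_history x1 t"
    and yl: "\<And>T. 0 < T \<Longrightarrow> linf_on {-1/c..<T} y"
    and yb: "\<And>T. 0 < T \<Longrightarrow> \<exists>M\<ge>0. \<forall>t\<in>{-1/c..<T}. norm (y t) \<le> M"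
    and yF: "\<And>t. 0 \<le> t \<Longrightarrow> y t = Fhist (w t) (\<lambda>s. y (t + s))"
    using history_solution[OF linf_on_init_history[OF x1l] hb wDU wl wb] by blast
  define x where "x t = Xhist (\<lambda>s. y (t + s))" for t
  define p where "p t = fst (Out (d t, u t) (x t))" for t
  define v where "v t = snd (Out (d t, u t) (x t))" for t
  let ?y = "extend_history x0 p v"
  have ylh: "linf_on {-1/c..<0} (\<lambda>s. y (t + s))" if "0 \<le> t" for t
    by (rule linf_on_history[OF yl[of "t + 1"]]) (use that in auto)
  have Oy: "AE t in lebesgue. 0 \<le> t \<longrightarrow> y t = Out (d t, u t) (x t)"
    using good by eventually_elim (auto simp: yF Fhist_eq x_def w_def u'_def)
  have yy: "AE t in lebesgue. -1/c \<le> t \<longrightarrow> y t = ?y t"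
    using Oy init_history_cong_AE[OF x01]
    by eventually_elim (auto simp: extend_history_def p_def v_def yh)
  have yyh: "AE s in lebesgue. s \<in> {-1/c..<0} \<longrightarrow> y (t + s) = ?y (t + s)" if "0 \<le> t" for t
    using AE_lebesgue_translate[OF yy, of t] by eventually_elim (use that in auto)
  have "is_global_sol c a g K G x0 d u x"
    unfolding is_global_sol_iff p_def[symmetric] v_def[symmetric]
  proof (intro conjI allI impI)
    fix t :: real assume t: "0 \<le> t"
    show "linf_on {0..1} (x t)" unfolding x_def by (rule linf_on_Xhist[OF ylh[OF t]])
    have "AE z in lebesgue. z \<in> {0..1} \<longrightarrow> Xhist (\<lambda>s. y (t + s)) z = Xhist (\<lambda>s. ?y (t + s)) z"
      by (rule Xhist_cong_AE[OF yyh[OF t]])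
    then show "AE z in lebesgue. z \<in> {0..1} \<longrightarrow> x t z = char_formula x0 p v t z"
      using AE_lebesgue_neq[of 0]
    proof eventually_elim
      case (elim z)
      have "linf_on {-1/c..<0} (\<lambda>s. ?y (t + s))" by (rule linf_on_cong_AE[OF ylh[OF t] yyh[OF t]])
      with elim show ?case
        using char_formula_eq_Xhist[OF t, of z x0 p v] by (auto simp: x_def)
    qed
  next
    fix T :: real assume T: "0 \<le> T"
    obtain M where M: "0 \<le> M" "\<And>t. t \<in> {-1/c..<T + 1} \<Longrightarrow> norm (y t) \<le> M"
      using yb[of "T + 1"] T by auto
    show "\<exists>B. \<forall>t\<in>{0..T}. esup {0..1} (\<lambda>z. \<bar>x t z\<bar>) \<le> B"
    proof (intro exI[of _ "Xbound M"] ballI esup_le Xbound_nonneg[OF M(1)])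
      fix t assume t: "t \<in> {0..T}"
      show "AE z in lebesgue. z \<in> {0..1} \<longrightarrow> \<bar>x t z\<bar> \<le> Xbound M"
        unfolding x_def
        by (rule Xhist_bound_AE[OF _ M(1)]) (intro always_eventually allI impI M(2), use t in auto)
    qed
    have "-1/c \<le> 0" using c_pos by simp
    then have "{0..T} \<subseteq> {-1/c..<T + 1}"
      by (intro subsetI, simp only: atLeastAtMost_iff atLeastLessThan_iff) linarith
    from linf_on_subset[OF yl[of "T + 1"] this] T have "linf_on {0..T} y" by simp
    then show "linf_on {0..T} (\<lambda>t. Out (d t, u t) (x t))"
      by (rule linf_on_cong_AE) (use Oy in eventually_elim, auto)
  qed
  then show ?thesis by (rule exI[of _ x])
qed

text \<open>The converse passage, which makes the stability estimates apply to an arbitrary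
  solution. Its outputs, preceded by the encoded initial profile, serve as \<open>y\<close>; the
  equation holds at every t \<ge> 0 because outputs are insensitive to changes of the profile on
  null sets.\<close>

lemma solution_history:
  assumes x0: "linf_on {0..1} x0" and adm: "adm_inputs D U d u"
    and sol: "is_global_sol c a g K G x0 d u x"
  obtains y where "\<And>s. s < 0 \<Longrightarrow> y s = init_history x0 s" "\<And>T. 0 < T \<Longrightarrow> linf_on {-1/c..<T} y"
    "\<And>t. 0 \<le> t \<Longrightarrow> y t = Fhist (d t, u t) (\<lambda>s. y (t + s))"
    "\<And>t. 0 \<le> t \<Longrightarrow> AE z in lebesgue. z \<in> {0..1} \<longrightarrow> x t z = Xhist (\<lambda>s. y (t + s)) z"
proof -
  define p where "p t = fst (Out (d t, u t) (x t))" for t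
  define v where "v t = snd (Out (d t, u t) (x t))" for t
  define y where "y = extend_history x0 p v"
  have xl: "\<And>t. 0 \<le> t \<Longrightarrow> linf_on {0..1} (x t)"
    and pv: "\<And>T. 0 \<le> T \<Longrightarrow> linf_on {0..T} (\<lambda>t. (p t, v t))"
    and xf: "\<And>t. 0 \<le> t \<Longrightarrow> AE z in lebesgue. z \<in> {0..1} \<longrightarrow> x t z = char_formula x0 p v t z"
    using sol unfolding is_global_sol_iff p_def v_def by auto
  have yl: "linf_on {-1/c..<T} y" if "0 < T" for T
    unfolding y_def by (rule linf_on_extend_history[OF x0 pv]) (use that in auto)
  have ylh: "linf_on {-1/c..<0} (\<lambda>s. y (t + s))" if "0 \<le> t" for t
    by (rule linf_on_history[OF yl[of "t + 1"]]) (use that in auto)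
  have X: "AE z in lebesgue. z \<in> {0..1} \<longrightarrow> x t z = Xhist (\<lambda>s. y (t + s)) z" if t: "0 \<le> t" for t
    using xf[OF t] AE_lebesgue_neq[of 0]
  proof eventually_elim
    case (elim z)
    with char_formula_eq_Xhist[OF t, of z x0 p v] ylh[OF t] show ?case by (auto simp: y_def)
  qed
  show thesis
  proof (rule that[of y])
    show "y s = init_history x0 s" if "s < 0" for s using that by (simp add: y_def extend_history_def)
    show "y t = Fhist (d t, u t) (\<lambda>s. y (t + s))" if t: "0 \<le> t" for t
    proof -
      have "Out (d t, u t) (x t) = Out (d t, u t) (Xhist (\<lambda>s. y (t + s)))"
        by (rule Out_cong_AE[OF _ xl[OF t] linf_on_Xhist[OF ylh[OF t]] X[OF t]])
          (use adm t in \<open>auto simp: adm_inputs_def\<close>)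
      then show ?thesis using t by (simp add: y_def extend_history_def p_def v_def Fhist_eq)
    qed
  qed (use yl X in auto)
qed

end

subsection \<open>Input-to-state stability\<close>

lemma AE_notin_Icc_imp_nonpos:
  assumes "AE s in lebesgue. s \<notin> {0..t::real}"
  shows "t \<le> 0"
proof -
  have "negligible {0..t}"
    using assms unfolding negligible_iff_null_sets by (subst completion.null_sets_iff_AE) auto
  then show ?thesis
    using negligible_interval(1)[of 0 t] by (auto simp: box_eq_empty)
qed

context delay_system
begin

section \<open>Sublevel radii and the gain\<close>

definition radius :: "real \<Rightarrow> real" where
  "radius s = Sup (norm ` {y. V y \<le> s})"

text \<open>Converts a bound on the Lyapunov function over the past into a bound on the
  profile.\<close>

definition gain :: "real \<Rightarrow> real" where
  "gain s = Xbound (radius s)"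

lemma norm_le_radius: "V y \<le> s \<Longrightarrow> norm y \<le> radius s"
proof -
  assume y: "V y \<le> s"
  obtain M where "\<And>y. V y \<le> s \<Longrightarrow> norm y \<le> M"
    using radially_unbounded_sublevel_bounded[OF V_radunb, of s] by blast
  then have "bdd_above (norm ` {y. V y \<le> s})" by (auto intro!: bdd_aboveI)
  with y show ?thesis unfolding radius_def by (intro cSup_upper) auto
qed

lemma radius_le:
  assumes "0 \<le> s" "\<And>y. V y \<le> s \<Longrightarrow> norm y \<le> r"
  shows "radius s \<le> r"
proof -
  have "0 \<in> {y. V y \<le> s}" using assms(1) V_zero by simp
  then show ?thesis unfolding radius_def using assms(2) by (intro cSup_least) blast+
qed

lemma radius_nonneg: "0 \<le> s \<Longrightarrow> 0 \<le> radius s"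
  using norm_le_radius[of 0 s] V_zero by simp

lemma radius_mono: "0 \<le> s \<Longrightarrow> s \<le> s' \<Longrightarrow> radius s \<le> radius s'"
  by (rule radius_le) (auto intro: norm_le_radius)

lemma gain_nonneg: "0 \<le> s \<Longrightarrow> 0 \<le> gain s"
  unfolding gain_def by (intro Xbound_nonneg radius_nonneg)

lemma gain_mono: "0 \<le> s \<Longrightarrow> s \<le> s' \<Longrightarrow> gain s \<le> gain s'"
  unfolding gain_def by (intro Xbound_mono radius_nonneg radius_mono)

text \<open>A sum is at most twice its larger summand. This weak triangle inequality separates the
  contributions of the initial data and of the input and is the origin of the factors 2
  below.\<close>

lemma gain_add_le:
  assumes "0 \<le> s" "0 \<le> s'"
  shows "gain (s + s') \<le> gain (2 * s) + gain (2 * s')"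
proof (cases "s \<le> s'")
  case True
  then have "gain (s + s') \<le> gain (2 * s')" using assms by (intro gain_mono) auto
  with gain_nonneg[of "2 * s"] assms show ?thesis by simp
next
  case False
  then have "gain (s + s') \<le> gain (2 * s)" using assms by (intro gain_mono) auto
  with gain_nonneg[of "2 * s'"] assms show ?thesis by simp
qed

lemma gain_small:
  assumes "0 < e"
  shows "\<exists>\<eta>>0. gain (2 * \<eta>) \<le> e"
proof -
  obtain r where r: "0 < r" "Xbound r \<le> e" using Xbound_small[OF assms] by blast
  have "\<And>y. y \<noteq> 0 \<Longrightarrow> 0 < V y" using V_pos by blast
  then obtain \<eta> where \<eta>: "0 < \<eta>" "\<And>y. V y \<le> \<eta> \<Longrightarrow> norm y \<le> r"
    using posdef_small_sublevel[OF V_cont _ V_radunb r(1)] by blast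
  then have "radius \<eta> \<le> r" by (intro radius_le) auto
  then have "gain (2 * (\<eta> / 2)) \<le> Xbound r"
    unfolding gain_def using \<eta>(1) by (intro Xbound_mono) (auto intro: radius_nonneg)
  with r \<eta>(1) show ?thesis by (intro exI[of _ "\<eta> / 2"]) auto
qed

lemma V_small_near_zero:
  assumes "0 < \<eta>"
  shows "\<exists>\<rho>>0. \<forall>y. norm y \<le> \<rho> \<longrightarrow> V y \<le> \<eta>"
proof -
  have "isCont V 0" using V_cont by (metis UNIV_I continuous_on_eq_continuous_at open_UNIV)
  then obtain d where d: "0 < d" "\<And>y. dist y 0 < d \<Longrightarrow> dist (V y) (V 0) < \<eta>"
    using assms unfolding continuous_at_eps_delta by blast
  have "V y \<le> \<eta>" if "norm y \<le> d / 2" for y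
    using d(2)[of y] d(1) that V_zero by (auto simp: dist_real_def)
  with d(1) show ?thesis by (intro exI[of _ "d / 2"]) auto
qed

text \<open>On the window \<open>[(k - 1)/c, t)\<close> the Lyapunov function has been contracted \<open>k\<close> times.\<close>

lemma V_decay:
  assumes yl: "linf_on {-1/c..<t} y" and t: "0 < t"
    and w: "\<And>s. 0 \<le> s \<Longrightarrow> w s \<in> D \<times> U"
    and yF: "\<And>s. 0 \<le> s \<Longrightarrow> y s = Fhist (w s) (\<lambda>r. y (s + r))"
    and M0: "0 \<le> M0" "AE s in lebesgue. s \<in> {-1/c..<0} \<longrightarrow> V (y s) \<le> M0"
    and \<Gamma>: "0 \<le> \<Gamma>" "AE s in lebesgue. s \<in> {0..t} \<longrightarrow> \<gamma> (norm (snd (w s))) \<le> \<Gamma>"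
  shows "AE s in lebesgue. s \<in> {(real k - 1)/c..<t} \<longrightarrow> V (y s) \<le> lam ^ k * M0 + \<Gamma> / (1 - lam)"
proof -
  define S where "S k = lam ^ k * M0 + \<Gamma> / (1 - lam)" for k
  have S0: "0 \<le> S k" for k using lam M0 \<Gamma> by (simp add: S_def)
  \<comment> \<open>Once s \<ge> \<tau> + 1/c, the whole history of s lies in the window from \<tau>
    to t on which the bound B holds, so the small-gain inequality can be applied at s.\<close>
  have step: "AE s in lebesgue. s \<in> {\<tau> + 1/c..<t} \<longrightarrow> V (y s) \<le> lam * B + \<Gamma>"
    if B: "0 \<le> B" "AE s in lebesgue. s \<in> {\<tau>..<t} \<longrightarrow> V (y s) \<le> B" and \<tau>: "-1/c \<le> \<tau>" for \<tau> B
    using \<Gamma>(2)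
  proof eventually_elim
    case (elim s)
    show ?case
    proof
      assume s: "s \<in> {\<tau> + 1/c..<t}"
      then have s0: "0 \<le> s" using \<tau> by auto
      have "V (Fhist (w s) (\<lambda>r. y (s + r))) \<le> lam * B + \<gamma> (norm (snd (w s)))"
      proof (rule small_gain_Fhist[OF _ w[OF s0] B(1)])
        show "linf_on {-1/c..<0} (\<lambda>r. y (s + r))"
          by (rule linf_on_history[OF yl s0]) (use s in auto)
        show "AE r in lebesgue. r \<in> {-1/c..<0} \<longrightarrow> V (y (s + r)) \<le> B"
          using AE_lebesgue_translate[OF B(2), of s] by eventually_elim (use s in auto)
      qed
      with elim s0 s show "V (y s) \<le> lam * B + \<Gamma>" by (simp add: yF[OF s0])
    qed
  qed
  have "AE s in lebesgue. s \<in> {(real k - 1)/c..<t} \<longrightarrow> V (y s) \<le> S k" for k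
  proof (induction k)
    case 0
    obtain M where M: "AE s in lebesgue. s \<in> {-1/c..<t} \<longrightarrow> norm (y s) \<le> M"
      using yl by (auto simp: linf_on_def)
    obtain B where B: "\<And>y. norm y \<le> M \<Longrightarrow> V y \<le> B" using V_bounded_on_cball[of M] by blast
    have VB: "AE s in lebesgue. s \<in> {-1/c..<t} \<longrightarrow> V (y s) \<le> B"
      using M by eventually_elim (use B in auto)
    \<comment> \<open>The essential supremum over the entire window is finite since y is essentially
      bounded there. This finiteness permits absorbing lam E into the left-hand side, after which
      the bound involves only M0 and \<Gamma>.\<close>
    define E where "E = esup {-1/c..<t} (\<lambda>s. V (y s))"
    have E: "0 \<le> E" "AE s in lebesgue. s \<in> {-1/c..<t} \<longrightarrow> V (y s) \<le> E"
      unfolding E_def by (rule esup_nonneg[OF VB]) (rule AE_le_esup[OF VB])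
    have "AE s in lebesgue. s \<in> {-1/c..<t} \<longrightarrow> V (y s) \<le> max M0 (lam * E + \<Gamma>)"
      using step[OF E order_refl] M0(2) by eventually_elim auto
    then have "E \<le> max M0 (lam * E + \<Gamma>)"
      unfolding E_def[symmetric] using M0(1) by (subst E_def, intro esup_le) auto
    then have "E \<le> M0 + \<Gamma> / (1 - lam)"
    proof (cases "E \<le> M0")
      case True
      then show ?thesis using \<Gamma>(1) lam by (simp add: add_increasing2)
    next
      case False
      with \<open>E \<le> max M0 (lam * E + \<Gamma>)\<close> have "E * (1 - lam) \<le> \<Gamma>" by (simp add: algebra_simps)
      then have "E \<le> \<Gamma> / (1 - lam)" using lam by (simp add: pos_le_divide_eq)
      then show ?thesis using M0(1) by simp
    qed
    then show ?case using E(2) by (auto simp: S_def elim!: eventually_mono)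
  next
    case (Suc k)
    have "(real k - 1)/c + 1/c = (real (Suc k) - 1)/c" by (simp add: diff_divide_distrib)
    moreover have "-1/c \<le> (real k - 1)/c" using c_pos by (intro divide_right_mono) auto
    \<comment> \<open>\<Gamma>/(1 - lam) is the fixed point of the map from s to lam s + \<Gamma>,
      so only the term from the initial data contracts.\<close>
    moreover have "lam * S k + \<Gamma> = S (Suc k)"
      using lam by (simp add: S_def field_simps)
    ultimately show ?case using step[OF S0 Suc] by simp
  qed
  then show ?thesis by (simp add: S_def)
qed

section \<open>Input term and stability estimates\<close>

definition Gam :: "real \<Rightarrow> (real \<Rightarrow> 'u) \<Rightarrow> real" where
  "Gam t u = esup {0..t} (\<lambda>s. \<gamma> (norm (u s)))"

text \<open>The gain of an essential supremum must be bounded by an essential supremum of gains,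
  although \<open>gain\<close> may jump. If the bound failed, monotonicity would force \<gamma>(|u|)
  to stay at least one unit below \<open>Gam t u\<close> almost everywhere. That contradicts the
  minimality of the essential supremum if \<open>Gam t u\<close> is at least 1, and \<gamma> \<ge> 0
  otherwise.\<close>

lemma esup_gain_input:
  assumes \<phi>: "mono_on {0..} \<phi>" "\<And>s. 0 \<le> s \<Longrightarrow> gain (2 * (s + 1) / (1 - lam)) \<le> \<phi> s"
    and u: "linf_on {0..t} u" and t: "0 < t"
  shows "gain (2 * Gam t u / (1 - lam)) \<le> esup {0..t} (\<lambda>s. \<phi> (\<gamma> (norm (u s))))"
    "0 \<le> Gam t u" "AE s in lebesgue. s \<in> {0..t} \<longrightarrow> \<gamma> (norm (u s)) \<le> Gam t u"
proof -
  obtain B where B: "0 \<le> B" "AE s in lebesgue. s \<in> {0..t} \<longrightarrow> norm (u s) \<le> B"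
    by (rule linf_on_AE_bound[OF u])
  have \<gamma>B: "AE s in lebesgue. s \<in> {0..t} \<longrightarrow> \<gamma> (norm (u s)) \<le> \<gamma> B"
    using B(2) by eventually_elim (use \<gamma>_mono B(1) in \<open>auto simp: mono_on_def\<close>)
  have \<phi>B: "AE s in lebesgue. s \<in> {0..t} \<longrightarrow> \<phi> (\<gamma> (norm (u s))) \<le> \<phi> (\<gamma> B)"
    using \<gamma>B by eventually_elim (use \<phi>(1) B(1) \<gamma>_nonneg in \<open>auto simp: mono_on_def\<close>)
  show \<Gamma>0: "0 \<le> Gam t u" unfolding Gam_def by (rule esup_nonneg[OF \<gamma>B])
  show "AE s in lebesgue. s \<in> {0..t} \<longrightarrow> \<gamma> (norm (u s)) \<le> Gam t u"
    unfolding Gam_def by (rule AE_le_esup[OF \<gamma>B])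
  let ?e = "esup {0..t} (\<lambda>s. \<phi> (\<gamma> (norm (u s))))"
  have e: "AE s in lebesgue. s \<in> {0..t} \<longrightarrow> \<phi> (\<gamma> (norm (u s))) \<le> ?e"
    by (rule AE_le_esup[OF \<phi>B])
  show "gain (2 * Gam t u / (1 - lam)) \<le> ?e"
  proof (rule ccontr)
    assume neg: "\<not> gain (2 * Gam t u / (1 - lam)) \<le> ?e"
    have small: "AE s in lebesgue. s \<in> {0..t} \<longrightarrow> \<gamma> (norm (u s)) \<le> Gam t u - 1"
      using e
    proof eventually_elim
      case (elim s)
      show ?case
      proof (intro impI, rule ccontr)
        assume s: "s \<in> {0..t}" and "\<not> \<gamma> (norm (u s)) \<le> Gam t u - 1"
        then have "2 * Gam t u / (1 - lam) \<le> 2 * (\<gamma> (norm (u s)) + 1) / (1 - lam)"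
          using lam by (intro divide_right_mono) auto
        then have "gain (2 * Gam t u / (1 - lam)) \<le> gain (2 * (\<gamma> (norm (u s)) + 1) / (1 - lam))"
          using \<Gamma>0 lam by (intro gain_mono) auto
        also have "\<dots> \<le> \<phi> (\<gamma> (norm (u s)))" using \<gamma>_nonneg by (intro \<phi>(2)) auto
        finally show False using elim s neg by auto
      qed
    qed
    show False
    proof (cases "1 \<le> Gam t u")
      case True
      then have "Gam t u \<le> Gam t u - 1" using small unfolding Gam_def by (intro esup_le) auto
      then show False by simp
    next
      case False
      have "AE s in lebesgue. s \<notin> {0..t}"
        using small
      proof eventually_elim
        case (elim s)
        have "0 \<le> \<gamma> (norm (u s))" using \<gamma>_nonneg by simp
        with elim False show ?case by (auto simp del: atLeastAtMost_iff)
      qed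
      from AE_notin_Icc_imp_nonpos[OF this] t show False by simp
    qed
  qed
qed

text \<open>For t \<ge> k/c the past seen at time t lies in the window where V has contracted k
  times. The resulting level is a decaying term from the initial data plus a term from the input,
  and \<open>gain_add_le\<close> splits the two.\<close>

lemma solution_estimate:
  assumes \<phi>: "mono_on {0..} \<phi>" "\<And>s. 0 \<le> s \<Longrightarrow> gain (2 * (s + 1) / (1 - lam)) \<le> \<phi> s"
    and x0: "linf_on {0..1} x0" and r: "esup {0..1} (\<lambda>z. \<bar>x0 z\<bar>) \<le> r"
    and adm: "adm_inputs D U d u" and sol: "is_global_sol c a g K G x0 d u x"
    and M0: "0 \<le> M0" "\<And>y. norm y \<le> exp (abound 0 / c) * r \<Longrightarrow> V y \<le> M0"
    and t: "0 < t" "real k / c \<le> t"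
  shows "esup {0..1} (\<lambda>z. \<bar>x t z\<bar>) \<le> gain (2 * (lam ^ k * M0)) + esup {0..t} (\<lambda>s. \<phi> (\<gamma> (norm (u s))))"
proof -
  obtain y where yh: "\<And>s. s < 0 \<Longrightarrow> y s = init_history x0 s"
    and yl: "\<And>T. 0 < T \<Longrightarrow> linf_on {-1/c..<T} y"
    and yF: "\<And>t. 0 \<le> t \<Longrightarrow> y t = Fhist (d t, u t) (\<lambda>s. y (t + s))"
    and X: "\<And>t. 0 \<le> t \<Longrightarrow> AE z in lebesgue. z \<in> {0..1} \<longrightarrow> x t z = Xhist (\<lambda>s. y (t + s)) z"
    by (rule solution_history[OF x0 adm sol]) (rule that)
  have u: "linf_on {0..t} u" using adm t by (auto simp: adm_inputs_def)
  note \<Gamma> = esup_gain_input[OF \<phi> u t(1)]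
  obtain B where B: "AE z in lebesgue. z \<in> {0..1} \<longrightarrow> \<bar>x0 z\<bar> \<le> B"
    using x0 by (auto simp: linf_on_def)
  have x0r: "AE z in lebesgue. z \<in> {0..1} \<longrightarrow> \<bar>x0 z\<bar> \<le> r"
    using AE_le_esup[OF B] by eventually_elim (use r in auto)
  have VM0: "AE s in lebesgue. s \<in> {-1/c..<0} \<longrightarrow> V (y s) \<le> M0"
    using init_history_AE_bound[OF x0r] by eventually_elim (use M0(2) yh in auto)
  define A where "A = lam ^ k * M0"
  define C where "C = Gam t u / (1 - lam)"
  have AC: "0 \<le> A" "0 \<le> C" using lam M0(1) \<Gamma>(2) by (simp_all add: A_def C_def)
  have "AE s in lebesgue. s \<in> {(real k - 1)/c..<t} \<longrightarrow> V (y s) \<le> A + C"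
    unfolding A_def C_def
  proof (rule V_decay[where w = "\<lambda>s. (d s, u s)"])
    show "(d s, u s) \<in> D \<times> U" if "0 \<le> s" for s using adm that by (auto simp: adm_inputs_def)
  qed (use yl t M0 VM0 \<Gamma> yF in auto)
  from AE_lebesgue_translate[OF this, of t]
  have "AE s in lebesgue. s \<in> {-1/c..<0} \<longrightarrow> norm (y (t + s)) \<le> radius (A + C)"
  proof eventually_elim
    case (elim s)
    show ?case
    proof
      assume s: "s \<in> {-1/c..<0}"
      have "(real k - 1)/c = real k / c + -1/c" by (simp add: diff_divide_distrib)
      also have "\<dots> \<le> t + s" using s t by (intro add_mono) auto
      finally show "norm (y (t + s)) \<le> radius (A + C)"
        using elim s by (intro norm_le_radius) auto
    qed
  qed
  from Xhist_bound_AE[OF this] AC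
  have "AE z in lebesgue. z \<in> {0..1} \<longrightarrow> \<bar>Xhist (\<lambda>s. y (t + s)) z\<bar> \<le> gain (A + C)"
    by (simp add: gain_def radius_nonneg)
  then have "AE z in lebesgue. z \<in> {0..1} \<longrightarrow> \<bar>x t z\<bar> \<le> gain (A + C)"
    using X[of t] t by (auto elim: eventually_elim2)
  then have "esup {0..1} (\<lambda>z. \<bar>x t z\<bar>) \<le> gain (A + C)"
    using AC by (intro esup_le gain_nonneg) auto
  also have "\<dots> \<le> gain (2 * A) + gain (2 * C)" by (rule gain_add_le[OF AC])
  also have "gain (2 * C) \<le> esup {0..t} (\<lambda>s. \<phi> (\<gamma> (norm (u s))))"
    using \<Gamma>(1) by (simp add: C_def)
  finally show ?thesis by (simp add: A_def)
qed

text \<open>Time 0 is separate because the essential supremum of the input over a single point is 0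
  and cannot absorb an input term. For z > 0 the solution formula at time 0 reduces to the initial
  profile.\<close>

lemma initial_estimate:
  assumes x0: "linf_on {0..1} x0" and r: "esup {0..1} (\<lambda>z. \<bar>x0 z\<bar>) \<le> r" "0 \<le> r"
    and sol: "is_global_sol c a g K G x0 d u x"
  shows "esup {0..1} (\<lambda>z. \<bar>x 0 z\<bar>) \<le> r"
proof (rule esup_le[OF r(2)])
  obtain B where B: "AE z in lebesgue. z \<in> {0..1} \<longrightarrow> \<bar>x0 z\<bar> \<le> B"
    using x0 by (auto simp: linf_on_def)
  have "AE z in lebesgue. z \<in> {0..1} \<longrightarrow> x 0 z =
      char_formula x0 (\<lambda>t. fst (Out (d t, u t) (x t))) (\<lambda>t. snd (Out (d t, u t) (x t))) 0 z"
    using sol unfolding is_global_sol_iff by blast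
  then show "AE z in lebesgue. z \<in> {0..1} \<longrightarrow> \<bar>x 0 z\<bar> \<le> r"
    using AE_le_esup[OF B] AE_lebesgue_neq[of 0]
  proof eventually_elim
    case (elim z)
    show ?case
    proof
      assume z: "z \<in> {0..1}"
      with elim c_pos have "max 0 (0 - z/c) = 0" "\<not> z \<le> c * 0" by auto
      then have "x 0 z = x0 z" using elim z by (simp add: char_formula_def)
      with elim z r show "\<bar>x 0 z\<bar> \<le> r" by auto
    qed
  qed
qed

theorem ISS_delay_system: "ISS c a g K G D U"
proof -
  \<comment> \<open>The shift by 1 in the majorant of this function is exactly the slack that
    \<open>esup_gain_input\<close> consumes.\<close>
  have "mono_on {0..} (\<lambda>s. gain (2 * s / (1 - lam)))"
    using lam by (intro mono_onI gain_mono divide_right_mono) auto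
  then obtain \<phi> where \<phi>c: "continuous_on {0..} \<phi>" and \<phi>m: "mono_on {0..} \<phi>"
    and \<phi>: "\<And>s. 0 \<le> s \<Longrightarrow> gain (2 * (s + 1) / (1 - lam)) \<le> \<phi> s"
    using mono_on_continuous_majorant by blast
  define gt where "gt s = \<phi> (\<gamma> s)" for s
  have \<gamma>0: "\<gamma> s \<in> {0..}" if "s \<in> {0..}" for s using \<gamma>_nonneg that by simp
  have gt_nonneg: "0 \<le> gt s" if "0 \<le> s" for s
  proof -
    have "0 \<le> gain (2 * (\<gamma> s + 1) / (1 - lam))" using \<gamma>_nonneg that lam by (intro gain_nonneg) auto
    with \<phi>[of "\<gamma> s"] \<gamma>_nonneg that show ?thesis by (simp add: gt_def)
  qed
  \<comment> \<open>This covers all three ISS properties: k counts the delays that have certainly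
    elapsed by T0, and the disjunction admits t = 0 only when r itself is an acceptable
    bound.\<close>
  have est: "Sup (iss_vals c a g K G D U gt T0 r) \<le> ereal E"
    if M0: "0 \<le> M0" "\<And>y. norm y \<le> exp (abound 0 / c) * r \<Longrightarrow> V y \<le> M0"
      and T0: "real k / c \<le> T0" and E: "gain (2 * (lam ^ k * M0)) \<le> E" "0 < T0 \<or> (0 \<le> r \<and> r \<le> E)" "0 \<le> T0"
    for T0 r M0 E and k :: nat
  proof (rule Sup_least)
    fix e assume "e \<in> iss_vals c a g K G D U gt T0 r"
    then obtain t x0 d u x where e: "e = ereal (esup {0..1} (\<lambda>z. \<bar>x t z\<bar>) - esup {0..t} (\<lambda>s. gt (norm (u s))))"
      and t: "T0 \<le> t" and x0: "linf_on {0..1} x0" "esup {0..1} (\<lambda>z. \<bar>x0 z\<bar>) \<le> r"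
      and adm: "adm_inputs D U d u" and sol: "is_global_sol c a g K G x0 d u x"
      unfolding iss_vals_def by blast
    show "e \<le> ereal E"
    proof (cases "0 < t")
      case True
      have "esup {0..1} (\<lambda>z. \<bar>x t z\<bar>) \<le> gain (2 * (lam ^ k * M0)) + esup {0..t} (\<lambda>s. gt (norm (u s)))"
        unfolding gt_def
        by (rule solution_estimate[OF \<phi>m \<phi> x0 adm sol M0 True]) (use T0 t in auto)
      with E(1) show ?thesis by (simp add: e)
    next
      case False
      with E t have t0: "t = 0" and r: "0 \<le> r" "r \<le> E" by auto
      have "AE s in lebesgue. s \<in> {0..0::real} \<longrightarrow> gt (norm (u s)) \<le> gt (norm (u 0))"
        by (intro always_eventually) auto
      then have "0 \<le> esup {0..0} (\<lambda>s. gt (norm (u s)))" by (rule esup_nonneg)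
      with initial_estimate[OF x0 r(1) sol] r show ?thesis by (simp add: e t0)
    qed
  qed
  have e0: "0 < exp (abound 0 / c)" by simp
  show ?thesis
    unfolding ISS_def
  proof (intro conjI allI impI exI[of _ gt])
    show "\<exists>x. is_global_sol c a g K G x0 d u x" if "linf_on {0..1} x0 \<and> adm_inputs D U d u" for x0 d u
      using solution_exists that by blast
    show "continuous_on {0..} gt"
      unfolding gt_def by (rule continuous_on_compose2[OF \<phi>c \<gamma>_cont]) (use \<gamma>0 in blast)
    show "mono_on {0..} gt"
      unfolding gt_def using \<phi>m \<gamma>_mono \<gamma>0 by (auto simp: mono_on_def)
    show "0 \<le> gt s" if "0 \<le> s" for s by (rule gt_nonneg[OF that])
    show "Sup (iss_vals c a g K G D U gt 0 r) < \<infinity>" if "0 < r" for r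
    proof -
      obtain M0 where M0: "0 \<le> M0" "\<And>y. norm y \<le> exp (abound 0 / c) * r \<Longrightarrow> V y \<le> M0"
        using V_bounded_on_cball by blast
      define E where "E = max r (gain (2 * M0))"
      have "Sup (iss_vals c a g K G D U gt 0 r) \<le> ereal E"
        by (rule est[OF M0, where k = 0]) (use that in \<open>auto simp: E_def\<close>)
      then show ?thesis by (rule le_less_trans) simp
    qed
    show "\<exists>\<delta>>0. Sup (iss_vals c a g K G D U gt 0 \<delta>) < ereal \<epsilon>" if eps: "0 < \<epsilon>" for \<epsilon>
    proof -
      obtain \<eta> where \<eta>: "0 < \<eta>" "gain (2 * \<eta>) \<le> \<epsilon> / 2" using gain_small[of "\<epsilon> / 2"] eps by auto
      obtain \<rho> where \<rho>: "0 < \<rho>" "\<And>y. norm y \<le> \<rho> \<Longrightarrow> V y \<le> \<eta>" using V_small_near_zero[OF \<eta>(1)] by blast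
      \<comment> \<open>The second entry keeps the encoded past within radius \<rho> after
        amplification by exp(abound 0 / c); the first one takes care of time 0. Aiming at
        \<epsilon>/2 makes the bound on the supremum strict.\<close>
      define \<delta> where "\<delta> = min (\<epsilon> / 2) (\<rho> / exp (abound 0 / c))"
      have \<delta>: "0 < \<delta>" using eps \<rho> by (simp add: \<delta>_def)
      have \<delta>\<epsilon>: "\<delta> \<le> \<epsilon> / 2" unfolding \<delta>_def by (rule min.cobounded1)
      have "\<delta> \<le> \<rho> / exp (abound 0 / c)" by (simp add: \<delta>_def)
      then have "exp (abound 0 / c) * \<delta> \<le> \<rho>" by (simp add: field_simps)
      then have "V y \<le> \<eta>" if "norm y \<le> exp (abound 0 / c) * \<delta>" for y using \<rho>(2) that by simp
      then have "Sup (iss_vals c a g K G D U gt 0 \<delta>) \<le> ereal (\<epsilon> / 2)"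
        by (rule est[OF less_imp_le[OF \<eta>(1)], where k = 0]) (use \<eta> \<delta> \<delta>\<epsilon> in auto)
      moreover have "ereal (\<epsilon> / 2) < ereal \<epsilon>" using eps by simp
      ultimately show ?thesis using \<delta> le_less_trans by blast
    qed
    show "\<exists>\<tau>>0. Sup (iss_vals c a g K G D U gt \<tau> R) < ereal \<epsilon>" if eps: "0 < \<epsilon>" and R: "0 \<le> R" for \<epsilon> R
    proof -
      obtain \<eta> where \<eta>: "0 < \<eta>" "gain (2 * \<eta>) \<le> \<epsilon> / 2" using gain_small[of "\<epsilon> / 2"] eps by auto
      obtain M0 where M0: "0 \<le> M0" "\<And>y. norm y \<le> exp (abound 0 / c) * R \<Longrightarrow> V y \<le> M0"
        using V_bounded_on_cball by blast
      have "(\<lambda>k. lam ^ k * M0) \<longlonglongrightarrow> 0"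
        using lam by (intro tendsto_mult_left_zero LIMSEQ_realpow_zero) auto
      from order_tendstoD(2)[OF this \<eta>(1)] obtain k where k: "lam ^ k * M0 < \<eta>"
        by (auto simp: eventually_sequentially)
      \<comment> \<open>The summand 1 makes \<tau> positive even for k = 0, which excludes time 0
        from the estimate.\<close>
      define \<tau> where "\<tau> = real k / c + 1"
      have \<tau>: "0 < \<tau>" "real k / c \<le> \<tau>" using c_pos by (auto simp: \<tau>_def add_nonneg_pos)
      have "gain (2 * (lam ^ k * M0)) \<le> gain (2 * \<eta>)" using k lam M0(1) by (intro gain_mono) auto
      then have "Sup (iss_vals c a g K G D U gt \<tau> R) \<le> ereal (\<epsilon> / 2)"
        by (intro est[OF M0 \<tau>(2)]) (use \<eta> \<tau> in auto)
      moreover have "ereal (\<epsilon> / 2) < ereal \<epsilon>" using eps by simp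
      ultimately show ?thesis using \<tau>(1) le_less_trans by blast
    qed
  qed
qed

end

theorem theorem3p6:
  fixes c lam :: real
    and D :: "'d::euclidean_space set" and U :: "'u::euclidean_space set"
    and a :: "real^'n::finite \<Rightarrow> real \<Rightarrow> real"
    and g :: "'n \<Rightarrow> real \<Rightarrow> real"
    and K :: "'n \<Rightarrow> ('d \<times> 'u) \<Rightarrow> (real \<Rightarrow> real) \<Rightarrow> real"
    and G :: "('d \<times> 'u) \<Rightarrow> (real \<Rightarrow> real) \<Rightarrow> real"
    and V :: "(real^'n) \<times> real \<Rightarrow> real"
    and \<gamma> :: "real \<Rightarrow> real"
  assumes c_pos: "c > 0"
    and D_compact: "compact D"
    and U_lc: "locally compact U" and U_zero: "0 \<in> U"
    and a_cont: "continuous_on (UNIV \<times> {0..1}) (\<lambda>(p, z). a p z)"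
    and a_loclip: "\<forall>y\<in>UNIV \<times> {0..1}. \<exists>r>0. \<exists>L.
                     L-lipschitz_on (ball y r \<inter> (UNIV \<times> {0..1})) (\<lambda>(p, z). a p z)"
    and g_cont: "\<forall>i. continuous_on {0..1} (g i)"
    and A1: "\<exists>L \<sigma> :: real \<Rightarrow> real.
       mono_on {0..} L \<and> mono_on {0..} \<sigma> \<and> (\<forall>R\<ge>0. 0 \<le> L R \<and> 0 \<le> \<sigma> R) \<and>
       (\<forall>R\<ge>0. \<forall>h\<in>{0<..<1}. \<forall>w\<in>D \<times> U. \<forall>x y. norm w \<le> R \<longrightarrow>
          linf_on {0<..1} x \<longrightarrow> (AE z in lebesgue. z \<in> {0<..1} \<longrightarrow> \<bar>x z\<bar> \<le> R) \<longrightarrow>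
          linf_on {0<..1} y \<longrightarrow> (AE z in lebesgue. z \<in> {0<..1} \<longrightarrow> \<bar>y z\<bar> \<le> R) \<longrightarrow>
          \<bar>G w x - G w y\<bar> + (\<Sum>i\<in>UNIV. \<bar>K i w x - K i w y\<bar>)
            \<le> L R * h * esup {0<..h} (\<lambda>z. \<bar>x z - y z\<bar>)
              + L R * esup {h<..1} (\<lambda>z. \<bar>x z - y z\<bar>) \<and>
          \<bar>G w x\<bar> + (\<Sum>i\<in>UNIV. \<bar>K i w x\<bar>) \<le> \<sigma> R)"
    and A2: "\<forall>\<delta>>0. \<forall>(p :: real \<Rightarrow> real^'n) (v :: real \<Rightarrow> real) (w :: real \<Rightarrow> 'd \<times> 'u).
       linf_on {-1/c..<\<delta>} (\<lambda>t. (p t, v t)) \<longrightarrow> linf_on {0..<\<delta>} w \<longrightarrow>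
       (\<forall>t\<in>{0..<\<delta>}. w t \<in> D \<times> U) \<longrightarrow>
       linf_on {-1/c..<\<delta>} (\<lambda>t. if t < 0 then (p t, v t)
          else Fmap c a g K G (fst (w t)) (snd (w t)) (\<lambda>s. p (t + s)) (\<lambda>s. v (t + s)))"
    and A3: "\<exists>b. K_inf b \<and> (\<forall>x. linf_on {0..1} x \<longrightarrow> (\<forall>d\<in>D. \<forall>u\<in>U.
       \<bar>G (d, u) x\<bar> + (\<Sum>i\<in>UNIV. \<bar>K i (d, u) x\<bar>)
         \<le> b (max (norm u) (esup {0..1} (\<lambda>z. \<bar>x z\<bar>)))))"
    and V_cont: "continuous_on UNIV V"
    and V_nonneg: "\<forall>y. 0 \<le> V y"
    and V_posdef: "V 0 = 0" "\<forall>y. y \<noteq> 0 \<longrightarrow> V y > 0"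
    and V_radunb: "filterlim V at_top at_infinity"
    and \<gamma>_cont: "continuous_on {0..} \<gamma>" and \<gamma>_mono: "mono_on {0..} \<gamma>"
    and \<gamma>_nonneg: "\<forall>s\<ge>0. 0 \<le> \<gamma> s"
    and lam: "0 < lam" "lam < 1"
    and small_gain: "\<forall>p v. linf_on {-1/c..<0} (\<lambda>s. (p s, v s)) \<longrightarrow> (\<forall>d\<in>D. \<forall>u\<in>U.
       V (Fmap c a g K G d u p v)
         \<le> lam * esup {-1/c..<0} (\<lambda>s. V (p s, v s)) + \<gamma> (norm u))"
  shows "ISS c a g K G D U"
proof -
  interpret delay_system c a g D U K G V \<gamma> lam
    by unfold_locales (fact assms)+
  show ?thesis by (rule ISS_delay_system)
qed

end
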